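(* Let $m\geq 2$ and $n\geq 1$ be integers, and suppose that $$v_2\big(\operatorname{tr}(P_{m+1,n})\big)\leq m+1+\frac{3n}{2}.$$ If $P_{m,n}$ is $2$-special, then $P_{m+1,n}$ is also $2$-special.
   Context: Let $a_i=a_i(c)\in\mathbb{Z}[c]$ be defined by $a_0=0$ and $a_i=a_{i-1}^2+c$ (i.e. $a_i=f_c^i(0)$ with $f_c(z)=z^2+c$). $\mu$ is the Möbius function. For $m\geq 2$, $n\geq 1$, $G_{m,n}\in\mathbb{Z}[c]$ is $\prod_{k\mid n}(a_{m+k-1}+a_{m-1})^{\mu(n/k)}$ if $n\nmid m-1$, and $\prod_{k\mid n}(a_{m+k-1}+a_{m-1})^{\mu(n/k)}\prod_{k\mid n}a_k^{-\mu(n/k)}$ if $n\mid m-1$ (a monic integer polynomial). For a root $\alpha$ of $G_{m,n}$, $\lambda_{m,n}(\alpha)=2^n\prod_{i=0}^{n-1}a_{m+i}(\alpha)$, and $P_{m,n}(x)=\prod_j(x-\lambda_{m,n}(\alpha_j))\in\mathbb{Z}[x]$ over all roots $\alpha_j$ of $G_{m,n}$ with multiplicity. For a monic polynomial $P$, $\operatorname{tr}(P)$ is the sum of its roots. $v_p$ is the $p$-adic valuation on $\mathbb{Z}$ with $v_p(p)=1$. A monic polynomial $P(x)=x^i+A_{i-1}x^{i-1}+\cdots+A_0\in\mathbb{Z}[x]$ is called $p$-special (for a prime $p$) if $v_p(A_{i-1})>v_p(2)$ and $v_p(A_j)>v_p(A_{i-1})$ for all $j=0,1,\ldots,i-2$.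 *)

theory Defs
  imports
    "HOL-Computational_Algebra.Computational_Algebra"
    "HOL-Library.Extended_Real"
begin

definition moebius_mu :: "nat \<Rightarrow> int" where
  "moebius_mu n = (if squarefree n then (-1) ^ card (prime_factors n) else 0)"

text \<open>The variable \<open>[:0, 1:]\<close> of the polynomial ring is the parameter \<open>c\<close> of \<open>z^2 + c\<close>.\<close>

fun crit_orbit :: "nat \<Rightarrow> int poly" where
  "crit_orbit 0 = 0"
| "crit_orbit (Suc i) = crit_orbit i ^ 2 + [:0, 1:]"

definition misiurewicz_quot :: "nat \<Rightarrow> nat \<Rightarrow> int poly fract" where
  "misiurewicz_quot m n =
     (\<Prod>k | k dvd n. to_fract (crit_orbit (m + k - 1) + crit_orbit (m - 1)) powi moebius_mu (n div k)) *
     (if n dvd m - 1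
      then \<Prod>k | k dvd n. to_fract (crit_orbit k) powi (- moebius_mu (n div k))
      else 1)"

text \<open>The polynomial \<open>G\<close> with integer coefficients that the quotient above represents
  (\<^const>\<open>to_fract\<close> is injective, so there is at most one).\<close>

definition misiurewicz_poly :: "nat \<Rightarrow> nat \<Rightarrow> int poly" where
  "misiurewicz_poly m n = (THE G. to_fract G = misiurewicz_quot m n)"

definition cycle_multiplier :: "nat \<Rightarrow> nat \<Rightarrow> complex \<Rightarrow> complex" where
  "cycle_multiplier m n \<alpha> =
     2 ^ n * (\<Prod>i<n. poly (map_poly of_int (crit_orbit (m + i))) \<alpha>)"

text \<open>The polynomial \<open>P\<close> with integer coefficients whose image over the complex numbers is the
  displayed product; \<^const>\<open>proots\<close> counts roots with multiplicity.\<close>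

definition multiplier_poly :: "nat \<Rightarrow> nat \<Rightarrow> int poly" where
  "multiplier_poly m n =
     (THE P. map_poly of_int P =
        (\<Prod>\<alpha>\<in>#proots (map_poly of_int (misiurewicz_poly m n)). [:- cycle_multiplier m n \<alpha>, 1:]))"

text \<open>The sum of the complex roots, which is an integer for monic \<open>P\<close>.\<close>

definition root_trace :: "int poly \<Rightarrow> int" where
  "root_trace P = (THE t. (of_int t :: complex) = (\<Sum>z\<in>#proots (map_poly of_int P). z))"

text \<open>The \<open>p\<close>-adic valuation, with value \<open>\<infinity>\<close> at \<open>0\<close>.\<close>

definition padic_val :: "nat \<Rightarrow> int \<Rightarrow> ereal" where
  "padic_val p x = (if x = 0 then \<infinity> else ereal (real (multiplicity (int p) x)))"

text \<open>The coefficient below the leading one must exist, hence the positive degree.\<close>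

definition special_poly :: "nat \<Rightarrow> int poly \<Rightarrow> bool" where
  "special_poly p P \<longleftrightarrow>
     lead_coeff P = 1 \<and> degree P > 0 \<and>
     padic_val p (coeff P (degree P - 1)) > padic_val p 2 \<and>
     (\<forall>j. j + 2 \<le> degree P \<longrightarrow> padic_val p (coeff P j) > padic_val p (coeff P (degree P - 1)))"

end

theory Submission
  imports Defs "Jordan_Normal_Form.Char_Poly" "HOL-Computational_Algebra.Polynomial_FPS"
begin

text \<open>Let \<open>x_j\<close> be the values of \<open>a_m a_(m+1) ... a_(m+n-1)\<close> at the roots of \<open>G_(m,n)\<close>, so that the multipliers are
  \<open>2^n x_j\<close>. Modulo 2 the factor \<open>a_(m+k-1) + a_(m-1)\<close> of \<open>G_(m,n)\<close> is a power of \<open>a_k\<close>, so the product is nilpotent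
  modulo that factor and 2. Hence the elementary symmetric functions of the \<open>x_j\<close> are even, and \<open>2^(n k + 1)\<close>
  divides the \<open>k\<close>-th elementary symmetric function of the multipliers.

  The sum of a product of few orbit points over the roots \<open>c\<close> of \<open>f_c^d(a_m/t) = a_m/t\<close> is a Laurent polynomial in \<open>t\<close>
  whose growth at \<open>0\<close> and \<open>\<infinity>\<close> forces it to be constant. Comparing \<open>t = 1\<close> with \<open>t = -1\<close> shows that the power sums
  of the multipliers double from \<open>m\<close> to \<open>m + 1\<close> in degrees \<open>k\<close> with \<open>n k + 1 < 2^(m-1)\<close>, so by Newton's identities
  \<open>P_(m+1,n)\<close> and \<open>P_(m,n)^2\<close> have the same \<open>k\<close>-th coefficient below the leading one, and the condition of being
  2-special passes to the square.

  Let \<open>v\<close> be the valuation of the trace of \<open>P_(m+1,n)\<close>. The coefficients with \<open>n k \<ge> v\<close> are settled by the divisibility.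
  By the bound on \<open>v\<close>, those with \<open>n k < v\<close> lie in the range of doubling up to finitely many \<open>(m,n)\<close>. For
  these the trace is computed modulo a power of 2, and it turns out that \<open>n k < v\<close> never happens for \<open>k \<ge> 2\<close> outside
  the range of doubling.\<close>

hide_const (open) Module.smult

text \<open>Since a_k divides the product a_m ... a_(m+n-1) for every k dividing n, the periodic
  factors of G contribute nothing to power sums, and a sum over the roots of G is a Moebius
  combination of sums over the roots of A_m = a_(m+d-1) + a_(m-1) for d dividing n. The growth of
  the t-family comes from dynamics. At a root c the point a_m/t is periodic, so its orbit is bounded
  by 1 + sqrt |c|, while a_m has degree 2^(m-1) in c. Hence |t| grows at least like |c|^((2^m -
  1)/2), and a product of weight N, where orbit points count one and c counts two, is O(|t|^(N/(2^m
  - 1))). For N < 2^m - 1 the exponent is below 1. Put B_m = a_(m+d) - a_m. Constancy equates the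
  traces over A_(m+1) and B_m. As B_m = A_m B_(m-1), constancy one level lower, applied to the two
  factors, produces the doubling; this second use is why the range is governed by 2^(m-1) and not by
  2^m. For the leftover pairs the obstacle is to evaluate traces of powers of the product. On a
  cycle such powers reduce to products of distinct points, and those over a proper nonempty part of
  the cycle have trace 0.\<close>

subsection \<open>Symmetric functions of the values at the roots of a polynomial\<close>

definition newton_basis :: "'a::comm_ring_1 list \<Rightarrow> nat \<Rightarrow> 'a poly" where
  "newton_basis rs i = (\<Prod>a\<leftarrow>take i rs. [:-a, 1:])"

lemma newton_basis_0 [simp]: "newton_basis rs 0 = 1"
  by (simp add: newton_basis_def)

lemma newton_basis_Cons_Suc [simp]: "newton_basis (a # rs) (Suc i) = [:-a, 1:] * newton_basis rs i"
  by (simp add: newton_basis_def)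

lemma newton_basis_add:
  "newton_basis rs (i + k) = newton_basis rs i * newton_basis (drop i rs) k"
  by (simp add: newton_basis_def take_add)

lemma newton_basis_monic:
  fixes rs :: "'a::idom list"
  assumes "i \<le> length rs"
  shows "degree (newton_basis rs i) = i \<and> lead_coeff (newton_basis rs i) = 1"
  using assms
proof (induction rs arbitrary: i)
  case (Cons a rs)
  show ?case
  proof (cases i)
    case (Suc j)
    with Cons have *: "degree (newton_basis rs j) = j" "coeff (newton_basis rs j) j = 1"
      by fastforce+
    hence "newton_basis rs j \<noteq> 0" by auto
    hence "degree ([:-a, 1:] * newton_basis rs j) = Suc j"
      by (subst degree_mult_eq) (auto simp: *)
    moreover have "lead_coeff ([:-a, 1:] * newton_basis rs j) = 1"
      by (subst lead_coeff_mult) (simp add: *)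
    ultimately show ?thesis by (simp add: Suc del: mult_pCons_left)
  qed auto
qed auto

lemma newton_expansion:
  fixes f :: "'a::idom poly"
  shows "\<exists>c q. f = (\<Sum>k<length rs. smult (c k) (newton_basis rs k)) + q * newton_basis rs (length rs)
            \<and> (rs \<noteq> [] \<longrightarrow> c 0 = poly f (hd rs))"
proof (induction rs arbitrary: f)
  case Nil
  thus ?case by simp
next
  case (Cons a rs)
  define g where "g = synthetic_div f a"
  have f: "f = [:poly f a:] + [:-a, 1:] * g"
    using synthetic_div_correct'[of a f] by (simp add: g_def add.commute)
  obtain c q where cq: "g = (\<Sum>k<length rs. smult (c k) (newton_basis rs k)) + q * newton_basis rs (length rs)"
    using Cons[of g] by blast
  define c' where "c' = case_nat (poly f a) c"
  have "f = [:poly f a:] + [:-a, 1:] * ((\<Sum>k<length rs. smult (c k) (newton_basis rs k)) + q * newton_basis rs (length rs))"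
    using f cq by simp
  also have "\<dots> = (\<Sum>k<length (a # rs). smult (c' k) (newton_basis (a # rs) k))
      + q * newton_basis (a # rs) (length (a # rs))"
    unfolding length_Cons sum.lessThan_Suc_shift
    by (simp add: c'_def distrib_left sum_distrib_left mult.left_commute del: mult_pCons_left)
  finally show ?case
    by (intro exI[of _ c'] exI[of _ q]) (simp add: c'_def)
qed

text \<open>Expanding \<open>H\<close> in the Newton basis of the remaining roots
  \<open>drop i rs\<close> produces only basis elements of index at least \<open>i\<close>, and the
  first coefficient is the value of \<open>H\<close> at the next root. This is the triangularity of
  multiplication by \<open>H\<close>.\<close>

lemma newton_basis_times:
  fixes H :: "'a::idom poly"
  assumes "i < length rs"
  shows "\<exists>t. (\<forall>k<i. t k = 0) \<and> t i = poly H (rs ! i) \<and>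
          newton_basis rs (length rs) dvd newton_basis rs i * H - (\<Sum>k<length rs. smult (t k) (newton_basis rs k))"
proof -
  define D where "D = length rs - i"
  have len: "length (drop i rs) = D" "length rs = i + D" using assms by (auto simp: D_def)
  obtain c q where cq: "H = (\<Sum>k<D. smult (c k) (newton_basis (drop i rs) k)) + q * newton_basis (drop i rs) D"
    and c0: "c 0 = poly H (rs ! i)"
    using newton_expansion[of H "drop i rs"] assms hd_drop_conv_nth[OF assms] unfolding len(1) by auto
  define t where "t = (\<lambda>k. if k < i then 0 else c (k - i))"
  have "newton_basis rs i * H = (\<Sum>k<D. smult (c k) (newton_basis rs (i + k))) + q * newton_basis rs (i + D)"
    by (subst cq) (simp add: newton_basis_add distrib_left sum_distrib_left mult.left_commute)
  also have "(\<Sum>k<D. smult (c k) (newton_basis rs (i + k))) = (\<Sum>k\<in>{i..<i+D}. smult (t k) (newton_basis rs k))"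
    by (rule sum.reindex_bij_witness[of _ "\<lambda>k. k - i" "\<lambda>k. i + k"]) (auto simp: t_def)
  also have "\<dots> = (\<Sum>k<i+D. smult (t k) (newton_basis rs k))"
    by (rule sum.mono_neutral_left) (auto simp: t_def)
  finally have "newton_basis rs i * H - (\<Sum>k<length rs. smult (t k) (newton_basis rs k)) = q * newton_basis rs (length rs)"
    by (simp add: len)
  thus ?thesis using c0 by (intro exI[of _ t]) (auto simp: t_def)
qed

lemma mod_sum_poly: "(\<Sum>i\<in>A. f i) mod (g :: 'a::field poly) = (\<Sum>i\<in>A. f i mod g)"
  by (induction A rule: infinite_finite_induct) (auto simp: poly_mod_add_left)

text \<open>Multiplication by \<open>H\<close> on the quotient ring modulo \<open>G\<close>, in the
  basis of powers. Unlike the Newton basis, this basis does not mention the roots, so the matrix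
  already makes sense over the ring of coefficients.\<close>

definition mult_mat :: "'a::field poly \<Rightarrow> 'a poly \<Rightarrow> 'a mat" where
  "mult_mat G H = mat (degree G) (degree G) (\<lambda>(i, j). coeff ((monom 1 i * H) mod G) j)"

text \<open>In the Newton basis of the roots of \<open>G\<close>, multiplication by \<open>H\<close> is triangular with the values
  of \<open>H\<close> on the diagonal.\<close>

lemma char_poly_mult_mat:
  fixes H :: "'a::field poly" and rs :: "'a list"
  defines "G \<equiv> newton_basis rs (length rs)"
  shows "char_poly (mult_mat G H) = (\<Prod>a\<leftarrow>rs. [:- poly H a, 1:])"
proof -
  define D where "D = length rs"
  have G: "degree G = D" "lead_coeff G = 1"
    using newton_basis_monic[of D rs] by (auto simp: D_def G_def)
  hence "G \<noteq> 0" by auto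
  let ?e = "newton_basis rs"
  have e: "degree (?e i) = i" "coeff (?e i) i = 1" if "i < D" for i
    using newton_basis_monic[of i rs] that by (auto simp: D_def)
  have "\<forall>i\<in>{..<D}. \<exists>t. (\<forall>k<i. t k = 0) \<and> t i = poly H (rs ! i) \<and>
          G dvd ?e i * H - (\<Sum>k<D. smult (t k) (?e k))"
    using newton_basis_times[of _ rs H] by (auto simp: D_def G_def)
  then obtain t where t: "\<And>i k. i < D \<Longrightarrow> k < i \<Longrightarrow> t i k = 0" "\<And>i. i < D \<Longrightarrow> t i i = poly H (rs ! i)"
    "\<And>i. i < D \<Longrightarrow> G dvd ?e i * H - (\<Sum>k<D. smult (t i k) (?e k))"
    by (subst (asm) bchoice_iff) auto
  define M where "M = mult_mat G H"
  define T where "T = mat D D (\<lambda>(i, k). t i k)"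
  define P where "P = mat D D (\<lambda>(i, j). coeff (?e i) j)"
  have carr: "M \<in> carrier_mat D D" "T \<in> carrier_mat D D" "P \<in> carrier_mat D D"
    by (auto simp: M_def T_def P_def mult_mat_def G)
  have PM: "P * M = T * P"
  proof (rule eq_matI)
    fix i j assume "i < dim_row (T * P)" "j < dim_col (T * P)"
    hence i: "i < D" and j: "j < D" by (auto simp: T_def P_def)
    have ei: "?e i = (\<Sum>k<D. smult (coeff (?e i) k) (monom 1 k))"
    proof -
      have "?e i = (\<Sum>k\<le>i. monom (coeff (?e i) k) k)"
        using poly_as_sum_of_monoms[of "?e i"] e[OF i] by simp
      also have "\<dots> = (\<Sum>k<D. monom (coeff (?e i) k) k)"
        using i e[OF i] by (intro sum.mono_neutral_left) (auto simp: coeff_eq_0)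
      finally show ?thesis by (simp add: smult_monom)
    qed
    have "(P * M) $$ (i, j) = (\<Sum>k<D. coeff (?e i) k * coeff ((monom 1 k * H) mod G) j)"
      using i j by (simp add: P_def M_def mult_mat_def scalar_prod_def G atLeast0LessThan)
    also have "\<dots> = coeff ((\<Sum>k<D. smult (coeff (?e i) k) (monom 1 k * H)) mod G) j"
      by (simp add: mod_sum_poly coeff_sum mod_smult_left)
    also have "(\<Sum>k<D. smult (coeff (?e i) k) (monom 1 k * H)) = ?e i * H"
      by (subst (2) ei) (simp add: sum_distrib_right)
    also have "(?e i * H) mod G = (\<Sum>k<D. smult (t i k) (?e k)) mod G"
      using t(3)[OF i] by (simp add: mod_eq_dvd_iff)
    also have "\<dots> = (\<Sum>k<D. smult (t i k) (?e k))"
    proof (cases "D = 0")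
      case False
      have "degree (\<Sum>k<D. smult (t i k) (?e k)) < D"
        using False by (intro degree_sum_less) (auto simp: e intro: le_less_trans[OF degree_smult_le])
      thus ?thesis by (simp add: mod_poly_less G)
    qed (use i in auto)
    also have "coeff \<dots> j = (\<Sum>k<D. t i k * coeff (?e k) j)"
      by (simp add: coeff_sum)
    also have "\<dots> = (T * P) $$ (i, j)"
      using i j by (simp add: P_def T_def scalar_prod_def atLeast0LessThan)
    finally show "(P * M) $$ (i, j) = (T * P) $$ (i, j)" .
  qed (use carr in auto)
  have "det P = prod_list (diag_mat P)"
    by (rule det_lower_triangular[OF _ carr(3)]) (auto simp: P_def e coeff_eq_0)
  also have "diag_mat P = map (\<lambda>_. 1) [0..<D]"
    by (simp add: diag_mat_def P_def e)
  finally have "det P = 1" by (simp add: map_replicate_const prod_list_replicate)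
  then obtain Q where Q: "Q \<in> carrier_mat D D" "Q * P = 1\<^sub>m D" "P * Q = 1\<^sub>m D"
    using det_non_zero_imp_unit[OF carr(3)] by (auto simp: Units_def ring_mat_def)
  have "M = 1\<^sub>m D * M" using carr by simp
  also have "\<dots> = Q * (P * M)" using carr Q by (simp flip: Q(2) add: assoc_mult_mat)
  also have "\<dots> = Q * T * P" using carr Q by (simp add: PM assoc_mult_mat)
  finally have "similar_mat M T"
    using carr Q by (intro similar_matI[of _ _ Q P D]) auto
  hence "char_poly M = char_poly T" by (rule char_poly_similar)
  also have "\<dots> = (\<Prod>a\<leftarrow>diag_mat T. [:- a, 1:])"
    by (rule char_poly_upper_triangular[OF carr(2)]) (auto simp: upper_triangular_def T_def t)
  also have "diag_mat T = map (poly H) rs"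
    by (rule nth_equalityI) (auto simp: diag_mat_def T_def t D_def)
  finally show ?thesis by (simp add: M_def o_def)
qed

lemma monic_division:
  fixes F G :: "'a::idom poly"
  assumes "lead_coeff G = 1"
  obtains q r where "F = G * q + r" "r = 0 \<or> degree r < degree G"
proof -
  have "G \<noteq> 0" using assms by auto
  obtain q r where "pseudo_divmod F G = (q, r)" by force
  from pseudo_divmod[OF \<open>G \<noteq> 0\<close> this] assms show ?thesis using that by auto
qed

text \<open>Division by a monic polynomial needs no field, so the matrix of multiplication by
  \<open>H\<close> and its characteristic polynomial live over \<open>'a\<close> and commute with
  every homomorphism. The lemma is used with \<open>'a = int\<close>, where it shows integrality,
  and with \<open>'a = complex poly\<close>, where \<open>\<phi>\<close> evaluates at a
  parameter.\<close>

lemma norm_poly_exists: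
  fixes G H :: "'a::idom poly"
  assumes "lead_coeff G = 1"
  obtains E where "lead_coeff E = 1" "degree E = degree G"
    "\<And>\<phi>::'a \<Rightarrow> complex. comm_ring_hom \<phi> \<Longrightarrow>
        map_poly \<phi> E = (\<Prod>\<alpha>\<in>#proots (map_poly \<phi> G). [:- poly (map_poly \<phi> H) \<alpha>, 1:])"
proof -
  define D where "D = degree G"
  have "\<forall>i. \<exists>r. (\<exists>q. monom 1 i * H = G * q + r) \<and> (r = 0 \<or> degree r < degree G)"
    using monic_division[OF assms] by metis
  then obtain r where r: "\<And>i. \<exists>q. monom 1 i * H = G * q + r i" "\<And>i. r i = 0 \<or> degree (r i) < degree G"
    by metis
  define M where "M = mat D D (\<lambda>(i, j). coeff (r i) j)"
  have M: "M \<in> carrier_mat D D" by (simp add: M_def)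
  show ?thesis
  proof (rule that[of "char_poly M"])
    show "lead_coeff (char_poly M) = 1" "degree (char_poly M) = degree G"
      using degree_monic_char_poly[OF M] by (auto simp: D_def)
    fix \<phi> :: "'a \<Rightarrow> complex" assume "comm_ring_hom \<phi>"
    then interpret comm_ring_hom \<phi> .
    interpret mp: map_poly_comm_ring_hom \<phi> ..
    let ?G = "map_poly \<phi> G" and ?H = "map_poly \<phi> H"
    have deg: "degree ?G = D" and monic: "lead_coeff ?G = 1"
    proof -
      show "degree ?G = D"
        using assms unfolding D_def by (intro map_poly_degree_eq) simp
      thus "lead_coeff ?G = 1" using assms by (simp add: D_def)
    qed
    obtain rs where rs: "mset rs = proots ?G" using ex_mset by blast
    have G: "?G = newton_basis rs (length rs)"
      using complex_poly_decompose_multiset[of ?G] monic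
      by (simp add: newton_basis_def flip: rs prod_mset_prod_list mset_map)
    have "map_poly \<phi> (r i) = (monom 1 i * ?H) mod ?G" for i
    proof -
      obtain q where "monom 1 i * H = G * q + r i" using r(1) by blast
      hence "map_poly \<phi> (monom 1 i * H) = map_poly \<phi> (G * q + r i)" by simp
      hence *: "monom 1 i * ?H = ?G * map_poly \<phi> q + map_poly \<phi> (r i)"
        by (simp add: mp.hom_add mp.hom_mult)
      have "map_poly \<phi> (r i) = 0 \<or> degree (map_poly \<phi> (r i)) < degree ?G"
        using r(2)[of i] degree_map_poly_le[of \<phi> "r i"] unfolding deg by (auto simp: D_def)
      hence "map_poly \<phi> (r i) mod ?G = map_poly \<phi> (r i)" by (auto simp: mod_poly_less)
      thus ?thesis using * by simp
    qed
    hence "map_mat \<phi> M = mult_mat ?G ?H"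
      by (intro eq_matI) (auto simp: M_def mult_mat_def deg simp flip: coeff_map_poly_hom)
    hence "map_poly \<phi> (char_poly M) = char_poly (mult_mat ?G ?H)"
      using char_poly_hom[OF M] by simp
    also have "\<dots> = (\<Prod>a\<leftarrow>rs. [:- poly ?H a, 1:])"
      by (subst G) (rule char_poly_mult_mat)
    also have "\<dots> = (\<Prod>\<alpha>\<in>#proots ?G. [:- poly ?H \<alpha>, 1:])"
      by (simp flip: rs prod_mset_prod_list mset_map)
    finally show "map_poly \<phi> (char_poly M) = \<dots>" .
  qed
qed

subsection \<open>The critical orbit\<close>

abbreviation cpoly :: "int poly \<Rightarrow> complex poly" where
  "cpoly \<equiv> map_poly of_int"

abbreviation orb :: "nat \<Rightarrow> complex poly" where
  "orb i \<equiv> cpoly (crit_orbit i)"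

text \<open>The factors of \<open>misiurewicz_quot\<close>. At a root, a_(m+k-1) = - a_(m-1), so the
  critical orbit is periodic from index \<open>m\<close> on, with period dividing
  \<open>k\<close>.\<close>

definition misiu :: "nat \<Rightarrow> nat \<Rightarrow> int poly" where
  "misiu m k = crit_orbit (m + k - 1) + crit_orbit (m - 1)"

lemma orb_Suc: "orb (Suc i) = orb i ^ 2 + [:0, 1:]"
  by (simp add: of_int_poly_hom.hom_add of_int_poly_hom.hom_power)

declare crit_orbit.simps(2) [simp del]

lemma poly_orb_0 [simp]: "poly (orb 0) x = 0"
  and poly_orb_Suc: "poly (orb (Suc i)) x = poly (orb i) x ^ 2 + x"
  by (simp_all add: orb_Suc)

lemma monic_add_lower:
  fixes p q :: "'a::comm_ring_1 poly"
  assumes "lead_coeff p = 1" "degree q < degree p"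
  shows "degree (p + q) = degree p \<and> lead_coeff (p + q) = 1"
  using assms degree_add_eq_left[of q p] by (simp add: coeff_eq_0)

lemma crit_orbit_degree: "degree (crit_orbit (Suc i)) = 2 ^ i \<and> lead_coeff (crit_orbit (Suc i)) = 1"
proof (induction i)
  case (Suc i)
  let ?p = "crit_orbit (Suc i)"
  have "?p \<noteq> 0" using Suc by auto
  hence deg: "degree (?p ^ 2) = 2 ^ Suc i" using Suc by (simp add: degree_power_eq)
  have "(1::nat) < 2 ^ Suc i" by (rule one_less_power) auto
  hence lt: "degree ([:0, 1::int:]) < degree (?p ^ 2)" unfolding deg by simp
  have "lead_coeff (?p ^ 2) = 1" unfolding lead_coeff_power using conjunct2[OF Suc] by (metis power_one)
  moreover have "crit_orbit (Suc (Suc i)) = ?p ^ 2 + [:0, 1:]" by (rule crit_orbit.simps(2))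
  ultimately show ?case using monic_add_lower[OF _ lt] deg by metis
qed (simp add: crit_orbit.simps(2))

lemma misiu_degree:
  assumes "m \<ge> 1" "k \<ge> 1"
  shows "degree (misiu m k) = 2 ^ (m + k - 2) \<and> lead_coeff (misiu m k) = 1"
proof -
  obtain j where j: "m + k - 1 = Suc j" using assms by (cases "m + k - 1") auto
  hence jk: "m + k - 2 = j" by simp
  have "degree (crit_orbit (m - 1)) < degree (crit_orbit (m + k - 1))"
  proof (cases "m - 1")
    case (Suc i)
    hence "i < j" using j assms by simp
    thus ?thesis using crit_orbit_degree[of i] crit_orbit_degree[of j] Suc j by simp
  qed (use crit_orbit_degree[of j] j in simp)
  thus ?thesis unfolding misiu_def
    using monic_add_lower[of "crit_orbit (m + k - 1)" "crit_orbit (m - 1)"] crit_orbit_degree[of j] 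
    unfolding jk j by metis
qed

lemma crit_orbit_nonzero: "i \<ge> 1 \<Longrightarrow> crit_orbit i \<noteq> 0"
  using crit_orbit_degree[of "i - 1"] by (cases i) auto

lemma misiu_nonzero: "m \<ge> 1 \<Longrightarrow> k \<ge> 1 \<Longrightarrow> misiu m k \<noteq> 0"
  using misiu_degree[of m k] by auto

lemma poly_misiu: "poly (cpoly (misiu m k)) x = poly (orb (m + k - 1)) x + poly (orb (m - 1)) x"
  by (simp add: misiu_def of_int_poly_hom.hom_add)

subsection \<open>Values at algebraic integers\<close>

lemma poly_int_algebraic_int:
  assumes "lead_coeff G = 1" "poly (cpoly G) \<alpha> = 0"
  shows "algebraic_int (poly (cpoly h) \<alpha>)"
proof -
  obtain E where E: "lead_coeff E = 1"
    "\<And>\<phi>::int \<Rightarrow> complex. comm_ring_hom \<phi> \<Longrightarrow>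
        map_poly \<phi> E = (\<Prod>\<alpha>\<in>#proots (map_poly \<phi> G). [:- poly (map_poly \<phi> h) \<alpha>, 1:])"
    using norm_poly_exists[OF assms(1), of h] by metis
  have "G \<noteq> 0" using assms by auto
  hence "\<alpha> \<in># proots (cpoly G)" using assms by simp
  hence "poly (cpoly E) (poly (cpoly h) \<alpha>) = 0"
    by (subst E(2)) (auto simp: poly_prod_mset prod_mset_zero_iff of_int_hom.comm_ring_hom_axioms)
  thus ?thesis using E(1) by (auto simp: algebraic_int_altdef_ipoly)
qed

text \<open>Otherwise -1/2 would be an algebraic integer. The derivatives and cofactors whose
  vanishing has to be excluded below are odd in this sense.\<close>

lemma odd_nonzero:
  assumes "lead_coeff G = 1" "poly (cpoly G) \<alpha> = 0"
  shows "1 + 2 * poly (cpoly h) \<alpha> \<noteq> 0"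
proof
  assume "1 + 2 * poly (cpoly h) \<alpha> = 0"
  hence eq: "poly (cpoly h) \<alpha> = - 1 / 2" by (simp add: field_simps add_eq_0_iff)
  hence "algebraic_int (- 1 / 2 :: complex)" using poly_int_algebraic_int[OF assms, of h] by simp
  hence "(- 1 / 2 :: complex) \<in> \<int>" by (rule rational_algebraic_int_is_int) auto
  then obtain i :: int where "- 1 / 2 = (of_int i :: complex)" by (auto elim: Ints_cases)
  hence "(of_int (2 * i) :: complex) = of_int (- 1)" by (simp add: field_simps)
  hence "2 * i = - 1" by (simp only: of_int_eq_iff)
  thus False by presburger
qed

subsection \<open>Orders of vanishing\<close>

lemma ex_period:
  fixes x :: "nat \<Rightarrow> 'a"
  assumes step: "\<And>a b. x a = x b \<Longrightarrow> x (Suc a) = x (Suc b)"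
  assumes "k \<ge> 1" "x (M + k) = x M"
  obtains p where "p \<ge> 1" "\<And>k. x (M + k) = x M \<longleftrightarrow> p dvd k"
proof -
  define p where "p = (LEAST p. p \<ge> 1 \<and> x (M + p) = x M)"
  have p: "p \<ge> 1" "x (M + p) = x M"
    using LeastI[of "\<lambda>p. p \<ge> 1 \<and> x (M + p) = x M" k] assms(2,3) by (auto simp: p_def)
  have min: "p \<le> q" if "q \<ge> 1" "x (M + q) = x M" for q
    using Least_le[of "\<lambda>p. p \<ge> 1 \<and> x (M + p) = x M" q] that by (auto simp: p_def)
  have shift: "x a = x b \<Longrightarrow> x (a + j) = x (b + j)" for a b j
    by (induction j) (auto intro: step)
  have mult: "x (M + q * p + r) = x (M + r)" for q r
  proof (induction q)
    case (Suc q)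
    have "x (M + Suc q * p + r) = x ((M + p) + (q * p + r))" by (simp add: algebra_simps)
    also have "\<dots> = x (M + (q * p + r))" by (rule shift) (rule p)
    finally show ?case using Suc by (simp add: add.assoc)
  qed simp
  show ?thesis
  proof (rule that[OF p(1)])
    fix k
    have "x (M + k) = x (M + k mod p)" using mult[of "k div p" "k mod p"] by (simp add: add.assoc)
    moreover have "x (M + k mod p) = x M \<longleftrightarrow> k mod p = 0"
    proof
      assume *: "x (M + k mod p) = x M"
      have "k mod p < p" using p(1) by simp
      thus "k mod p = 0" using min[of "k mod p"] * by linarith
    qed simp
    ultimately show "x (M + k) = x M \<longleftrightarrow> p dvd k" by (simp add: dvd_eq_mod_eq_0)
  qed
qed

lemma crit_orbit_diff_shift:
  "crit_orbit (a + r) - crit_orbit (b + r)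
     = (crit_orbit a - crit_orbit b) * (\<Prod>i<r. crit_orbit (a + i) + crit_orbit (b + i))"
proof (induction r)
  case (Suc r)
  have "crit_orbit (a + Suc r) - crit_orbit (b + Suc r)
      = (crit_orbit (a + r) - crit_orbit (b + r)) * (crit_orbit (a + r) + crit_orbit (b + r))"
    by (simp add: crit_orbit.simps(2) algebra_simps power2_eq_square)
  thus ?case using Suc by (simp add: mult.assoc)
qed simp

lemma poly_orb_step: "poly (orb a) x = poly (orb b) x \<Longrightarrow> poly (orb (Suc a)) x = poly (orb (Suc b)) x"
  by (simp add: poly_orb_Suc)

lemma poly_orb_shift: "poly (orb a) x = poly (orb b) x \<Longrightarrow> poly (orb (a + j)) x = poly (orb (b + j)) x"
  by (induction j) (auto intro: poly_orb_step)

lemma order_eq_1: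
  fixes p :: "complex poly"
  assumes "p \<noteq> 0" "poly p x = 0" "poly (pderiv p) x \<noteq> 0"
  shows "order x p = 1"
  using order_pderiv[OF assms(1,2)] order_0I[OF assms(3)] by simp

text \<open>The derivative of a_(i+1) with respect to c is 1 + 2 a_i a_i', which is odd and hence
  nonzero at the algebraic integer \<open>\<alpha>\<close>. So all zeros in question are simple, and
  only their location has to be determined.\<close>

lemma order_structure_periodic:
  assumes m: "m \<ge> 2" and per: "k0 \<ge> 1" "poly (orb k0) \<alpha> = 0"
  obtains p where "p \<ge> 1"
    "\<And>k. k \<ge> 1 \<Longrightarrow> order \<alpha> (orb k) = (if p dvd k then 1 else 0)"
    "\<And>k. k \<ge> 1 \<Longrightarrow> order \<alpha> (cpoly (misiu m k)) = (if p dvd k \<and> p dvd m - 1 then 1 else 0)"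
proof -
  define x where "x = (\<lambda>i. poly (orb i) \<alpha>)"
  define y where "y = (\<lambda>i. poly (pderiv (orb i)) \<alpha>)"
  have x0: "x 0 = 0" by (simp add: x_def)
  have step: "x a = x b \<Longrightarrow> x (Suc a) = x (Suc b)" for a b
    unfolding x_def by (rule poly_orb_step)
  have shift: "x a = x b \<Longrightarrow> x (a + j) = x (b + j)" for a b j
    unfolding x_def by (rule poly_orb_shift)
  have "x (0 + k0) = x 0" using per by (simp add: x_def)
  from ex_period[OF step per(1) this] obtain p where p: "p \<ge> 1" "\<And>k. x k = 0 \<longleftrightarrow> p dvd k"
    using x0 by auto
  have y_Suc: "y (Suc i) = 1 + 2 * (x i * y i)" for i
    unfolding y_def x_def orb_Suc by (simp add: pderiv_add pderiv_mult pderiv_pCons power2_eq_square algebra_simps)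
  have y_nz: "y i \<noteq> 0" if i: "i \<ge> 1" for i
  proof -
    obtain j where j: "i = Suc j" using i by (cases i) auto
    have "y i = 1 + 2 * poly (cpoly (crit_orbit j * pderiv (crit_orbit j))) \<alpha>"
      unfolding j y_Suc by (simp add: x_def y_def of_int_poly_hom.hom_mult of_int_hom.map_poly_pderiv)
    thus ?thesis
      using odd_nonzero[of "crit_orbit k0" \<alpha>] per crit_orbit_degree[of "k0 - 1"] by (cases k0) auto
  qed
  have x_add: "x (i + j) = x i" if "p dvd j" for i j
    using shift[of j 0 i] that p(2)[of j] x0 by (simp add: add.commute)
  have y_add: "y (Suc i + j) = y (Suc i)" if "p dvd j" for i j
  proof (induction i)
    case 0
    have "x j = 0" using that p by simp
    thus ?case using y_Suc[of j] y_Suc[of 0] x0 by simp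
  next
    case (Suc i)
    thus ?case using y_Suc[of "Suc i + j"] y_Suc[of "Suc i"] x_add[OF that, of "Suc i"] by simp
  qed
  show ?thesis
  proof (rule that[OF p(1)])
    fix k :: nat assume k: "k \<ge> 1"
    have "orb k \<noteq> 0" using crit_orbit_nonzero[OF k] by simp
    show "order \<alpha> (orb k) = (if p dvd k then 1 else 0)"
    proof (cases "p dvd k")
      case True
      thus ?thesis using p(2)[of k] y_nz[OF k] order_eq_1[OF \<open>orb k \<noteq> 0\<close>] by (simp add: x_def y_def)
    qed (use p(2)[of k] in \<open>auto simp: x_def intro: order_0I\<close>)
    let ?A = "cpoly (misiu m k)"
    have A: "poly ?A \<alpha> = x (m - 1 + k) + x (m - 1)" using k m by (simp add: poly_misiu x_def)
    have "?A \<noteq> 0" using misiu_nonzero[of m k] k m by simp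
    show "order \<alpha> ?A = (if p dvd k \<and> p dvd m - 1 then 1 else 0)"
    proof (cases "p dvd k \<and> p dvd m - 1")
      case True
      have "poly (pderiv ?A) \<alpha> = y (m + k - 1) + y (m - 1)"
        by (simp add: misiu_def of_int_poly_hom.hom_add pderiv_add y_def)
      \<comment> \<open>The derivatives are periodic from index 1 on, so the two summands are equal
        and cannot cancel.\<close>
      also have "\<dots> = 2 * y (m - 1)"
        using y_add[of k "m - 2"] True m by (simp add: Suc_diff_Suc numeral_2_eq_2)
      finally have "poly (pderiv ?A) \<alpha> \<noteq> 0" using y_nz[of "m - 1"] m by simp
      moreover have "poly ?A \<alpha> = 0" using A x_add[of k "m - 1"] p(2)[of "m - 1"] True by simp
      ultimately show ?thesis using order_eq_1[OF \<open>?A \<noteq> 0\<close>] True by simp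
    next
      case False
      have "poly ?A \<alpha> \<noteq> 0"
      proof
        assume 0: "poly ?A \<alpha> = 0"
        hence "x (m - 1 + k) = - x (m - 1)" using A by (simp add: add_eq_0_iff2)
        hence "x (Suc (m - 1 + k)) = x (Suc (m - 1))" by (simp add: x_def poly_orb_Suc)
        hence "x (m + k) = x m" using m by (simp add: Suc_diff_le)
        \<comment> \<open>The shift by (p - 1) m moves the index \<open>m\<close> to the multiple p
          m of the period, where the orbit is at 0.\<close>
        hence "x (m + k + (p - 1) * m) = x (m + (p - 1) * m)" by (rule shift)
        moreover have "m + (p - 1) * m = p * m" using p by (cases p) auto
        ultimately have "x (p * m + k) = 0" using p(2)[of "p * m"] by (simp add: algebra_simps)
        hence "p dvd k" using p(2)[of "p * m + k"] by (simp add: dvd_add_right_iff)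
        moreover from this have "x (m - 1) = 0" using 0 A x_add[of k "m - 1"] by simp
        ultimately show False using False p(2) by simp
      qed
      thus ?thesis using False by (auto intro: order_0I)
    qed
  qed
qed

text \<open>Let B_k = a_(m+k) - a_m, which is \<open>misiu m k\<close> times a factor that does not
  vanish at \<open>\<alpha>\<close> if the period \<open>p\<close> divides \<open>k\<close>. For
  such \<open>k\<close>, B_k is B_p times a cofactor that is odd at \<open>\<alpha>\<close>. So the
  order at \<open>\<alpha>\<close> is the same for all multiples of \<open>p\<close>, although it is
  not shown to be 1.\<close>

lemma order_structure_preperiodic:
  assumes m: "m \<ge> 2" and nonper: "\<And>k. k \<ge> 1 \<Longrightarrow> poly (orb k) \<alpha> \<noteq> 0"
  obtains p e where "p \<ge> 1"
    "\<And>k. k \<ge> 1 \<Longrightarrow> order \<alpha> (cpoly (misiu m k)) = (if p dvd k then e else 0)"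
proof (cases "\<exists>k\<ge>1. poly (cpoly (misiu m k)) \<alpha> = 0")
  case False
  hence "order \<alpha> (cpoly (misiu m k)) = (if 1 dvd k then 0 else 0)" if "k \<ge> 1" for k
    using that by (auto intro: order_0I)
  thus ?thesis by (intro that[of 1 0]) auto
next
  case True
  then obtain k0 where k0: "k0 \<ge> 1" "poly (cpoly (misiu m k0)) \<alpha> = 0" by blast
  define x where "x = (\<lambda>i. poly (orb i) \<alpha>)"
  have x_nz: "x i \<noteq> 0" if "i \<ge> 1" for i using nonper[OF that] by (simp add: x_def)
  have step: "x a = x b \<Longrightarrow> x (Suc a) = x (Suc b)" for a b
    unfolding x_def by (rule poly_orb_step)
  have shift: "x a = x b \<Longrightarrow> x (a + j) = x (b + j)" for a b j
    unfolding x_def by (rule poly_orb_shift)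
  have A: "poly (cpoly (misiu m k)) \<alpha> = x (m - 1 + k) + x (m - 1)" if "k \<ge> 1" for k
    using that m by (simp add: poly_misiu x_def)
  have x_Suc: "x (Suc i) = x i ^ 2 + \<alpha>" for i by (simp add: x_def poly_orb_Suc)
  have sq: "x (m + k) = x m \<longleftrightarrow> x (m - 1 + k) = x (m - 1) \<or> x (m - 1 + k) = - x (m - 1)" for k
    using x_Suc[of "m - 1 + k"] x_Suc[of "m - 1"] m by (simp add: power2_eq_iff Suc_diff_le)
  have A0: "x (m - 1 + k0) = - x (m - 1)" using A[OF k0(1)] k0 by (simp add: add_eq_0_iff2)
  hence "x (m + k0) = x m" using sq by simp
  from ex_period[OF step k0(1) this] obtain p where p: "p \<ge> 1" "\<And>k. x (m + k) = x m \<longleftrightarrow> p dvd k"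
    by blast
  have A_iff: "x (m - 1 + k) = - x (m - 1) \<longleftrightarrow> p dvd k" if k: "k \<ge> 1" for k
  proof -
    \<comment> \<open>Going from m - 1 to m - 1 + k0 k in steps of \<open>k\<close> preserves the
      value, while a first step of \<open>k0\<close> changes its sign and the later ones preserve
      it. So a_(m-1) would be its own negative.\<close>
    have False if plus: "x (m - 1 + k) = x (m - 1)"
    proof -
      have 1: "x (m - 1 + j * k) = x (m - 1)" for j
      proof (induction j)
        case (Suc j)
        have "x (m - 1 + k + j * k) = x (m - 1 + j * k)" by (rule shift) (rule plus)
        thus ?case using Suc by (simp add: algebra_simps)
      qed simp
      have 2: "x (m - 1 + k0 + j * k0) = x (m - 1 + k0)" for j
      proof -
        have "p dvd k0" using p(2)[of k0] \<open>x (m + k0) = x m\<close> by simp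
        hence "x (m + j * k0) = x m" using p(2)[of "j * k0"] by simp
        hence "x (m + j * k0 + (k0 - 1)) = x (m + (k0 - 1))" by (rule shift)
        thus ?thesis using k0 m by (simp add: algebra_simps)
      qed
      have "x (m - 1 + k0 * k) = - x (m - 1)"
        using 2[of "k - 1"] A0 k by (cases k) (auto simp: algebra_simps)
      hence "x (m - 1) = 0" using 1[of k0] by simp
      thus False using x_nz[of "m - 1"] m by linarith
    qed
    thus ?thesis using sq[of k] p(2)[of k] by blast
  qed
  define B where "B = (\<lambda>k. crit_orbit (m + k) - crit_orbit m)"
  have order_B: "order \<alpha> (cpoly (B k)) = order \<alpha> (cpoly (misiu m k))" if k: "k \<ge> 1" "p dvd k" for k
  proof -
    define D where "D = crit_orbit (m + k - 1) - crit_orbit (m - 1)"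
    have BD: "B k = misiu m k * D"
      using crit_orbit_diff_shift[of "m + k - 1" 1 "m - 1"] m k
      by (simp add: B_def D_def misiu_def mult.commute)
    have "poly (cpoly D) \<alpha> = x (m - 1 + k) - x (m - 1)"
      using m k by (simp add: D_def of_int_poly_hom.hom_minus x_def)
    also have "\<dots> \<noteq> 0" using A_iff[of k] k x_nz[of "m - 1"] m by simp
    finally have D: "poly (cpoly D) \<alpha> \<noteq> 0" .
    hence "cpoly D \<noteq> 0" by auto
    thus ?thesis using misiu_nonzero[of m k] m k order_0I[OF D]
      by (simp add: BD of_int_poly_hom.hom_mult order_mult)
  qed
  \<comment> \<open>\<open>C j\<close> is the cofactor of a_(m+p) - a_m in a_(m+(j+1)p) - a_m. At
    \<open>\<alpha>\<close> the factors of the inner product become 2 a_(m+i), so the value of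
    \<open>C j\<close> is odd.\<close>
  define C where "C = rec_nat (1 :: int poly) (\<lambda>j C. C * (\<Prod>i<p. crit_orbit (m + Suc j * p + i) + crit_orbit (m + i)) + 1)"
  have C_simps: "C 0 = 1"
    "C (Suc j) = C j * (\<Prod>i<p. crit_orbit (m + Suc j * p + i) + crit_orbit (m + i)) + 1" for j
    by (simp_all add: C_def)
  have BC: "B (Suc j * p) = B p * C j" for j
  proof (induction j)
    case (Suc j)
    have "B (Suc (Suc j) * p) = (crit_orbit (m + Suc j * p + p) - crit_orbit (m + p)) + B p"
      by (simp add: B_def algebra_simps)
    also have "crit_orbit (m + Suc j * p + p) - crit_orbit (m + p)
        = B (Suc j * p) * (\<Prod>i<p. crit_orbit (m + Suc j * p + i) + crit_orbit (m + i))"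
      unfolding B_def by (rule crit_orbit_diff_shift)
    also have "\<dots> + B p = B p * C (Suc j)"
      unfolding Suc by (simp only: C_simps distrib_left mult.assoc mult_1_right)
    finally show ?case .
  qed (simp add: C_simps)
  have C_nz: "poly (cpoly (C j)) \<alpha> \<noteq> 0" for j
  proof -
    have "\<exists>h. poly (cpoly (C j)) \<alpha> = 1 + 2 * poly (cpoly h) \<alpha>"
    proof (cases j)
      case 0
      thus ?thesis by (intro exI[of _ 0]) (simp add: C_simps)
    next
      case (Suc i)
      have eq: "x (m + Suc i * p + l) = x (m + l)" for l
        using p(2)[of "Suc i * p"] by (intro shift) simp
      have "poly (cpoly (C j)) \<alpha> = poly (cpoly (C i)) \<alpha> * (\<Prod>l<p. x (m + Suc i * p + l) + x (m + l)) + 1"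
        unfolding Suc C_simps
        by (simp add: of_int_poly_hom.hom_add of_int_poly_hom.hom_mult of_int_poly_hom.hom_prod poly_prod x_def
           )
      also have "(\<Prod>l<p. x (m + Suc i * p + l) + x (m + l)) = (\<Prod>l<p. 2 * x (m + l))"
        unfolding eq by simp
      also have "\<dots> = 2 * (2 ^ (p - 1) * (\<Prod>l<p. x (m + l)))"
        using p(1) by (cases p) (auto simp: prod.distrib)
      finally show ?thesis
        by (intro exI[of _ "smult (2 ^ (p - 1)) (C i * (\<Prod>l<p. crit_orbit (m + l)))"])
          (simp add: of_int_hom.map_poly_hom_smult of_int_poly_hom.hom_mult of_int_poly_hom.hom_prod poly_prod x_def)
    qed
    thus ?thesis
      using odd_nonzero[of "misiu m k0" \<alpha>] k0 misiu_degree[of m k0] m by auto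
  qed
  define e where "e = order \<alpha> (cpoly (misiu m p))"
  show ?thesis
  proof (rule that[OF p(1)])
    fix k :: nat assume k: "k \<ge> 1"
    show "order \<alpha> (cpoly (misiu m k)) = (if p dvd k then e else 0)"
    proof (cases "p dvd k")
      case False
      hence "poly (cpoly (misiu m k)) \<alpha> \<noteq> 0" using A[OF k] A_iff[OF k] by (simp add: add_eq_0_iff2)
      thus ?thesis using False by (auto intro: order_0I)
    next
      case True
      then obtain j where "k = j * p" by (metis dvdE mult.commute)
      then obtain i where i: "k = Suc i * p" using k by (cases j) auto
      have nz: "cpoly (B p) * cpoly (C i) \<noteq> 0"
      proof -
        have "cpoly (C i) \<noteq> 0" using C_nz[of i] by auto
        moreover have "m + p \<ge> 1" "m \<ge> 1" using m by auto
        hence "degree (crit_orbit m) < degree (crit_orbit (m + p))"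
          using crit_orbit_degree[of "m - 1"] crit_orbit_degree[of "m + p - 1"] p(1) m by simp
        hence "B p \<noteq> 0" by (auto simp: B_def)
        ultimately show ?thesis by simp
      qed
      have "order \<alpha> (cpoly (misiu m k)) = order \<alpha> (cpoly (B p) * cpoly (C i))"
        using order_B[OF k True] BC[of i] by (simp add: i of_int_poly_hom.hom_mult)
      also have "\<dots> = e"
        using nz order_B[OF p(1)] order_0I[OF C_nz[of i]] by (simp add: order_mult e_def)
      finally show ?thesis using True by simp
    qed
  qed
qed

text \<open>Both orders depend on \<open>k\<close> only through \<open>p dvd k\<close>. This is the
  form in which the Moebius sum of orders collapses to the single case p = n.\<close>

lemma order_structure:
  assumes m: "m \<ge> 2"
  obtains p e f where "p \<ge> 1"
    "\<And>k. k \<ge> 1 \<Longrightarrow> order \<alpha> (cpoly (misiu m k)) = (if p dvd k then e else 0)"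
    "\<And>k. k \<ge> 1 \<Longrightarrow> order \<alpha> (orb k) = (if p dvd k then f else 0)"
    "f = 0 \<or> e = (if p dvd m - 1 then f else 0)"
proof (cases "\<exists>k\<ge>1. poly (orb k) \<alpha> = 0")
  case True
  then obtain k0 where "k0 \<ge> 1" "poly (orb k0) \<alpha> = 0" by blast
  from order_structure_periodic[OF m this] obtain p where p: "p \<ge> 1"
    "\<And>k. k \<ge> 1 \<Longrightarrow> order \<alpha> (orb k) = (if p dvd k then 1 else 0)"
    "\<And>k. k \<ge> 1 \<Longrightarrow> order \<alpha> (cpoly (misiu m k)) = (if p dvd k \<and> p dvd m - 1 then 1 else 0)" by blast
  show ?thesis
    by (rule that[of p "if p dvd m - 1 then 1 else 0" 1]) (use p in auto)
next
  case False
  hence *: "poly (orb k) \<alpha> \<noteq> 0" if "k \<ge> 1" for k using that by blast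
  from order_structure_preperiodic[OF m this] obtain p e where p: "p \<ge> 1"
    "\<And>k. k \<ge> 1 \<Longrightarrow> order \<alpha> (cpoly (misiu m k)) = (if p dvd k then e else 0)" by blast
  show ?thesis
    by (rule that[of p e 0]) (use p * in \<open>auto intro: order_0I\<close>)
qed

subsection \<open>The polynomial \<open>G\<close>\<close>

lemma moebius_mu_1 [simp]: "moebius_mu (Suc 0) = 1"
  by (simp add: moebius_mu_def)

lemma moebius_mu_prime_mult:
  assumes "prime q" "squarefree j" "\<not> q dvd j"
  shows "moebius_mu (q * j) = - moebius_mu j"
proof -
  have cop: "coprime q j" using assms by (simp add: prime_imp_coprime)
  have "j \<noteq> 0" using assms(3) by (metis dvd_0_right)
  have "squarefree (q * j)" using assms cop by (simp add: squarefree_mult_coprime squarefree_prime)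
  moreover have "prime_factors (q * j) = insert q (prime_factors j)"
    using assms \<open>j \<noteq> 0\<close> by (subst prime_factors_product) (auto simp: prime_prime_factors)
  moreover have "q \<notin> prime_factors j" using assms(3) by auto
  ultimately show ?thesis using assms by (simp add: moebius_mu_def)
qed

lemma sum_moebius_divisors:
  assumes "N \<ge> 1"
  shows "(\<Sum>j | j dvd N. moebius_mu j) = (if N = 1 then 1 else 0)"
proof (cases "N = 1")
  case False
  then obtain q where q: "prime q" "q dvd N" using prime_factor_nat by blast
  have fin: "finite {j. j dvd N}" using assms by simp
  let ?A = "{j. j dvd N \<and> squarefree j \<and> \<not> q dvd j}" and ?B = "{j. j dvd N \<and> squarefree j \<and> q dvd j}"
  have "(\<Sum>j | j dvd N. moebius_mu j) = (\<Sum>j | j dvd N \<and> squarefree j. moebius_mu j)"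
    using fin by (intro sum.mono_neutral_right) (auto simp: moebius_mu_def)
  also have "\<dots> = (\<Sum>j\<in>?A \<union> ?B. moebius_mu j)" by (rule sum.cong) auto
  also have "\<dots> = (\<Sum>j\<in>?A. moebius_mu j) + (\<Sum>j\<in>?B. moebius_mu j)"
    by (rule sum.union_disjoint) (auto intro: finite_subset[OF _ fin])
  also have "(\<Sum>j\<in>?B. moebius_mu j) = (\<Sum>j\<in>?A. moebius_mu (q * j))"
  proof (rule sum.reindex_bij_witness[of _ "\<lambda>j. q * j" "\<lambda>j. j div q"])
    fix j assume j: "j \<in> ?B"
    then obtain i where i: "j = q * i" by (auto elim: dvdE)
    have "\<not> q dvd i"
    proof
      assume "q dvd i"
      hence "q ^ 2 dvd j" using i by (simp add: power2_eq_square)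
      thus False using j q by (auto simp: squarefree_def)
    qed
    moreover have "squarefree i" using j i by (auto intro: squarefree_mono[of i "q * i"])
    ultimately show "j div q \<in> ?A" using j i q by (auto dest: dvd_mult_right)
    show "q * (j div q) = j" using j by simp
    thus "moebius_mu (q * (j div q)) = moebius_mu j" by simp
  next
    fix j assume j: "j \<in> ?A"
    have cop: "coprime q j" using j q by (simp add: prime_imp_coprime)
    show "q * j div q = j" using q by simp
    show "q * j \<in> ?B" using j q cop by (simp add: divides_mult squarefree_mult_coprime squarefree_prime)
  qed
  also have "\<dots> = (\<Sum>j\<in>?A. - moebius_mu j)"
    using q by (intro sum.cong) (auto simp: moebius_mu_prime_mult)
  finally show ?thesis using False by (simp add: sum_negf)
qed (simp add: moebius_mu_def)

lemma sum_moebius_multiples: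
  assumes "n \<ge> 1" "p \<ge> 1"
  shows "(\<Sum>k | k dvd n. moebius_mu (n div k) * (if p dvd k then c else 0)) = (if p = n then c else 0)"
proof (cases "p dvd n")
  case False
  thus ?thesis by (auto intro!: sum.neutral dest: dvd_trans)
next
  case True
  then obtain N where N: "n = p * N" by (auto elim: dvdE)
  with assms have N1: "N \<ge> 1" by (cases N) auto
  have "(\<Sum>k | k dvd n. moebius_mu (n div k) * (if p dvd k then c else 0))
      = (\<Sum>k | k dvd n \<and> p dvd k. moebius_mu (n div k) * c)"
    using assms by (intro sum.mono_neutral_cong_right) auto
  also have "\<dots> = (\<Sum>j | j dvd N. moebius_mu j * c)"
  proof (rule sum.reindex_bij_witness[of _ "\<lambda>j. p * (N div j)" "\<lambda>k. n div k"])
    fix k assume k: "k \<in> {k. k dvd n \<and> p dvd k}"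
    then obtain i where i: "k = p * i" by (auto elim: dvdE)
    have "i dvd N" using k assms unfolding i N by simp
    then obtain l where l: "N = i * l" by (auto elim: dvdE)
    have "i \<ge> 1" "l \<ge> 1" using N1 l by (auto simp: Suc_le_eq)
    thus "p * (N div (n div k)) = k" "n div k \<in> {j. j dvd N}"
      using assms(2) by (simp_all add: N i l)
  next
    fix j assume "j \<in> {j. j dvd N}"
    then obtain l where l: "N = j * l" by (auto elim: dvdE)
    have "j \<ge> 1" "l \<ge> 1" using N1 l by (auto simp: Suc_le_eq)
    thus "n div (p * (N div j)) = j" "p * (N div j) \<in> {k. k dvd n \<and> p dvd k}"
      using assms(2) by (simp_all add: N l)
  qed auto
  also have "\<dots> = (if N = 1 then c else 0)"
    using sum_moebius_divisors[OF N1] by (simp flip: sum_distrib_right)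
  also have "N = 1 \<longleftrightarrow> p = n" using N assms by auto
  finally show ?thesis by simp
qed

text \<open>The exponents are split by sign, so that the quotient defining G becomes a quotient of
  two monic integer polynomials.\<close>

definition misiu_num :: "nat \<Rightarrow> nat \<Rightarrow> int poly" where
  "misiu_num m n = (\<Prod>k | k dvd n. misiu m k ^ nat (moebius_mu (n div k))) *
     (\<Prod>k | k dvd n. crit_orbit k ^ (if n dvd m - 1 then nat (- moebius_mu (n div k)) else 0))"

definition misiu_den :: "nat \<Rightarrow> nat \<Rightarrow> int poly" where
  "misiu_den m n = (\<Prod>k | k dvd n. misiu m k ^ nat (- moebius_mu (n div k))) *
     (\<Prod>k | k dvd n. crit_orbit k ^ (if n dvd m - 1 then nat (moebius_mu (n div k)) else 0))"

lemma divisor_ge_1: "n \<ge> 1 \<Longrightarrow> k dvd n \<Longrightarrow> (k::nat) \<ge> 1"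
  by (cases k) auto

lemma power_int_nat_quotient:
  fixes x :: "'a::field"
  assumes "x \<noteq> 0"
  shows "x powi i = x ^ nat i / x ^ nat (- i)"
  using assms by (auto simp: power_int_def field_simps)

lemma to_fract_power: "to_fract (x ^ n) = to_fract x ^ n"
  by (induction n) (auto simp: to_fract_mult)

lemma to_fract_prod: "to_fract (\<Prod>x\<in>A. f x) = (\<Prod>x\<in>A. to_fract (f x))"
  by (induction A rule: infinite_finite_induct) (auto simp: to_fract_mult)

lemma misiu_den_nonzero:
  assumes "m \<ge> 2" "n \<ge> 1"
  shows "lead_coeff (misiu_den m n) = 1" "lead_coeff (misiu_num m n) = 1"
proof -
  have "lead_coeff (misiu m k) = 1" "lead_coeff (crit_orbit k) = 1" if "k dvd n" for k
    using divisor_ge_1[OF assms(2) that] misiu_degree[of m k] crit_orbit_degree[of "k - 1"] assms by auto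
  thus "lead_coeff (misiu_den m n) = 1" "lead_coeff (misiu_num m n) = 1"
    by (simp_all add: misiu_den_def misiu_num_def lead_coeff_mult lead_coeff_prod lead_coeff_power)
qed

lemma misiurewicz_quot_eq:
  assumes "m \<ge> 2" "n \<ge> 1"
  shows "misiurewicz_quot m n = to_fract (misiu_num m n) / to_fract (misiu_den m n)"
proof -
  let ?K = "{k. k dvd n}" and ?\<mu> = "\<lambda>k. moebius_mu (n div k)"
  have nz: "to_fract (misiu m k) \<noteq> 0" "to_fract (crit_orbit k) \<noteq> 0" if "k \<in> ?K" for k
    using divisor_ge_1[OF assms(2)] that misiu_nonzero[of m k] crit_orbit_nonzero[of k] assms by auto
  have 1: "(\<Prod>k\<in>?K. to_fract (crit_orbit (m + k - 1) + crit_orbit (m - 1)) powi ?\<mu> k)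
     = (\<Prod>k\<in>?K. to_fract (misiu m k) ^ nat (?\<mu> k)) / (\<Prod>k\<in>?K. to_fract (misiu m k) ^ nat (- ?\<mu> k))"
    unfolding prod_dividef [symmetric]
    using power_int_nat_quotient[OF nz(1)] by (intro prod.cong refl) (simp only: misiu_def [symmetric])
  have 2: "(\<Prod>k\<in>?K. to_fract (crit_orbit k) powi (- ?\<mu> k))
     = (\<Prod>k\<in>?K. to_fract (crit_orbit k) ^ nat (- ?\<mu> k)) / (\<Prod>k\<in>?K. to_fract (crit_orbit k) ^ nat (?\<mu> k))"
    unfolding prod_dividef [symmetric]
    by (rule prod.cong) (auto simp: power_int_nat_quotient[OF nz(2)])
  show ?thesis
    unfolding misiurewicz_quot_def 1 2
    by (cases "n dvd m - 1")
      (simp_all add: misiu_num_def misiu_den_def to_fract_mult to_fract_power to_fract_prod)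
qed

lemma order_prod_power:
  fixes f :: "nat \<Rightarrow> complex poly"
  assumes "finite K" "\<And>k. k \<in> K \<Longrightarrow> f k \<noteq> 0"
  shows "(\<Prod>k\<in>K. f k ^ e k) \<noteq> 0" "order \<alpha> (\<Prod>k\<in>K. f k ^ e k) = (\<Sum>k\<in>K. e k * order \<alpha> (f k))"
proof -
  show nz: "(\<Prod>k\<in>K. f k ^ e k) \<noteq> 0" using assms by (auto simp: prod_zero_iff)
  have "count (proots (\<Prod>k\<in>K. f k ^ e k)) \<alpha> = (\<Sum>k\<in>K. e k * order \<alpha> (f k))"
    using assms by (subst proots_prod) (auto simp: proots_power count_sum intro!: sum.cong)
  thus "order \<alpha> (\<Prod>k\<in>K. f k ^ e k) = (\<Sum>k\<in>K. e k * order \<alpha> (f k))" using nz by simp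
qed

text \<open>The difference of the orders is a Moebius sum over the multiples of \<open>p\<close>,
  hence 0 unless p = n. In that case it is \<open>e\<close>, reduced by \<open>f\<close> if
  \<open>n\<close> divides m - 1; the last clause of \<open>order_structure\<close> makes this
  nonnegative. The first bound yields that G is a polynomial, the second that its roots are roots of
  \<open>misiu m n\<close>.\<close>

lemma order_num_den:
  assumes m: "m \<ge> 2" and n: "n \<ge> 1"
  shows "order \<alpha> (cpoly (misiu_den m n)) \<le> order \<alpha> (cpoly (misiu_num m n))"
    and "order \<alpha> (cpoly (misiu_num m n)) \<le> order \<alpha> (cpoly (misiu_den m n)) + order \<alpha> (cpoly (misiu m n))"
proof -
  obtain p e f where p: "p \<ge> 1"
    and oA: "\<And>k. k \<ge> 1 \<Longrightarrow> order \<alpha> (cpoly (misiu m k)) = (if p dvd k then e else 0)"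
    and oa: "\<And>k. k \<ge> 1 \<Longrightarrow> order \<alpha> (orb k) = (if p dvd k then f else 0)"
    and ef: "f = 0 \<or> e = (if p dvd m - 1 then f else 0)"
    using order_structure[OF m, where \<alpha> = \<alpha>] by blast
  let ?K = "{k. k dvd n}" and ?\<mu> = "\<lambda>k. moebius_mu (n div k)"
  have nz: "cpoly (misiu m k) \<noteq> 0" "orb k \<noteq> 0" if "k \<in> ?K" for k
    using divisor_ge_1[OF n] that misiu_nonzero[of m k] crit_orbit_nonzero[of k] m by auto
  have key: "order \<alpha> (cpoly ((\<Prod>k\<in>?K. misiu m k ^ a k) * (\<Prod>k\<in>?K. crit_orbit k ^ b k)))
      = (\<Sum>k\<in>?K. a k * order \<alpha> (cpoly (misiu m k))) + (\<Sum>k\<in>?K. b k * order \<alpha> (orb k))" for a b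
    using order_prod_power[of ?K "\<lambda>k. cpoly (misiu m k)"] order_prod_power[of ?K orb] nz n
    unfolding of_int_poly_hom.hom_mult of_int_poly_hom.hom_prod of_int_poly_hom.hom_power
    by (simp add: order_mult)
  note num = key[of "\<lambda>k. nat (?\<mu> k)" "\<lambda>k. if n dvd m - 1 then nat (- ?\<mu> k) else 0", folded misiu_num_def]
  note den = key[of "\<lambda>k. nat (- ?\<mu> k)" "\<lambda>k. if n dvd m - 1 then nat (?\<mu> k) else 0", folded misiu_den_def]
  define s where "s = (if n dvd m - 1 then 1 else 0 :: int)"
  have "int (order \<alpha> (cpoly (misiu_num m n))) - int (order \<alpha> (cpoly (misiu_den m n)))
     = (\<Sum>k\<in>?K. ?\<mu> k * (int (order \<alpha> (cpoly (misiu m k))) - s * int (order \<alpha> (orb k))))"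
    unfolding num den of_nat_add of_nat_sum of_nat_mult
    unfolding sum.distrib [symmetric] sum_subtractf [symmetric]
    by (intro sum.cong refl) (auto simp: s_def algebra_simps int_nat_eq)
  also have "\<dots> = (\<Sum>k\<in>?K. ?\<mu> k * (if p dvd k then int e - s * int f else 0))"
    using oA oa divisor_ge_1[OF n] by (intro sum.cong) auto
  also have "\<dots> = (if p = n then int e - s * int f else 0)"
    by (rule sum_moebius_multiples[OF n p])
  finally have *: "int (order \<alpha> (cpoly (misiu_num m n))) - int (order \<alpha> (cpoly (misiu_den m n))) = \<dots>" .
  show "order \<alpha> (cpoly (misiu_den m n)) \<le> order \<alpha> (cpoly (misiu_num m n))"
    using * ef by (auto simp: s_def split: if_splits)
  show "order \<alpha> (cpoly (misiu_num m n)) \<le> order \<alpha> (cpoly (misiu_den m n)) + order \<alpha> (cpoly (misiu m n))"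
    using * ef oA[OF n] by (auto simp: s_def split: if_splits)
qed

lemma dvd_of_order_le:
  fixes p q :: "complex poly"
  assumes "p \<noteq> 0" "q \<noteq> 0" "\<And>\<alpha>. order \<alpha> p \<le> order \<alpha> q"
  shows "p dvd q"
proof -
  have sub: "proots p \<subseteq># proots q" using assms by (auto intro!: mset_subset_eqI)
  have "(\<Prod>x\<in>#proots p. [:-x, 1:]) dvd (\<Prod>x\<in>#proots q. [:-x, 1:])"
    by (rule prod_mset_subset_imp_dvd) (rule image_mset_subseteq_mono[OF sub])
  hence "smult (lead_coeff p) (\<Prod>x\<in>#proots p. [:-x, 1:]) dvd smult (lead_coeff q) (\<Prod>x\<in>#proots q. [:-x, 1:])"
    using assms by (simp add: smult_dvd_iff dvd_smult)
  thus ?thesis unfolding complex_poly_decompose_multiset .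
qed

lemma int_dvd_of_complex_dvd:
  assumes "lead_coeff d = 1" "cpoly d dvd cpoly f"
  shows "d dvd f"
proof -
  obtain q r where qr: "f = d * q + r" "r = 0 \<or> degree r < degree d"
    using monic_division[OF assms(1)] by blast
  have "cpoly d dvd cpoly r"
    using assms(2) unfolding qr(1) of_int_poly_hom.hom_add of_int_poly_hom.hom_mult by (simp add: dvd_add_right_iff)
  have "r = 0"
  proof (rule ccontr)
    assume "r \<noteq> 0"
    hence "degree (cpoly d) \<le> degree (cpoly r)"
      using \<open>cpoly d dvd cpoly r\<close> by (intro dvd_imp_degree_le) auto
    thus False using qr(2) \<open>r \<noteq> 0\<close> by simp
  qed
  thus ?thesis using qr(1) by simp
qed

lemma misiurewicz_poly_mult:
  assumes "m \<ge> 2" "n \<ge> 1"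
  shows "misiu_num m n = misiu_den m n * misiurewicz_poly m n"
    and "lead_coeff (misiurewicz_poly m n) = 1"
proof -
  have nz: "misiu_den m n \<noteq> 0" "misiu_num m n \<noteq> 0" using misiu_den_nonzero[OF assms] by auto
  have "cpoly (misiu_den m n) dvd cpoly (misiu_num m n)"
    using order_num_den(1)[OF assms] nz by (intro dvd_of_order_le) auto
  then obtain G where G: "misiu_num m n = misiu_den m n * G"
    using int_dvd_of_complex_dvd[OF misiu_den_nonzero(1)[OF assms]] by (auto elim: dvdE)
  have "misiurewicz_poly m n = G"
    unfolding misiurewicz_poly_def
  proof (rule the_equality)
    show "to_fract G = misiurewicz_quot m n"
      using nz by (simp add: misiurewicz_quot_eq[OF assms] G to_fract_mult)
    show "G' = G" if "to_fract G' = misiurewicz_quot m n" for G'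
      using that nz by (simp add: misiurewicz_quot_eq[OF assms] G to_fract_mult)
  qed
  with G show *: "misiu_num m n = misiu_den m n * misiurewicz_poly m n" by simp
  show "lead_coeff (misiurewicz_poly m n) = 1"
    using misiu_den_nonzero[OF assms] unfolding * lead_coeff_mult by simp
qed

lemma misiurewicz_poly_root:
  assumes m: "m \<ge> 2" and n: "n \<ge> 1" and "poly (cpoly (misiurewicz_poly m n)) \<alpha> = 0"
  shows "poly (cpoly (misiu m n)) \<alpha> = 0"
proof -
  let ?G = "misiurewicz_poly m n"
  have nz: "misiu_den m n \<noteq> 0" "?G \<noteq> 0" "misiu m n \<noteq> 0"
    using misiu_den_nonzero[OF m n] misiurewicz_poly_mult(2)[OF m n] misiu_nonzero[of m n] m n by auto
  have "order \<alpha> (cpoly (misiu_num m n)) = order \<alpha> (cpoly (misiu_den m n)) + order \<alpha> (cpoly ?G)"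
    unfolding misiurewicz_poly_mult(1)[OF m n] of_int_poly_hom.hom_mult using nz by (simp add: order_mult)
  hence "order \<alpha> (cpoly ?G) \<le> order \<alpha> (cpoly (misiu m n))"
    using order_num_den(2)[OF m n, of \<alpha>] by simp
  moreover have "order \<alpha> (cpoly ?G) \<noteq> 0" using assms(3) nz by (simp add: order_root)
  ultimately show ?thesis by (simp add: order_root)
qed

section \<open>Sums over roots with multiplicity, and their reduction from G to its factors\<close>

definition root_sum :: "complex poly \<Rightarrow> (complex \<Rightarrow> complex) \<Rightarrow> complex" where
  "root_sum p g = (\<Sum>\<alpha>\<in>#proots p. g \<alpha>)"

lemma root_sum_mult: "p \<noteq> 0 \<Longrightarrow> q \<noteq> 0 \<Longrightarrow> root_sum (p * q) g = root_sum p g + root_sum q g"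
  by (simp add: root_sum_def proots_mult)

lemma root_sum_power: "root_sum (p ^ k) g = of_nat k * root_sum p g"
  unfolding root_sum_def proots_power by (induction k) (auto simp: algebra_simps sum_mset.distrib)

lemma root_sum_prod:
  assumes "\<And>k. k \<in> K \<Longrightarrow> f k \<noteq> 0"
  shows "root_sum (\<Prod>k\<in>K. f k) g = (\<Sum>k\<in>K. root_sum (f k) g)"
  using assms by (induction K rule: infinite_finite_induct) (auto simp: root_sum_mult root_sum_def proots_mult)

lemma root_sum_cong:
  assumes "p \<noteq> 0" "\<And>\<alpha>. poly p \<alpha> = 0 \<Longrightarrow> g \<alpha> = h \<alpha>"
  shows "root_sum p g = root_sum p h"
  using assms by (auto simp: root_sum_def intro!: arg_cong[where f = sum_mset] image_mset_cong)

text \<open>A sum over the roots turns the product into a sum weighted by the exponents. The factors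
  a_k drop out because \<open>g\<close> vanishes at their roots, so the formula is the same whether
  or not \<open>n\<close> divides m - 1.\<close>

lemma root_sum_misiurewicz_poly:
  assumes m: "m \<ge> 2" and n: "n \<ge> 1"
    and g: "\<And>k \<alpha>. k dvd n \<Longrightarrow> poly (orb k) \<alpha> = 0 \<Longrightarrow> g \<alpha> = 0"
  shows "root_sum (cpoly (misiurewicz_poly m n)) g
       = (\<Sum>k | k dvd n. of_int (moebius_mu (n div k)) * root_sum (cpoly (misiu m k)) g)"
proof -
  let ?K = "{k. k dvd n}" and ?\<mu> = "\<lambda>k. moebius_mu (n div k)"
  have nz: "cpoly (misiu m k) \<noteq> 0" "orb k \<noteq> 0" if "k \<in> ?K" for k
    using divisor_ge_1[OF n] that misiu_nonzero[of m k] crit_orbit_nonzero[of k] m by auto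
  have nz': "cpoly (misiu_den m n) \<noteq> 0" "cpoly (misiurewicz_poly m n) \<noteq> 0"
    using misiu_den_nonzero[OF m n] misiurewicz_poly_mult(2)[OF m n] by auto
  have orb0: "root_sum (orb k) g = 0" if "k \<in> ?K" for k
    using g[of k] that root_sum_cong[OF nz(2)[OF that], of g "\<lambda>_. 0"] by (simp add: root_sum_def)
  have key: "root_sum (cpoly ((\<Prod>k\<in>?K. misiu m k ^ e k) * (\<Prod>k\<in>?K. crit_orbit k ^ e' k))) g
      = (\<Sum>k\<in>?K. of_nat (e k) * root_sum (cpoly (misiu m k)) g)" for e e'
  proof -
    have 1: "root_sum (\<Prod>k\<in>?K. cpoly (misiu m k) ^ e k) g = (\<Sum>k\<in>?K. of_nat (e k) * root_sum (cpoly (misiu m k)) g)"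
      using nz(1) by (subst root_sum_prod) (auto simp: root_sum_power)
    have 2: "root_sum (\<Prod>k\<in>?K. orb k ^ e' k) g = 0"
      using nz(2) orb0 by (subst root_sum_prod) (auto simp: root_sum_power)
    have 3: "(\<Prod>k\<in>?K. cpoly (misiu m k) ^ e k) \<noteq> 0" "(\<Prod>k\<in>?K. orb k ^ e' k) \<noteq> 0"
      using nz n by (auto simp: prod_zero_iff)
    show ?thesis
      unfolding of_int_poly_hom.hom_mult of_int_poly_hom.hom_prod of_int_poly_hom.hom_power
        root_sum_mult[OF 3] 1 2 by simp
  qed
  have "root_sum (cpoly (misiu_num m n)) g
      = root_sum (cpoly (misiu_den m n)) g + root_sum (cpoly (misiurewicz_poly m n)) g"
    unfolding misiurewicz_poly_mult(1)[OF m n] of_int_poly_hom.hom_mult using nz' by (rule root_sum_mult)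
  hence "root_sum (cpoly (misiurewicz_poly m n)) g
      = (\<Sum>k\<in>?K. of_nat (nat (?\<mu> k)) * root_sum (cpoly (misiu m k)) g)
      - (\<Sum>k\<in>?K. of_nat (nat (- ?\<mu> k)) * root_sum (cpoly (misiu m k)) g)"
    unfolding misiu_num_def misiu_den_def key by (simp add: algebra_simps)
  also have "\<dots> = (\<Sum>k\<in>?K. of_int (?\<mu> k) * root_sum (cpoly (misiu m k)) g)"
    unfolding sum_subtractf [symmetric] left_diff_distrib [symmetric]
  proof -
    have "(of_nat (nat i) - of_nat (nat (- i)) :: complex) = of_int i" for i by (cases "i \<ge> 0") auto
    thus "(\<Sum>k\<in>?K. (of_nat (nat (?\<mu> k)) - of_nat (nat (- ?\<mu> k))) * root_sum (cpoly (misiu m k)) g)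
        = (\<Sum>k\<in>?K. of_int (?\<mu> k) * root_sum (cpoly (misiu m k)) g)" by simp
  qed
  finally show ?thesis .
qed

subsection \<open>The reciprocal polynomial of the multipliers\<close>

text \<open>The multiplier without its factor \<open>2 ^ n\<close>; its values at the roots of G are
  the x_j of the overview.\<close>

definition theta :: "nat \<Rightarrow> nat \<Rightarrow> int poly" where
  "theta m n = (\<Prod>i<n. crit_orbit (m + i))"

lemma poly_theta: "poly (cpoly (theta m n)) \<alpha> = (\<Prod>i<n. poly (orb (m + i)) \<alpha>)"
  by (simp add: theta_def of_int_poly_hom.hom_prod poly_prod)

lemma cycle_multiplier_eq: "cycle_multiplier m n \<alpha> = poly (cpoly (smult (2 ^ n) (theta m n))) \<alpha>"
  by (simp add: cycle_multiplier_def poly_theta of_int_hom.map_poly_hom_smult)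

lemma cpoly_reflect_poly: "cpoly (reflect_poly p) = reflect_poly (cpoly p)"
  by (rule poly_eqI) (simp add: coeff_reflect_poly)

text \<open>The coefficient of index \<open>k\<close> is (-1)^k times the \<open>k\<close>-th
  elementary symmetric function, whatever the size of the multiset. This makes multisets of
  different sizes comparable.\<close>

definition rev_prod :: "complex multiset \<Rightarrow> complex poly" where
  "rev_prod A = (\<Prod>x\<in>#A. [:1, -x:])"

lemma rev_prod_empty [simp]: "rev_prod {#} = 1"
  and rev_prod_add [simp]: "rev_prod (add_mset x A) = [:1, -x:] * rev_prod A"
  and rev_prod_union: "rev_prod (A + B) = rev_prod A * rev_prod B"
  by (simp_all add: rev_prod_def)

lemma reflect_poly_prod_linear: "reflect_poly (\<Prod>x\<in>#A. [:-x, 1:]) = rev_prod A"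
proof (induction A)
  case (add x A)
  have "reflect_poly [:-x, 1:] = [:1, -x :: complex:]"
    by (rule poly_eqI) (auto simp: coeff_reflect_poly coeff_pCons split: nat.splits)
  thus ?case using add by (simp add: reflect_poly_mult del: mult_pCons_left)
qed simp

lemma coeff_rev_prod_scale: "coeff (rev_prod (image_mset (\<lambda>x. c * x) A)) k = c ^ k * coeff (rev_prod A) k"
proof (induction A arbitrary: k)
  case (add x A)
  show ?case by (cases k) (simp_all add: add.IH, simp add: algebra_simps)
qed (simp add: one_pCons coeff_pCons split: nat.splits)

lemma coeff_rev_prod_0 [simp]: "coeff (rev_prod A) 0 = 1"
  by (induction A) simp_all

lemma coeff_rev_prod_1: "coeff (rev_prod A) (Suc 0) = - \<Sum>\<^sub># A"
  by (induction A) simp_all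

text \<open>Root squaring: if F is the product of all 1 - x t, then F(t) F(-t) is the corresponding
  product for the squares, evaluated at t^2.\<close>

lemma coeff_rev_prod_square:
  "coeff (rev_prod (image_mset (\<lambda>x. x ^ 2) A)) k
     = (\<Sum>i\<le>2*k. coeff (rev_prod A) i * ((-1) ^ (2*k - i) * coeff (rev_prod A) (2*k - i)))"
proof -
  have *: "coeff (q \<circ>\<^sub>p [:0, 0, 1:]) (2 * k) = coeff q k" for q :: "complex poly" and k
  proof (induction q arbitrary: k)
    case (pCons a q)
    show ?case by (cases k) (simp_all add: pcompose_pCons pCons.IH coeff_pCons split: nat.splits)
  qed simp
  have "rev_prod A * rev_prod (image_mset (\<lambda>x. (-1) * x) A) = rev_prod (image_mset (\<lambda>x. x ^ 2) A) \<circ>\<^sub>p [:0, 0, 1:]"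
  proof (induction A)
    case (add x A)
    have "rev_prod (add_mset x A) * rev_prod (image_mset (\<lambda>x. (-1) * x) (add_mset x A))
        = ([:1, -x:] * [:1, x:]) * (rev_prod A * rev_prod (image_mset (\<lambda>x. (-1) * x) A))"
      by (simp add: mult_ac del: mult_pCons_left mult_pCons_right)
    also have "[:1, -x:] * [:1, x:] = [:1, - (x ^ 2):] \<circ>\<^sub>p [:0, 0, 1:]"
      by (simp add: pcompose_pCons power2_eq_square)
    finally show ?case unfolding add.IH by (simp only: image_mset_add_mset rev_prod_add pcompose_mult)
  qed (simp add: pcompose_1)
  hence "coeff (rev_prod (image_mset (\<lambda>x. x ^ 2) A)) k
      = coeff (rev_prod A * rev_prod (image_mset (\<lambda>x. (-1) * x) A)) (2 * k)"
    by (simp add: *)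
  thus ?thesis unfolding coeff_mult coeff_rev_prod_scale .
qed

lemma rev_norm_exists:
  assumes "lead_coeff G = 1"
  obtains S where "cpoly S = rev_prod (image_mset (poly (cpoly h)) (proots (cpoly G)))"
proof -
  obtain E where E: "\<And>\<phi>::int \<Rightarrow> complex. comm_ring_hom \<phi> \<Longrightarrow>
        map_poly \<phi> E = (\<Prod>\<alpha>\<in>#proots (map_poly \<phi> G). [:- poly (map_poly \<phi> h) \<alpha>, 1:])"
    using norm_poly_exists[OF assms, of h] by metis
  have "cpoly E = (\<Prod>x\<in>#image_mset (poly (cpoly h)) (proots (cpoly G)). [:-x, 1:])"
    by (subst E) (simp_all add: of_int_hom.comm_ring_hom_axioms multiset.map_comp o_def)
  hence "cpoly (reflect_poly E) = rev_prod (image_mset (poly (cpoly h)) (proots (cpoly G)))"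
    unfolding cpoly_reflect_poly by (simp only: reflect_poly_prod_linear)
  thus ?thesis by (rule that)
qed

section \<open>Parity of the symmetric functions of the x_j\<close>

lemma even_symmetric_sum:
  fixes f :: "nat \<Rightarrow> int"
  assumes "\<And>i. i \<le> 2 * k \<Longrightarrow> f (2 * k - i) = f i"
  shows "even ((\<Sum>i\<le>2*k. f i) - f k)"
proof -
  have "(\<Sum>i\<le>2*k. f i) = (\<Sum>i\<in>{..<k} \<union> {k} \<union> {k<..2*k}. f i)"
    by (rule sum.cong) auto
  also have "\<dots> = (\<Sum>i<k. f i) + f k + (\<Sum>i\<in>{k<..2*k}. f i)"
    by (subst sum.union_disjoint; auto)+
  also have "(\<Sum>i\<in>{k<..2*k}. f i) = (\<Sum>i<k. f i)"
    using assms by (intro sum.reindex_bij_witness[of _ "\<lambda>i. 2 * k - i" "\<lambda>i. 2 * k - i"]) auto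
  finally show ?thesis by simp
qed

text \<open>In the convolution for the squared roots the terms \<open>i\<close> and 2 k - i are
  equal, so modulo 2 only the middle term survives. It is the square of \<open>coeff S k\<close> up
  to sign, and an integer has the parity of its square.\<close>

lemma coeff_square_parity:
  assumes "cpoly S = rev_prod A" "cpoly T = rev_prod (image_mset (\<lambda>x. x ^ 2) A)"
  shows "even (coeff T k - coeff S k)"
proof -
  define f where "f = (\<lambda>i. coeff S i * ((-1) ^ (2*k - i) * coeff S (2*k - i)))"
  have S: "of_int (coeff S i) = coeff (rev_prod A) i" for i
    using assms(1) by (simp flip: of_int_hom.coeff_map_poly_hom)
  have "complex_of_int (coeff T k) = coeff (cpoly T) k" by simp
  also have "\<dots> = of_int (\<Sum>i\<le>2*k. f i)"
    unfolding assms(2) coeff_rev_prod_square f_def by (simp add: S)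
  finally have T: "coeff T k = (\<Sum>i\<le>2*k. f i)" by (simp only: of_int_eq_iff)
  have "f (2 * k - i) = f i" if "i \<le> 2 * k" for i
  proof -
    have "(-1 :: int) ^ (2 * k - i) = (-1) ^ i" using that by (simp add: minus_one_power_iff)
    thus ?thesis using that by (simp add: f_def mult_ac)
  qed
  hence "even (coeff T k - f k)" unfolding T by (rule even_symmetric_sum)
  moreover have "even (f k - coeff S k)"
    by (cases "even k") (auto simp: f_def mult_2 algebra_simps)
  ultimately show ?thesis using dvd_add[of 2 "coeff T k - f k" "f k - coeff S k"] by simp
qed

text \<open>Modulo 2 squaring is additive and the two copies of c cancel, so raising both indices by
  one squares the sum.\<close>

lemma misiu_mod_2: "\<exists>h. crit_orbit (i + n) + crit_orbit i = crit_orbit n ^ (2 ^ i) + 2 * h"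
proof (induction i)
  case (Suc i)
  then obtain h where h: "crit_orbit (i + n) + crit_orbit i = crit_orbit n ^ (2 ^ i) + 2 * h" by blast
  have "crit_orbit (Suc i + n) + crit_orbit (Suc i)
      = (crit_orbit (i + n) + crit_orbit i) ^ 2 + 2 * ([:0, 1:] - crit_orbit (i + n) * crit_orbit i)"
    by (simp add: crit_orbit.simps(2) power2_eq_square algebra_simps)
  also have "\<dots> = crit_orbit n ^ (2 ^ Suc i)
      + 2 * (2 * h * crit_orbit n ^ (2 ^ i) + 2 * h ^ 2 + ([:0, 1:] - crit_orbit (i + n) * crit_orbit i))"
    unfolding h power_Suc power_mult by (simp add: power2_eq_square algebra_simps)
  finally show ?case by blast
qed (intro exI[of _ 0], simp)

lemma crit_orbit_dvd_mult: "crit_orbit n dvd crit_orbit (j * n)"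
proof (induction j)
  case (Suc j)
  have "crit_orbit n dvd crit_orbit (n + j * n) - crit_orbit (0 + j * n)"
    unfolding crit_orbit_diff_shift by simp
  from dvd_add[OF this Suc] show ?case by simp
qed simp

text \<open>Among \<open>n\<close> consecutive indices one is a multiple of \<open>n\<close>; the
  witness \<open>i\<close> leads from \<open>m\<close> to it.\<close>

lemma crit_orbit_dvd_theta:
  assumes "n \<ge> 1"
  shows "crit_orbit n dvd theta m n"
proof -
  define i where "i = (n - m mod n) mod n"
  have i: "i < n" using assms by (simp add: i_def)
  have "(m + i) mod n = (m mod n + (n - m mod n)) mod n"
    unfolding i_def by (simp only: mod_add_left_eq mod_add_right_eq)
  also have "\<dots> = 0" using assms by simp
  finally obtain j where "m + i = j * n" by (metis mod_0_imp_dvd dvd_def mult.commute)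
  hence "crit_orbit n dvd crit_orbit (m + i)" using crit_orbit_dvd_mult by metis
  also have "\<dots> dvd theta m n" unfolding theta_def using i by (intro dvd_prodI) auto
  finally show ?thesis .
qed

lemma theta_power_even:
  assumes "m \<ge> 1" "n \<ge> 1"
  obtains h where "\<And>\<alpha>. poly (cpoly (misiu m n)) \<alpha> = 0 \<Longrightarrow>
    poly (cpoly (theta m n)) \<alpha> ^ (2 ^ (m - 1)) = 2 * poly (cpoly h) \<alpha>"
proof -
  obtain h where h: "crit_orbit (m - 1 + n) + crit_orbit (m - 1) = crit_orbit n ^ (2 ^ (m - 1)) + 2 * h"
    using misiu_mod_2 by blast
  obtain w where w: "theta m n = crit_orbit n * w" using crit_orbit_dvd_theta[OF assms(2)] by (auto elim: dvdE)
  have "theta m n ^ (2 ^ (m - 1)) = (misiu m n - 2 * h) * w ^ (2 ^ (m - 1))"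
    using h assms by (simp add: w power_mult_distrib misiu_def)
  hence "cpoly (theta m n) ^ (2 ^ (m - 1)) = (cpoly (misiu m n) - smult 2 (cpoly h)) * cpoly w ^ (2 ^ (m - 1))"
    by (simp add: of_int_poly_hom.hom_mult of_int_poly_hom.hom_minus of_int_hom.map_poly_hom_smult
        numeral_poly flip: of_int_poly_hom.hom_power)
  hence eq: "poly (cpoly (theta m n)) \<alpha> ^ (2 ^ (m - 1))
      = (poly (cpoly (misiu m n)) \<alpha> - 2 * poly (cpoly h) \<alpha>) * poly (cpoly w) \<alpha> ^ (2 ^ (m - 1))" for \<alpha>
    by (metis poly_mult poly_power poly_diff poly_smult)
  show ?thesis
    by (rule that[of "- h * w ^ (2 ^ (m - 1))"])
      (subst eq, simp add: of_int_poly_hom.hom_mult of_int_poly_hom.hom_uminus of_int_poly_hom.hom_power)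
qed

text \<open>Squaring all values preserves the coefficients modulo 2. After m - 1 squarings the
  values are twice values of an integer polynomial, so the coefficient of index \<open>k\<close> is
  divisible by 2^k. The polynomial \<open>G\<close> is kept general because both G_(m,n) and its
  single factors are needed.\<close>

lemma rev_prod_theta_even:
  assumes mn: "m \<ge> 1" "n \<ge> 1" and G: "lead_coeff G = 1"
    and roots: "\<And>\<alpha>. poly (cpoly G) \<alpha> = 0 \<Longrightarrow> poly (cpoly (misiu m n)) \<alpha> = 0"
    and S: "cpoly S = rev_prod (image_mset (poly (cpoly (theta m n))) (proots (cpoly G)))"
    and k: "k \<ge> 1"
  shows "even (coeff S k)"
proof -
  let ?\<theta> = "poly (cpoly (theta m n))" and ?R = "proots (cpoly G)"
  have "\<exists>T. cpoly T = rev_prod (image_mset (\<lambda>\<alpha>. ?\<theta> \<alpha> ^ (2 ^ j)) ?R)" for j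
  proof -
    obtain T where "cpoly T = rev_prod (image_mset (poly (cpoly (theta m n ^ (2 ^ j)))) ?R)"
      using rev_norm_exists[OF G] by blast
    also have "poly (cpoly (theta m n ^ (2 ^ j))) = (\<lambda>\<alpha>. ?\<theta> \<alpha> ^ (2 ^ j))"
      by (rule ext) (simp add: of_int_poly_hom.hom_power)
    finally show ?thesis by blast
  qed
  then obtain T where T: "\<And>j. cpoly (T j) = rev_prod (image_mset (\<lambda>\<alpha>. ?\<theta> \<alpha> ^ (2 ^ j)) ?R)" by metis
  have step: "even (coeff (T (Suc j)) k - coeff (T j) k)" for j
    by (rule coeff_square_parity[OF T]) (simp add: T multiset.map_comp o_def mult.commute flip: power_mult)
  have "even (coeff (T j) k - coeff (T 0) k)" for j
  proof (induction j)
    case (Suc j)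
    from dvd_add[OF step[of j] this] show ?case by simp
  qed simp
  moreover have "even (coeff (T (m - 1)) k)"
  proof -
    obtain h where h: "\<And>\<alpha>. poly (cpoly (misiu m n)) \<alpha> = 0 \<Longrightarrow> ?\<theta> \<alpha> ^ (2 ^ (m - 1)) = 2 * poly (cpoly h) \<alpha>"
      using theta_power_even[OF mn] by blast
    have "cpoly G \<noteq> 0" using G by auto
    hence "image_mset (\<lambda>\<alpha>. ?\<theta> \<alpha> ^ (2 ^ (m - 1))) ?R = image_mset (\<lambda>x. 2 * x) (image_mset (poly (cpoly h)) ?R)"
      using h roots by (auto simp: multiset.map_comp intro!: image_mset_cong)
    moreover obtain U where U: "cpoly U = rev_prod (image_mset (poly (cpoly h)) ?R)"
      using rev_norm_exists[OF G] by blast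
    ultimately have "coeff (cpoly (T (m - 1))) k = 2 ^ k * coeff (cpoly U) k"
      unfolding T U by (simp only: coeff_rev_prod_scale)
    hence "complex_of_int (coeff (T (m - 1)) k) = of_int (2 ^ k * coeff U k)" by simp
    hence "coeff (T (m - 1)) k = 2 ^ k * coeff U k" by (simp only: of_int_eq_iff)
    thus ?thesis using k by simp
  qed
  moreover have "T 0 = S"
  proof -
    have "cpoly (T 0) = cpoly S" using T[of 0] S by simp
    thus ?thesis using of_int_poly_hom.eq_iff by metis
  qed
  ultimately show ?thesis by (metis dvd_diff_commute dvd_add_right_iff diff_add_cancel even_diff)
qed

section \<open>The coefficients of the multiplier polynomial\<close>

abbreviation misi_roots :: "nat \<Rightarrow> nat \<Rightarrow> complex multiset" where
  "misi_roots m n \<equiv> proots (cpoly (misiurewicz_poly m n))"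

text \<open>Reversal puts the \<open>k\<close>-th coefficient below the leading one at index
  \<open>k\<close>, so levels \<open>m\<close> and m + 1 can be compared although the degrees
  differ.\<close>

definition lam_poly :: "nat \<Rightarrow> nat \<Rightarrow> int poly" where
  "lam_poly m n = reflect_poly (multiplier_poly m n)"

lemma multiplier_poly_eq:
  assumes "m \<ge> 2" "n \<ge> 1"
  shows "cpoly (multiplier_poly m n) = (\<Prod>x\<in>#image_mset (cycle_multiplier m n) (misi_roots m n). [:-x, 1:])"
    and "lead_coeff (multiplier_poly m n) = 1"
proof -
  obtain E where E: "lead_coeff E = 1" "\<And>\<phi>::int \<Rightarrow> complex. comm_ring_hom \<phi> \<Longrightarrow>
        map_poly \<phi> E = (\<Prod>\<alpha>\<in>#proots (map_poly \<phi> (misiurewicz_poly m n)).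
          [:- poly (map_poly \<phi> (smult (2 ^ n) (theta m n))) \<alpha>, 1:])"
    using norm_poly_exists[OF misiurewicz_poly_mult(2)[OF assms], of "smult (2 ^ n) (theta m n)"] by metis
  have cE: "cpoly E = (\<Prod>\<alpha>\<in>#misi_roots m n. [:- cycle_multiplier m n \<alpha>, 1:])"
    unfolding cycle_multiplier_eq by (rule E(2)) (rule of_int_hom.comm_ring_hom_axioms)
  have "multiplier_poly m n = E"
    unfolding multiplier_poly_def
  proof (rule the_equality)
    show "cpoly E = (\<Prod>\<alpha>\<in>#misi_roots m n. [:- cycle_multiplier m n \<alpha>, 1:])" by (rule cE)
    show "P = E" if "cpoly P = (\<Prod>\<alpha>\<in>#misi_roots m n. [:- cycle_multiplier m n \<alpha>, 1:])" for P
      using that cE of_int_poly_hom.eq_iff by metis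
  qed
  thus "cpoly (multiplier_poly m n) = (\<Prod>x\<in>#image_mset (cycle_multiplier m n) (misi_roots m n). [:-x, 1:])"
    and "lead_coeff (multiplier_poly m n) = 1"
    using cE E(1) by (simp_all add: multiset.map_comp o_def)
qed

lemma cpoly_lam_poly:
  assumes "m \<ge> 2" "n \<ge> 1"
  shows "cpoly (lam_poly m n) = rev_prod (image_mset (cycle_multiplier m n) (misi_roots m n))"
  unfolding lam_poly_def cpoly_reflect_poly multiplier_poly_eq(1)[OF assms] by (rule reflect_poly_prod_linear)

lemma coeff_lam_poly_1:
  assumes "m \<ge> 2" "n \<ge> 1"
  shows "of_int (coeff (lam_poly m n) 1) = - root_sum (cpoly (misiurewicz_poly m n)) (cycle_multiplier m n)"
proof -
  have "of_int (coeff (lam_poly m n) 1) = coeff (cpoly (lam_poly m n)) 1" by simp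
  thus ?thesis unfolding cpoly_lam_poly[OF assms] by (simp add: coeff_rev_prod_1 root_sum_def)
qed

lemma proots_prod_linear: "proots (\<Prod>x\<in>#A. [:-x, 1 :: complex:]) = A"
proof (induction A)
  case (add x A)
  have "(\<Prod>x\<in>#A. [:-x, 1 :: complex:]) \<noteq> 0" by (auto simp: prod_mset_zero_iff)
  thus ?case using add by (simp add: proots_mult del: mult_pCons_left)
qed simp

lemma root_trace_multiplier_poly:
  assumes "m \<ge> 2" "n \<ge> 1"
  shows "root_trace (multiplier_poly m n) = - coeff (lam_poly m n) 1"
proof -
  have *: "of_int (- coeff (lam_poly m n) 1) = (\<Sum>x\<in>#image_mset (cycle_multiplier m n) (misi_roots m n). x)"
    using coeff_lam_poly_1[OF assms] by (simp add: root_sum_def)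
  show ?thesis
    unfolding root_trace_def multiplier_poly_eq(1)[OF assms] proots_prod_linear
  proof (rule the_equality)
    show "t = - coeff (lam_poly m n) 1"
      if "of_int t = (\<Sum>x\<in>#image_mset (cycle_multiplier m n) (misi_roots m n). x)" for t
      using that unfolding * [symmetric] by (simp only: of_int_eq_iff)
  qed (rule *)
qed

lemma special_poly_multiplier_iff:
  assumes "m \<ge> 2" "n \<ge> 1"
  defines "D \<equiv> degree (multiplier_poly m n)" and "\<epsilon> \<equiv> coeff (lam_poly m n)"
  shows "special_poly 2 (multiplier_poly m n) \<longleftrightarrow> D > 0 \<and> padic_val 2 (\<epsilon> 1) > 1 \<and>
           (\<forall>k. 2 \<le> k \<and> k \<le> D \<longrightarrow> padic_val 2 (\<epsilon> k) > padic_val 2 (\<epsilon> 1))"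
proof (cases "D = 0")
  case False
  have e: "coeff (multiplier_poly m n) (D - k) = \<epsilon> k" if "k \<le> D" for k
    using that by (simp add: \<epsilon>_def lam_poly_def D_def coeff_reflect_poly)
  have two: "padic_val 2 2 = 1" by (simp add: padic_val_def one_ereal_def)
  have "(\<forall>j. j + 2 \<le> D \<longrightarrow> padic_val 2 (coeff (multiplier_poly m n) j) > padic_val 2 (\<epsilon> 1))
    \<longleftrightarrow> (\<forall>k. 2 \<le> k \<and> k \<le> D \<longrightarrow> padic_val 2 (\<epsilon> k) > padic_val 2 (\<epsilon> 1))" (is "?l = ?r")
  proof
    assume ?l
    thus ?r using e by (metis diff_le_self le_add_diff_inverse2 diff_diff_cancel add_le_cancel_left le_diff_conv2 add.commute)
  next
    assume r: ?r
    show ?l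
    proof (intro allI impI)
      fix j assume "j + 2 \<le> D"
      thus "padic_val 2 (coeff (multiplier_poly m n) j) > padic_val 2 (\<epsilon> 1)"
        using e[of "D - j"] r[rule_format, of "D - j"] by simp
    qed
  qed
  thus ?thesis using False e[of 1] multiplier_poly_eq(2)[OF assms(1,2)]
    by (simp add: special_poly_def two flip: D_def)
qed (simp add: special_poly_def flip: D_def)

lemma lam_poly_coeff_dvd:
  assumes "m \<ge> 2" "n \<ge> 1" "k \<ge> 1"
  shows "2 ^ (n * k + 1) dvd coeff (lam_poly m n) k"
proof -
  let ?R = "misi_roots m n"
  obtain S where S: "cpoly S = rev_prod (image_mset (poly (cpoly (theta m n))) ?R)"
    using rev_norm_exists[OF misiurewicz_poly_mult(2)[OF assms(1,2)]] by blast
  have "complex_of_int (coeff (lam_poly m n) k) = coeff (cpoly (lam_poly m n)) k" by simp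
  also have "image_mset (cycle_multiplier m n) ?R
      = image_mset (\<lambda>x. 2 ^ n * x) (image_mset (poly (cpoly (theta m n))) ?R)"
    by (auto intro!: image_mset_cong simp: multiset.map_comp cycle_multiplier_eq of_int_hom.map_poly_hom_smult)
  hence "coeff (cpoly (lam_poly m n)) k = of_int ((2 ^ n) ^ k * coeff S k)"
    unfolding cpoly_lam_poly[OF assms(1,2)] by (simp add: coeff_rev_prod_scale flip: S)
  finally have "coeff (lam_poly m n) k = (2 ^ n) ^ k * coeff S k" by (simp only: of_int_eq_iff)
  moreover have "even (coeff S k)"
    using assms misiurewicz_poly_mult(2)[OF assms(1,2)] misiurewicz_poly_root[OF assms(1,2)] S
    by (intro rev_prod_theta_even[of m n "misiurewicz_poly m n" S k]) auto
  ultimately show ?thesis by (simp add: power_mult mult.commute[of "(2 ^ n) ^ k"])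
qed

subsection \<open>Traces over the roots of a family of polynomials\<close>

text \<open>The trace is minus the second coefficient of the polynomial in
  \<open>norm_poly_exists\<close>. With \<open>'a = complex poly\<close> it is therefore a
  polynomial in the parameter.\<close>

lemma root_sum_ring_exists:
  fixes G H :: "'a::idom poly"
  assumes "lead_coeff G = 1" "degree G > 0"
  obtains \<tau> where "\<And>\<phi>::'a \<Rightarrow> complex. comm_ring_hom \<phi> \<Longrightarrow>
    root_sum (map_poly \<phi> G) (poly (map_poly \<phi> H)) = \<phi> \<tau>"
proof -
  have top: "coeff (\<Prod>x\<in>#A. [:-x, 1:]) (size A - 1) = - \<Sum>\<^sub># A" if "size A > 0" for A :: "complex multiset"
    using that
  proof (induction A)
    case (add x A)
    show ?case
    proof (cases "size A = 0")
      case False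
      have "degree (\<Prod>x\<in>#A. [:-x, 1 :: complex:]) = size A \<and> lead_coeff (\<Prod>x\<in>#A. [:-x, 1 :: complex:]) = 1" for A
      proof (induction A)
        case (add x A)
        hence "(\<Prod>x\<in>#A. [:-x, 1 :: complex:]) \<noteq> 0" by auto
        moreover have "coeff (\<Prod>x\<in>#A. [:-x, 1 :: complex:]) (size A) = 1" using add by metis
        ultimately show ?case using add degree_mult_eq[of "[:-x, 1:]" "\<Prod>x\<in>#A. [:-x, 1 :: complex:]"]
          lead_coeff_mult[of "[:-x, 1:]" "\<Prod>x\<in>#A. [:-x, 1 :: complex:]"]
          by (simp del: mult_pCons_left)
      qed simp
      hence "coeff (\<Prod>x\<in>#A. [:-x, 1 :: complex:]) (size A) = 1" by metis
      thus ?thesis using add False by (cases "size A") auto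
    qed simp
  qed simp
  obtain E where E: "lead_coeff E = 1" "degree E = degree G"
    "\<And>\<phi>::'a \<Rightarrow> complex. comm_ring_hom \<phi> \<Longrightarrow>
        map_poly \<phi> E = (\<Prod>\<alpha>\<in>#proots (map_poly \<phi> G). [:- poly (map_poly \<phi> H) \<alpha>, 1:])"
    using norm_poly_exists[OF assms(1), of H] by metis
  show ?thesis
  proof (rule that[of "- coeff E (degree G - 1)"])
    fix \<phi> :: "'a \<Rightarrow> complex" assume "comm_ring_hom \<phi>"
    then interpret comm_ring_hom \<phi> .
    have "degree (map_poly \<phi> G) = degree G" using assms(1) by (intro map_poly_degree_eq) simp
    hence sz: "size (proots (map_poly \<phi> G)) = degree G" by (simp add: size_proots_complex)
    define A where "A = image_mset (poly (map_poly \<phi> H)) (proots (map_poly \<phi> G))"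
    have "\<phi> (coeff E (degree G - 1)) = coeff (map_poly \<phi> E) (degree G - 1)" by simp
    also have "\<dots> = coeff (\<Prod>x\<in>#A. [:-x, 1:]) (size A - 1)"
      unfolding E(3)[OF comm_ring_hom_axioms] by (simp add: A_def sz multiset.map_comp o_def)
    also have "\<dots> = - \<Sum>\<^sub># A" by (rule top) (use assms sz in \<open>simp add: A_def\<close>)
    finally show "root_sum (map_poly \<phi> G) (poly (map_poly \<phi> H)) = \<phi> (- coeff E (degree G - 1))"
      by (simp add: root_sum_def A_def hom_uminus)
  qed
qed

lemma norm_poly_lower_bound:
  fixes p :: "complex poly"
  assumes "p \<noteq> 0"
  obtains R where "R \<ge> 1" "\<And>z. norm z \<ge> R \<Longrightarrow> norm (lead_coeff p) * norm z ^ degree p \<le> 2 * norm (poly p z)"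
proof -
  define n where "n = degree p"
  define S where "S = (\<Sum>i<n. norm (coeff p i))"
  define c where "c = norm (lead_coeff p)"
  have c: "c > 0" using assms by (simp add: c_def)
  have S: "S \<ge> 0" by (simp add: S_def sum_nonneg)
  show ?thesis
  proof (rule that[of "max 1 (2 * S / c)"])
    fix z :: complex assume z: "max 1 (2 * S / c) \<le> norm z"
    hence z1: "norm z \<ge> 1" and z2: "2 * S \<le> c * norm z" using c by (auto simp: field_simps)
    have eq: "poly p z = lead_coeff p * z ^ n + (\<Sum>i<n. coeff p i * z ^ i)"
      by (simp add: poly_altdef n_def lessThan_Suc_atMost [symmetric])
    have low: "2 * norm (\<Sum>i<n. coeff p i * z ^ i) \<le> c * norm z ^ n"
    proof (cases n)
      case (Suc k)
      have "norm (\<Sum>i<n. coeff p i * z ^ i) \<le> (\<Sum>i<n. norm (coeff p i) * norm z ^ k)"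
        using z1 Suc by (intro order.trans[OF norm_sum] sum_mono)
          (auto simp: norm_mult norm_power intro!: mult_left_mono power_increasing)
      also have "\<dots> = S * norm z ^ k" by (simp add: S_def sum_distrib_right)
      finally have "2 * norm (\<Sum>i<n. coeff p i * z ^ i) \<le> (2 * S) * norm z ^ k" by simp
      also have "\<dots> \<le> (c * norm z) * norm z ^ k" by (intro mult_right_mono z2) auto
      finally show ?thesis by (simp add: Suc)
    qed (use c in simp)
    have "c * norm z ^ n = norm (lead_coeff p * z ^ n)" by (simp add: c_def norm_mult norm_power)
    also have "\<dots> \<le> norm (poly p z) + norm (\<Sum>i<n. coeff p i * z ^ i)"
      unfolding eq by (metis add_diff_cancel_right' norm_triangle_ineq4)
    finally show "norm (lead_coeff p) * norm z ^ degree p \<le> 2 * norm (poly p z)"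
      using low by (simp add: c_def n_def)
  qed simp
qed

lemma degree_le_of_growth:
  fixes p :: "complex poly"
  assumes "\<And>z. norm z \<ge> 1 \<Longrightarrow> norm (poly p z) \<le> C * norm z ^ e"
  shows "degree p \<le> e"
proof (rule ccontr)
  assume "\<not> degree p \<le> e"
  hence d: "degree p = Suc (e + (degree p - Suc e))" and "p \<noteq> 0" by auto
  from norm_poly_lower_bound[OF this(2)] obtain R where R: "R \<ge> 1"
    "\<And>z. norm z \<ge> R \<Longrightarrow> norm (lead_coeff p) * norm z ^ degree p \<le> 2 * norm (poly p z)" by blast
  define c where "c = norm (lead_coeff p)"
  have c: "c > 0" using \<open>p \<noteq> 0\<close> by (simp add: c_def)
  have "C \<ge> 0" using assms[of 1] by (simp add: order.trans[OF norm_ge_zero])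
  define x where "x = max R (2 * C / c + 1)"
  have x: "x \<ge> R" "x \<ge> 1" "c * x > 2 * C" using R(1) c \<open>C \<ge> 0\<close> by (auto simp: x_def field_simps max_def)
  have "c * x * x ^ e \<le> c * x ^ degree p"
  proof -
    have "x ^ Suc e \<le> x ^ degree p" using x d by (intro power_increasing) auto
    thus ?thesis using c by simp
  qed
  also have "\<dots> \<le> 2 * norm (poly p (of_real x))" using R(2)[of "of_real x"] x by (simp add: c_def)
  also have "\<dots> \<le> 2 * C * x ^ e" using assms[of "of_real x"] x by simp
  finally have "c * x \<le> 2 * C" using x by simp
  thus False using x by simp
qed

text \<open>A Laurent polynomial \<open>Q(t) / t^M\<close> that is bounded near \<open>0\<close> and \<open>O(|t|^(N/p))\<close> with \<open>N < p\<close>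
  near \<open>\<infinity>\<close> is constant.\<close>

lemma monom_of_growth:
  fixes Q :: "complex poly"
  assumes small: "\<And>t. t \<noteq> 0 \<Longrightarrow> norm t \<le> 1 \<Longrightarrow> norm (poly Q t) \<le> C * norm t ^ M"
    and large: "\<And>t. norm t \<ge> 1 \<Longrightarrow> norm (poly Q t) ^ p \<le> C' * norm t ^ (p * M + N)"
    and "N < p"
  shows "Q = monom (coeff Q M) M"
proof -
  \<comment> \<open>The \<open>p\<close>-th power replaces the fractional exponent M + N/p by an
    integer.\<close>
  have "degree (Q ^ p) \<le> p * M + N"
    by (rule degree_le_of_growth[of _ C']) (use large in \<open>simp add: norm_power\<close>)
  hence "p * degree Q \<le> p * M + N" by (cases "Q = 0") (auto simp: degree_power_eq mult.commute)
  hence "p * degree Q < p * (M + 1)" using \<open>N < p\<close> by simp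
  hence "degree Q < M + 1" using mult_less_cancel1 by blast
  hence deg: "degree Q \<le> M" by simp
  have low: "coeff Q i = 0" if "i < M" for i
  proof -
    let ?n = "degree Q"
    \<comment> \<open>The extra factor X settles the case deg Q < M as well: the product is then
      bounded, hence constant, which forces Q = 0. If deg Q = M, linear growth leaves only a
      constant reversed polynomial.\<close>
    have "norm (poly ([:0, 1:] * reflect_poly Q) s) \<le> C * norm s ^ (if ?n = M then 1 else 0)" if s: "norm s \<ge> 1" for s
    proof -
      have s0: "s \<noteq> 0" using s by auto
      have "norm (poly ([:0, 1:] * reflect_poly Q) s) = norm s ^ Suc ?n * norm (poly Q (inverse s))"
        using s0 by (simp add: poly_reflect_poly_nz norm_mult norm_power)
      also have "\<dots> \<le> norm s ^ Suc ?n * (C * norm (inverse s) ^ M)"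
        using s s0 by (intro mult_left_mono small) (auto simp: norm_inverse inverse_le_1_iff)
      also have "\<dots> = C * (norm s ^ Suc ?n / norm s ^ M)"
        by (simp add: norm_inverse power_inverse divide_inverse mult_ac)
      also have "\<dots> \<le> C * norm s ^ (if ?n = M then 1 else 0)"
      proof -
        have "0 \<le> C" using small[of 1] by (simp add: order.trans[OF norm_ge_zero])
        moreover have "norm s ^ Suc ?n \<le> norm s ^ (if ?n = M then 1 else 0) * norm s ^ M"
          using s deg by (auto simp flip: power_add power_Suc intro!: power_increasing)
        ultimately show ?thesis using s0 by (intro mult_left_mono) (auto simp: field_simps)
      qed
      finally show ?thesis .
    qed
    hence "degree ([:0, 1:] * reflect_poly Q) \<le> (if ?n = M then 1 else 0)"
      by (rule degree_le_of_growth)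
    hence rdeg: "Q = 0 \<or> (?n = M \<and> degree (reflect_poly Q) = 0)"
      by (cases "Q = 0") (auto simp: degree_mult_eq split: if_splits)
    thus ?thesis
    proof
      assume *: "?n = M \<and> degree (reflect_poly Q) = 0"
      have "coeff Q i = coeff (reflect_poly Q) (?n - i)"
        using that * by (simp add: coeff_reflect_poly)
      also have "\<dots> = 0" using * that by (intro coeff_eq_0) simp
      finally show ?thesis .
    qed simp
  qed
  show ?thesis
  proof (rule poly_eqI)
    show "coeff Q i = coeff (monom (coeff Q M) M) i" for i
      using low[of i] deg by (cases i M rule: linorder_cases) (auto simp: coeff_eq_0)
  qed
qed

section \<open>The t-family of orbits and the constancy of its traces\<close>

fun iter_poly :: "'a::comm_semiring_1 poly \<Rightarrow> nat \<Rightarrow> 'a poly" where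
  "iter_poly w 0 = w"
| "iter_poly w (Suc i) = iter_poly w i ^ 2 + [:0, 1:]"

lemma iter_poly_orb: "iter_poly (orb m) i = orb (m + i)"
  by (induction i) (simp_all add: orb_Suc)

lemma iter_poly_uminus: "iter_poly (- w :: 'a::comm_ring_1 poly) (Suc i) = iter_poly w (Suc i)"
  by (induction i) simp_all

text \<open>Outside the radius 1 + sqrt |c| the modulus strictly increases along the orbit, so a
  periodic orbit never gets there.\<close>

lemma periodic_orbit_bound:
  fixes z :: "nat \<Rightarrow> complex"
  assumes step: "\<And>i. z (Suc i) = z i ^ 2 + c" and per: "z d = z 0" and d: "d \<ge> 1"
  shows "norm (z i) \<le> 1 + sqrt (norm c)"
proof (rule ccontr)
  define s where "s = sqrt (norm c)"
  have s: "s \<ge> 0" "norm c = s ^ 2" by (simp_all add: s_def)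
  assume "\<not> norm (z i) \<le> 1 + sqrt (norm c)"
  hence i: "norm (z i) > 1 + s" by (simp add: s_def)
  have grow: "norm (z (Suc j)) > norm (z j)" if j: "norm (z j) > 1 + s" for j
  proof -
    have "(1 + s) * s < norm (z j) * (norm (z j) - 1)"
      using j s by (intro mult_strict_mono) auto
    hence "norm (z j) < norm (z j) ^ 2 - s ^ 2" using s by (simp add: algebra_simps power2_eq_square)
    also have "\<dots> = norm (z j ^ 2) - norm c" by (simp add: s norm_power)
    also have "\<dots> \<le> norm (z (Suc j))" unfolding step using norm_diff_ineq[of "z j ^ 2" c] by simp
    finally show ?thesis .
  qed
  have "norm (z (i + Suc k)) > norm (z i)" for k
  proof (induction k)
    case (Suc k)
    thus ?case using grow[of "i + Suc k"] i by simp
  qed (use grow[OF i] in simp)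
  from this[of "d - 1"] have "norm (z (i + d)) > norm (z i)" using d by simp
  moreover have "z (i + d) = z i" by (induction i) (simp_all add: per step)
  ultimately show False by simp
qed

text \<open>The bivariate polynomial \<open>t^(2^i) * f^i(w/t)\<close>, where \<open>f\<close> is \<open>z^2 + c\<close>: the inner variable is \<open>t\<close>
  and the outer variable is \<open>c\<close>.\<close>

fun scaled_iter :: "complex poly \<Rightarrow> nat \<Rightarrow> complex poly poly" where
  "scaled_iter w 0 = map_poly (\<lambda>x. [:x:]) w"
| "scaled_iter w (Suc i) = scaled_iter w i ^ 2 + [:0, monom 1 (2 ^ Suc i):]"

lemma poly_eval_hom: "comm_ring_hom (\<lambda>p. poly p (t :: complex))"
  by unfold_locales auto

lemma map_poly_scaled_iter:
  assumes t: "t \<noteq> 0"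
  shows "map_poly (\<lambda>p. poly p t) (scaled_iter w i) = smult (t ^ (2 ^ i)) (iter_poly (smult (1 / t) w) i)"
proof (induction i)
  case 0
  show ?case using t by (simp add: map_poly_map_poly o_def)
next
  case (Suc i)
  interpret comm_ring_hom "\<lambda>p. poly p t" by (rule poly_eval_hom)
  interpret mp: map_poly_comm_ring_hom "\<lambda>p. poly p t" ..
  have "map_poly (\<lambda>p. poly p t) (scaled_iter w (Suc i))
      = map_poly (\<lambda>p. poly p t) (scaled_iter w i) ^ 2 + [:0, t ^ (2 ^ Suc i):]"
    by (simp add: mp.hom_add mp.hom_power map_poly_pCons poly_monom)
  also have "\<dots> = smult (t ^ (2 ^ Suc i)) (iter_poly (smult (1 / t) w) (Suc i))"
    unfolding Suc by (simp add: smult_power smult_add_right power2_eq_square power_add mult_2)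
  finally show ?case .
qed

lemma scaled_iter_monic:
  assumes w: "lead_coeff w = 1" "degree w \<ge> 1"
  shows "degree (scaled_iter w i) = 2 ^ i * degree w \<and> lead_coeff (scaled_iter w i) = 1"
proof (induction i)
  case 0
  have "degree (scaled_iter w 0) = degree w" using w unfolding scaled_iter.simps by (intro map_poly_degree_eq) auto
  thus ?case using w by (simp add: coeff_map_poly one_pCons)
next
  case (Suc i)
  let ?s = "scaled_iter w i"
  have "?s \<noteq> 0" using Suc by auto
  hence deg: "degree (?s ^ 2) = 2 ^ Suc i * degree w" using Suc by (simp add: degree_power_eq)
  have "(1 :: nat) < 2 ^ Suc i * 1" by (rule order.strict_trans2[of _ 2]) auto
  also have "\<dots> \<le> 2 ^ Suc i * degree w" using w by (intro mult_left_mono) auto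
  finally have lt: "degree [:0, monom 1 (2 ^ Suc i) :: complex poly:] < degree (?s ^ 2)" unfolding deg by simp
  have "lead_coeff (?s ^ 2) = 1" unfolding lead_coeff_power using conjunct2[OF Suc] by (metis power_one)
  from monic_add_lower[OF this lt] deg show ?case by (metis scaled_iter.simps(2))
qed

definition twist_poly :: "nat \<Rightarrow> nat \<Rightarrow> complex \<Rightarrow> complex poly" where
  "twist_poly m d t = iter_poly (smult (1 / t) (orb m)) d - smult (1 / t) (orb m)"

definition twist_fun :: "nat \<Rightarrow> complex \<Rightarrow> nat \<Rightarrow> nat list \<Rightarrow> complex \<Rightarrow> complex" where
  "twist_fun m t j is c = c ^ j * (\<Prod>i\<leftarrow>is. poly (iter_poly (smult (1 / t) (orb m)) i) c)"

lemma orb_degree: "m \<ge> 1 \<Longrightarrow> degree (orb m) = 2 ^ (m - 1) \<and> lead_coeff (orb m) = 1"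
proof -
  assume "m \<ge> 1"
  hence eq: "Suc (m - 1) = m" by simp
  show ?thesis
    using crit_orbit_degree[of "m - 1", unfolded eq]
    by (metis of_int_1 of_int_hom.degree_map_poly_hom of_int_hom.hom_lead_coeff)
qed

text \<open>After multiplication by t^(2^d) the equation for c is monic with coefficients polynomial
  in t, so \<open>root_sum_ring_exists\<close> applies. A point of index \<open>i\<close> in the
  product needs t^(2^i) to clear its denominator; these exponents add up to
  \<open>M\<close>.\<close>

lemma twist_trace_laurent:
  assumes m: "m \<ge> 1" and d: "d \<ge> 1"
  obtains Q M D where "\<And>t. t \<noteq> 0 \<Longrightarrow> size (proots (twist_poly m d t)) \<le> D"
    "\<And>t. t \<noteq> 0 \<Longrightarrow> t ^ M * root_sum (twist_poly m d t) (twist_fun m t j is) = poly Q t"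
proof -
  define w where "w = orb m"
  have w: "lead_coeff w = 1" "degree w \<ge> 1" using orb_degree[OF m] by (auto simp: w_def)
  \<comment> \<open>The exponent 2^d - 1 arises from t^(2^d) times a_m/t.\<close>
  define G where "G = scaled_iter w d - [:monom 1 (2 ^ d - 1):] * scaled_iter w 0"
  have G_add: "G = scaled_iter w d + (- ([:monom 1 (2 ^ d - 1):] * scaled_iter w 0))" by (simp add: G_def)
  have "degree ([:monom 1 (2 ^ d - 1):] * scaled_iter w 0) \<le> degree w"
    using degree_map_poly_le[of "\<lambda>x. [:x:]" w] by (simp add: order.trans[OF degree_smult_le])
  also have "degree w < 2 ^ d * degree w"
    using w d one_less_power[of "2 :: nat" d] by simp
  finally have "degree (- ([:monom 1 (2 ^ d - 1):] * scaled_iter w 0)) < degree (scaled_iter w d)"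
    using scaled_iter_monic[OF w, of d] by simp
  from monic_add_lower[OF conjunct2[OF scaled_iter_monic[OF w]] this]
  have G: "degree G = 2 ^ d * degree w" "lead_coeff G = 1"
    using scaled_iter_monic[OF w, of d] unfolding G_add by metis+
  have "degree G > 0" using G w by simp
  define M :: nat where "M = (\<Sum>i\<leftarrow>is. 2 ^ i)"
  define H where "H = monom 1 j * (\<Prod>i\<leftarrow>is. scaled_iter w i)"
  obtain \<tau> where \<tau>: "\<And>\<phi>::complex poly \<Rightarrow> complex. comm_ring_hom \<phi> \<Longrightarrow>
    root_sum (map_poly \<phi> G) (poly (map_poly \<phi> H)) = \<phi> \<tau>"
    using root_sum_ring_exists[OF G(2) \<open>degree G > 0\<close>] by blast
  show ?thesis
  proof (rule that[of "degree G" M \<tau>])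
    fix t :: complex assume t: "t \<noteq> 0"
    interpret comm_ring_hom "\<lambda>p. poly p t" by (rule poly_eval_hom)
    interpret mp: map_poly_comm_ring_hom "\<lambda>p. poly p t" ..
    have c: "map_poly (\<lambda>p. poly p t) [:monom 1 (2 ^ d - 1):] = [:t ^ (2 ^ d - 1):]"
      by (simp add: map_poly_pCons poly_monom)
    have tt: "t ^ (2 ^ d) = t * t ^ (2 ^ d - 1)" by (simp flip: power_Suc)
    have "map_poly (\<lambda>p. poly p t) G = smult (t ^ (2 ^ d)) (twist_poly m d t)"
      using t unfolding G_def mp.hom_minus mp.hom_mult map_poly_scaled_iter[OF t] c twist_poly_def w_def
      by (simp add: smult_diff_right tt)
    with degree_map_poly_le[of "\<lambda>p. poly p t" G] t
    show "size (proots (twist_poly m d t)) \<le> degree G" by (simp add: size_proots_complex)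
    note \<open>map_poly (\<lambda>p. poly p t) G = _\<close>
    moreover have "poly (map_poly (\<lambda>p. poly p t) H) c = t ^ M * twist_fun m t j is c" for c
    proof -
      have "poly (map_poly (\<lambda>p. poly p t) (\<Prod>i\<leftarrow>is. scaled_iter w i)) c
          = t ^ M * (\<Prod>i\<leftarrow>is. poly (iter_poly (smult (1 / t) (orb m)) i) c)"
        unfolding M_def
        by (induction "is") (simp_all add: mp.hom_mult map_poly_scaled_iter[OF t] w_def power_add mult_ac)
      thus ?thesis by (simp add: H_def mp.hom_mult map_poly_monom poly_monom twist_fun_def)
    qed
    moreover have "root_sum (smult (t ^ (2 ^ d)) p) g = root_sum p g" for p g
      using t by (simp add: root_sum_def)
    ultimately have "root_sum (twist_poly m d t) (\<lambda>c. t ^ M * twist_fun m t j is c) = poly \<tau> t"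
      using \<tau>[OF poly_eval_hom, of t] by (metis (no_types, lifting) ext)
    thus "t ^ M * root_sum (twist_poly m d t) (twist_fun m t j is) = poly \<tau> t"
      by (simp add: root_sum_def sum_mset_distrib_left multiset.map_comp o_def)
  qed
qed

text \<open>Both bounds come from the periodicity of a_m/t. In the second, c counts twice because
  |c| is at most (1 + sqrt |c|)^2.\<close>

lemma twist_fun_bound:
  assumes m: "m \<ge> 1" and d: "d \<ge> 1"
  obtains K where "K \<ge> 1" "\<And>t c. t \<noteq> 0 \<Longrightarrow> poly (twist_poly m d t) c = 0 \<Longrightarrow>
    (1 + sqrt (norm c)) ^ (2 ^ m - 1) \<le> K * (1 + norm t)"
    "\<And>t c j is. t \<noteq> 0 \<Longrightarrow> poly (twist_poly m d t) c = 0 \<Longrightarrow>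
       norm (twist_fun m t j is c) \<le> (1 + sqrt (norm c)) ^ (2 * j + length is)"
proof -
  define q where "q = (2 :: nat) ^ (m - 1)"
  define p where "p = (2 :: nat) ^ m - 1"
  have q: "q \<ge> 1" by (simp add: q_def)
  have pq: "2 * q = Suc p" using m by (cases m) (auto simp: q_def p_def)
  have w: "orb m \<noteq> 0" "degree (orb m) = q" "lead_coeff (orb m) = 1" using orb_degree[OF m] by (auto simp: q_def)
  obtain R where R: "R \<ge> 1" and R': "\<And>z. norm z \<ge> R \<Longrightarrow>
      norm (lead_coeff (orb m)) * norm z ^ degree (orb m) \<le> 2 * norm (poly (orb m) z)"
    using norm_poly_lower_bound[OF w(1)] by metis
  have R2: "norm z ^ q \<le> 2 * norm (poly (orb m) z)" if "norm z \<ge> R" for z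
    using R'[OF that] unfolding w(3) unfolding w(2) by simp
  \<comment> \<open>The first entry covers |c| < R. For |c| at least R, writing y = sqrt |c|, the
    lower bound on a_m gives y^(2q) at most 2 |t| (1 + y), hence y^p at most 4 |t|; the factor 2^p
    comes from 1 + y being at most 2 y.\<close>
  define K where "K = max ((1 + sqrt R) ^ p) (2 ^ p * 4)"
  have orbit: "norm (poly (iter_poly (smult (1 / t) (orb m)) i) c) \<le> 1 + sqrt (norm c)"
    if "poly (twist_poly m d t) c = 0" for t c i
    using that d by (intro periodic_orbit_bound[of _ c d]) (auto simp: twist_poly_def)
  show ?thesis
  proof (rule that[of K])
    have "(1::real) \<le> 2 ^ p * 4" by (rule order.trans[of _ "1 * 4"]) (auto intro: mult_right_mono)
    thus "K \<ge> 1" by (simp add: K_def)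
  next
    fix t c assume t: "t \<noteq> 0" and root: "poly (twist_poly m d t) c = 0"
    define y where "y = sqrt (norm c)"
    have y: "y \<ge> 0" "norm c = y ^ 2" by (simp_all add: y_def)
    have "(1 + y) ^ p \<le> K * (1 + norm t)"
    proof (cases "norm c \<ge> R")
      case False
      hence "y \<le> sqrt R" by (simp add: y_def)
      hence "(1 + y) ^ p \<le> (1 + sqrt R) ^ p" using y by (intro power_mono) auto
      also have "\<dots> \<le> K * 1" by (simp add: K_def)
      also have "\<dots> \<le> K * (1 + norm t)"
        by (intro mult_left_mono) (auto simp: K_def le_max_iff_disj)
      finally show ?thesis .
    next
      case True
      hence "1 \<le> norm c" using R by simp
      hence y1: "y \<ge> 1" by (simp add: y_def)
      have "y ^ p * y = norm c ^ q" unfolding y(2) power_mult [symmetric] pq by simp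
      also have "\<dots> \<le> 2 * norm (poly (orb m) c)" using R2 True by simp
      also have "poly (orb m) c = t * poly (iter_poly (smult (1 / t) (orb m)) 0) c" using t by simp
      also have "2 * norm \<dots> \<le> 2 * (norm t * (1 + y))"
        using orbit[OF root, of 0] unfolding norm_mult y_def by (intro mult_left_mono) auto
      also have "\<dots> \<le> 2 * (norm t * (2 * y))" using y1 by (intro mult_left_mono) auto
      finally have "y ^ p * y \<le> (4 * norm t) * y" by simp
      hence yp: "y ^ p \<le> 4 * norm t" using y1 by simp
      have "(1 + y) ^ p \<le> (2 * y) ^ p" using y1 by (intro power_mono) auto
      also have "\<dots> \<le> 2 ^ p * (4 * norm t)" unfolding power_mult_distrib using yp by (intro mult_left_mono) auto
      also have "\<dots> \<le> (2 ^ p * 4) * (1 + norm t)" by simp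
      also have "\<dots> \<le> K * (1 + norm t)" by (intro mult_right_mono) (auto simp: K_def)
      finally show ?thesis .
    qed
    thus "(1 + sqrt (norm c)) ^ (2 ^ m - 1) \<le> K * (1 + norm t)" by (simp add: y_def p_def)
    fix j :: nat and "is" :: "nat list"
    have "norm (\<Prod>i\<leftarrow>is. poly (iter_poly (smult (1 / t) (orb m)) i) c) \<le> (1 + y) ^ length is"
      using orbit[OF root] y unfolding y_def [symmetric]
      by (induction "is") (auto simp: norm_mult intro!: mult_mono)
    moreover have "norm (c ^ j) \<le> (1 + y) ^ (2 * j)"
      unfolding norm_power y power_mult using y by (intro power_mono) (auto simp: algebra_simps)
    ultimately have "norm (twist_fun m t j is c) \<le> (1 + y) ^ (2 * j) * (1 + y) ^ length is"
      unfolding twist_fun_def norm_mult using y by (intro mult_mono) auto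
    thus "norm (twist_fun m t j is c) \<le> (1 + sqrt (norm c)) ^ (2 * j + length is)"
      by (simp add: y_def power_add)
  qed
qed

lemma norm_sum_mset_le:
  fixes g :: "'b \<Rightarrow> complex" and B :: real
  assumes "\<And>x. x \<in># A \<Longrightarrow> norm (g x) \<le> B"
  shows "norm (\<Sum>x\<in>#A. g x) \<le> size A * B"
  using assms
proof (induction A)
  case (add x A)
  thus ?case using norm_triangle_ineq[of "g x" "\<Sum>x\<in>#A. g x"] by (force simp: algebra_simps)
qed simp

lemma twist_trace_constant:
  assumes m: "m \<ge> 1" and d: "d \<ge> 1" and N: "2 * j + length is + 1 < 2 ^ m" and t: "t \<noteq> 0"
  shows "root_sum (twist_poly m d t) (twist_fun m t j is) = root_sum (twist_poly m d 1) (twist_fun m 1 j is)"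
proof -
  define \<tau> where "\<tau> = (\<lambda>t. root_sum (twist_poly m d t) (twist_fun m t j is))"
  define N where "N = 2 * j + length is"
  define p where "p = (2 :: nat) ^ m - 1"
  have Np: "N < p" and p: "p \<ge> 1" using N by (auto simp: N_def p_def)
  obtain Q M D where D: "\<And>t. t \<noteq> 0 \<Longrightarrow> size (proots (twist_poly m d t)) \<le> D"
    and Q: "\<And>t. t \<noteq> 0 \<Longrightarrow> t ^ M * \<tau> t = poly Q t"
    unfolding \<tau>_def using twist_trace_laurent[OF m d, of j "is"] by metis
  obtain K where K: "K \<ge> 1"
    and K1: "\<And>t c. t \<noteq> 0 \<Longrightarrow> poly (twist_poly m d t) c = 0 \<Longrightarrow> (1 + sqrt (norm c)) ^ p \<le> K * (1 + norm t)"
    and K2: "\<And>t c. t \<noteq> 0 \<Longrightarrow> poly (twist_poly m d t) c = 0 \<Longrightarrow>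
       norm (twist_fun m t j is c) \<le> (1 + sqrt (norm c)) ^ N"
    using twist_fun_bound[OF m d] unfolding N_def p_def by metis
  have bound: "norm (\<tau> t) \<le> real D * B"
    if "t \<noteq> 0" "B \<ge> 0" "\<And>c. poly (twist_poly m d t) c = 0 \<Longrightarrow> (1 + sqrt (norm c)) ^ N \<le> B" for t and B :: real
  proof -
    have "norm (\<tau> t) \<le> size (proots (twist_poly m d t)) * B"
      unfolding \<tau>_def root_sum_def
    proof (rule norm_sum_mset_le)
      fix c assume "c \<in># proots (twist_poly m d t)"
      hence "poly (twist_poly m d t) c = 0" by (cases "twist_poly m d t = 0") auto
      thus "norm (twist_fun m t j is c) \<le> B" using K2[of t c] that by force
    qed
    also have "\<dots> \<le> real D * B" using D[OF that(1)] that(2) by (intro mult_right_mono) auto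
    finally show ?thesis .
  qed
  have "Q = monom (coeff Q M) M"
  proof (rule monom_of_growth[of Q "D * (2 * K) ^ N" M p "real D ^ p * (2 * K) ^ N" N])
    fix t :: complex assume t: "t \<noteq> 0" "norm t \<le> 1"
    have "norm (\<tau> t) \<le> D * (2 * K) ^ N"
    proof (rule bound)
      fix c assume c: "poly (twist_poly m d t) c = 0"
      have "1 + sqrt (norm c) \<le> (1 + sqrt (norm c)) ^ p" using p by (intro self_le_power) auto
      also have "\<dots> \<le> K * (1 + norm t)" using K1[OF t(1) c] .
      also have "\<dots> \<le> 2 * K" using t K by (simp add: algebra_simps)
      finally show "(1 + sqrt (norm c)) ^ N \<le> (2 * K) ^ N" by (intro power_mono) auto
    qed (use t K in auto)
    hence "norm (\<tau> t) * norm t ^ M \<le> D * (2 * K) ^ N * norm t ^ M" by (rule mult_right_mono) simp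
    thus "norm (poly Q t) \<le> D * (2 * K) ^ N * norm t ^ M"
      by (simp add: norm_mult norm_power mult.commute flip: Q[OF t(1)])
  next
    fix t :: complex assume t: "1 \<le> norm t"
    hence t0: "t \<noteq> 0" by auto
    define r where "r = root p ((2 * K * norm t) ^ N)"
    have r: "r \<ge> 0" "r ^ p = (2 * K * norm t) ^ N" using p K by (auto simp: r_def)
    have "norm (\<tau> t) \<le> D * r"
    proof (rule bound[OF t0 r(1)])
      fix c assume c: "poly (twist_poly m d t) c = 0"
      have "K * 1 \<le> K * norm t" using t K by (intro mult_left_mono) auto
      hence "(1 + sqrt (norm c)) ^ p \<le> 2 * K * norm t" using K1[OF t0 c] by (simp add: algebra_simps)
      hence "((1 + sqrt (norm c)) ^ p) ^ N \<le> (2 * K * norm t) ^ N" by (intro power_mono) auto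
      hence "((1 + sqrt (norm c)) ^ N) ^ p \<le> r ^ p" by (simp add: r mult.commute flip: power_mult)
      thus "(1 + sqrt (norm c)) ^ N \<le> r" by (subst (asm) power_mono_iff) (use r(1) p in auto)
    qed
    hence "norm (\<tau> t) ^ p \<le> (D * r) ^ p" by (intro power_mono) auto
    also have "\<dots> = real D ^ p * (2 * K) ^ N * norm t ^ N" by (simp add: power_mult_distrib r)
    finally have "norm (\<tau> t) ^ p * norm t ^ (p * M) \<le> real D ^ p * (2 * K) ^ N * norm t ^ N * norm t ^ (p * M)"
      by (rule mult_right_mono) simp
    thus "norm (poly Q t) ^ p \<le> real D ^ p * (2 * K) ^ N * norm t ^ (p * M + N)"
      by (simp add: norm_mult norm_power power_mult_distrib power_add mult_ac flip: Q[OF t0] power_mult)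
  qed (rule Np)
  hence "t ^ M * \<tau> t = coeff Q M * t ^ M" if "t \<noteq> 0" for t
    using Q[OF that] by (metis poly_monom)
  hence "\<tau> t = coeff Q M" if "t \<noteq> 0" for t using that by (simp add: mult.commute)
  thus ?thesis using t by (simp add: \<tau>_def)
qed

text \<open>The members \<open>t = 1\<close> and \<open>t = -1\<close> of the family are \<open>a_(m+d) - a_m\<close> and \<open>a_(m+d) + a_m\<close>.\<close>

lemma root_sum_balance:
  assumes m: "m \<ge> 1" and d: "d \<ge> 1" and N: "2 * j + length is + 1 < 2 ^ m"
  shows "root_sum (cpoly (misiu (Suc m) d)) (\<lambda>c. c ^ j * (\<Prod>i\<leftarrow>is. poly (orb (m + d + i)) c))
       = root_sum (orb (m + d) - orb m) (\<lambda>c. c ^ j * (\<Prod>i\<leftarrow>is. poly (orb (m + i)) c))"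
proof -
  obtain e where e: "d = Suc e" using d by (cases d) auto
  have iter: "iter_poly (- orb m) (Suc i) = orb (m + Suc i)" for i
    unfolding iter_poly_uminus iter_poly_orb ..
  have "smult (1 / - 1) (orb m) = - orb m" by simp
  hence A: "twist_poly m d (- 1) = cpoly (misiu (Suc m) d)"
    by (simp only: twist_poly_def e iter) (simp add: misiu_def of_int_poly_hom.hom_add)
  have B: "twist_poly m d 1 = orb (m + d) - orb m" by (simp add: twist_poly_def iter_poly_orb)
  have nz: "cpoly (misiu (Suc m) d) \<noteq> 0" using misiu_nonzero[of "Suc m" d] d by simp
  have "root_sum (cpoly (misiu (Suc m) d)) (\<lambda>c. c ^ j * (\<Prod>i\<leftarrow>is. poly (orb (m + d + i)) c))
      = root_sum (twist_poly m d (- 1)) (twist_fun m (- 1) j is)"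
    unfolding A
  proof (rule root_sum_cong[OF nz])
    fix c assume root: "poly (cpoly (misiu (Suc m) d)) c = 0"
    have "poly (iter_poly (- orb m) i) c = poly (orb (m + d + i)) c" for i
    proof (cases i)
      case 0
      thus ?thesis using root by (simp add: poly_misiu add_eq_0_iff)
    next
      case (Suc l)
      have "poly (orb (m + d)) c = - poly (orb m) c" using root by (simp add: poly_misiu add_eq_0_iff)
      hence "poly (orb (Suc (m + d))) c = poly (orb (Suc m)) c" by (simp add: poly_orb_Suc)
      from poly_orb_shift[OF this, of l] show ?thesis by (simp only: Suc iter) simp
    qed
    thus "c ^ j * (\<Prod>i\<leftarrow>is. poly (orb (m + d + i)) c) = twist_fun m (- 1) j is c"
      by (simp add: twist_fun_def)
  qed
  also have "\<dots> = root_sum (twist_poly m d 1) (twist_fun m 1 j is)"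
    by (rule twist_trace_constant[OF m d N]) simp
  also have "twist_fun m 1 j is = (\<lambda>c. c ^ j * (\<Prod>i\<leftarrow>is. poly (orb (m + i)) c))"
    by (simp add: twist_fun_def fun_eq_iff iter_poly_orb)
  finally show ?thesis unfolding B .
qed

subsection \<open>Doubling of the power sums\<close>

lemma prod_window_periodic:
  fixes x :: "nat \<Rightarrow> 'a::comm_semiring_1"
  assumes per: "\<And>j. j \<ge> M \<Longrightarrow> x (j + d) = x j" and "d dvd n" "j \<ge> M"
  shows "(\<Prod>i<n. x (j + i)) = (\<Prod>i<n. x (M + i))"
proof -
  obtain e where e: "n = d * e" using assms(2) by (auto elim: dvdE)
  have per': "x (j + d * l) = x j" if "j \<ge> M" for j l
  proof (induction l)
    case (Suc l)
    have "x (j + d * Suc l) = x (j + d * l + d)" by (simp add: algebra_simps)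
    also have "\<dots> = x j" using per[of "j + d * l"] that Suc by simp
    finally show ?case .
  qed simp
  have step: "(\<Prod>i<n. x (Suc j + i)) = (\<Prod>i<n. x (j + i))" if "j \<ge> M" for j
  proof (cases n)
    case (Suc n')
    have "(\<Prod>i<n. x (Suc j + i)) = (\<Prod>i<n'. x (Suc j + i)) * x (j + n)"
      by (simp add: Suc)
    also have "x (j + n) = x j" using per'[OF that, of e] e by simp
    also have "(\<Prod>i<n'. x (Suc j + i)) * x j = (\<Prod>i<n. x (j + i))"
      unfolding Suc prod.lessThan_Suc_shift by (simp add: mult.commute)
    finally show ?thesis .
  qed simp
  have "(\<Prod>i<n. x (M + l + i)) = (\<Prod>i<n. x (M + i))" for l
    by (induction l) (use step in \<open>simp_all\<close>)
  from this[of "j - M"] assms(3) show ?thesis by simp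
qed

definition diff_orb :: "nat \<Rightarrow> nat \<Rightarrow> int poly" where
  "diff_orb m d = crit_orbit (m + d) - crit_orbit m"

lemma poly_diff_orb: "poly (cpoly (diff_orb m d)) c = poly (orb (m + d)) c - poly (orb m) c"
  by (simp add: diff_orb_def of_int_poly_hom.hom_minus)

lemma cpoly_diff_orb: "cpoly (diff_orb m d) = orb (m + d) - orb m"
  by (simp add: diff_orb_def of_int_poly_hom.hom_minus)

lemma diff_orb_Suc: "diff_orb (Suc m) d = misiu (Suc m) d * diff_orb m d"
  by (simp add: diff_orb_def misiu_def crit_orbit.simps(2) power2_eq_square algebra_simps)

lemma diff_orb_nonzero:
  assumes "d \<ge> 1"
  shows "diff_orb m d \<noteq> 0"
proof (induction m)
  case 0
  thus ?case using crit_orbit_nonzero[OF assms] by (simp add: diff_orb_def)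
next
  case (Suc m)
  thus ?case using misiu_nonzero[of "Suc m" d] assms by (simp add: diff_orb_Suc)
qed

lemma root_sum_diff_orb_Suc:
  assumes "d \<ge> 1"
  shows "root_sum (cpoly (diff_orb (Suc m) d)) g
       = root_sum (cpoly (misiu (Suc m) d)) g + root_sum (cpoly (diff_orb m d)) g"
  unfolding diff_orb_Suc of_int_poly_hom.hom_mult
  using diff_orb_nonzero[OF assms, of m] misiu_nonzero[of "Suc m" d] assms by (intro root_sum_mult) auto

lemma misiu_root_period:
  assumes "poly (cpoly (misiu (Suc m) d)) c = 0" "j \<ge> Suc m"
  shows "poly (orb (j + d)) c = poly (orb j) c"
proof -
  have "poly (orb (m + d)) c = - poly (orb m) c" using assms by (simp add: poly_misiu add_eq_0_iff)
  hence "poly (orb (Suc (m + d))) c = poly (orb (Suc m)) c" by (simp add: poly_orb_Suc)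
  from poly_orb_shift[OF this, of "j - Suc m"] assms(2) show ?thesis by (simp add: add.commute)
qed

lemma diff_orb_root_period:
  assumes "poly (cpoly (diff_orb m d)) c = 0" "j \<ge> m"
  shows "poly (orb (j + d)) c = poly (orb j) c"
proof -
  have "poly (orb (m + d)) c = poly (orb m) c" using assms by (simp add: poly_diff_orb)
  from poly_orb_shift[OF this, of "j - m"] assms(2) show ?thesis by (simp add: add.commute)
qed

lemma prod_list_concat_replicate: "prod_list (map f (concat (replicate k xs))) = prod_list (map f xs) ^ k"
  by (induction k) simp_all

lemma prod_list_upt: "(\<Prod>i\<leftarrow>[0..<n]. f i) = (\<Prod>i<n. f i :: 'a::comm_monoid_mult)"
  by (induction n) (simp_all add: mult.commute)

text \<open>The \<open>k\<close>-th power of the product is treated as a single product of n k orbit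
  points, one list [0..<n] per factor. Periodicity moves the window from m + d to m + 1 at the
  roots.\<close>

lemma misiu_trace_eq:
  assumes m: "m \<ge> 1" and d: "d \<ge> 1" "d dvd n" and N: "n * k + 1 < 2 ^ m"
  shows "root_sum (cpoly (misiu (Suc m) d)) (\<lambda>c. poly (cpoly (theta (Suc m) n)) c ^ k)
       = root_sum (cpoly (diff_orb m d)) (\<lambda>c. poly (cpoly (theta m n)) c ^ k)"
proof -
  define ix where "ix = concat (replicate k [0..<n])"
  have len: "length ix = n * k" by (simp add: ix_def length_concat sum_list_replicate)
  have win: "(\<Prod>i\<leftarrow>ix. f i) = (\<Prod>i<n. f i) ^ k" for f :: "nat \<Rightarrow> complex"
    unfolding ix_def prod_list_concat_replicate by (simp add: prod_list_upt)
  have nz: "cpoly (misiu (Suc m) d) \<noteq> 0" using misiu_nonzero[of "Suc m" d] d by simp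
  have "root_sum (cpoly (misiu (Suc m) d)) (\<lambda>c. poly (cpoly (theta (Suc m) n)) c ^ k)
      = root_sum (cpoly (misiu (Suc m) d)) (\<lambda>c. c ^ 0 * (\<Prod>i\<leftarrow>ix. poly (orb (m + d + i)) c))"
  proof (rule root_sum_cong[OF nz])
    fix c assume root: "poly (cpoly (misiu (Suc m) d)) c = 0"
    have "(\<Prod>i<n. poly (orb (m + d + i)) c) = (\<Prod>i<n. poly (orb (Suc m + i)) c)"
      by (rule prod_window_periodic[where d = d]) (use misiu_root_period[OF root] d in auto)
    thus "poly (cpoly (theta (Suc m) n)) c ^ k = c ^ 0 * (\<Prod>i\<leftarrow>ix. poly (orb (m + d + i)) c)"
      unfolding win poly_theta by simp
  qed
  also have "\<dots> = root_sum (orb (m + d) - orb m) (\<lambda>c. c ^ 0 * (\<Prod>i\<leftarrow>ix. poly (orb (m + i)) c))"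
    by (rule root_sum_balance[OF m d(1)]) (use N len in simp)
  finally show ?thesis by (simp add: win poly_theta cpoly_diff_orb)
qed

lemma diff_trace_Suc:
  assumes d: "d \<ge> 1" "d dvd n"
  shows "root_sum (cpoly (diff_orb (Suc m) d)) (\<lambda>c. poly (cpoly (theta (Suc m) n)) c ^ k)
       = root_sum (cpoly (misiu (Suc m) d)) (\<lambda>c. poly (cpoly (theta (Suc m) n)) c ^ k)
         + root_sum (cpoly (diff_orb m d)) (\<lambda>c. poly (cpoly (theta m n)) c ^ k)"
proof -
  have "cpoly (diff_orb m d) \<noteq> 0" using diff_orb_nonzero[OF d(1)] by simp
  hence "root_sum (cpoly (diff_orb m d)) (\<lambda>c. poly (cpoly (theta (Suc m) n)) c ^ k)
      = root_sum (cpoly (diff_orb m d)) (\<lambda>c. poly (cpoly (theta m n)) c ^ k)"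
  proof (rule root_sum_cong)
    fix c assume root: "poly (cpoly (diff_orb m d)) c = 0"
    have "(\<Prod>i<n. poly (orb (Suc m + i)) c) = (\<Prod>i<n. poly (orb (m + i)) c)"
      by (rule prod_window_periodic[where d = d]) (use diff_orb_root_period[OF root] d in auto)
    thus "poly (cpoly (theta (Suc m) n)) c ^ k = poly (cpoly (theta m n)) c ^ k"
      unfolding poly_theta by simp
  qed
  thus ?thesis unfolding root_sum_diff_orb_Suc[OF d(1)] by simp
qed

text \<open>\<open>misiu_trace_eq\<close> is used at \<open>m\<close> and at m - 1, with the
  factorization \<open>diff_orb_Suc\<close> in between.\<close>

lemma misiu_trace_double:
  assumes m: "m \<ge> 2" and d: "d \<ge> 1" "d dvd n" and N: "n * k + 1 < 2 ^ (m - 1)"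
  shows "root_sum (cpoly (misiu (Suc m) d)) (\<lambda>c. poly (cpoly (theta (Suc m) n)) c ^ k)
       = 2 * root_sum (cpoly (misiu m d)) (\<lambda>c. poly (cpoly (theta m n)) c ^ k)"
proof -
  obtain l where l: "m = Suc l" "l \<ge> 1" using m by (cases m) auto
  have "n * k + 1 < 2 ^ l" "n * k + 1 < 2 ^ m" using N l by auto
  thus ?thesis
    using misiu_trace_eq[of m d n k] misiu_trace_eq[of l d n k] diff_trace_Suc[of d n l k] m d l by simp
qed

lemma cycle_multiplier_fun: "cycle_multiplier m n = (\<lambda>\<alpha>. 2 ^ n * poly (cpoly (theta m n)) \<alpha>)"
  by (rule ext) (simp add: cycle_multiplier_eq of_int_hom.map_poly_hom_smult)

lemma theta_zero_periodic:
  assumes "n \<ge> 1" "k dvd n" "poly (orb k) \<alpha> = 0"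
  shows "poly (cpoly (theta m n)) \<alpha> = 0"
proof -
  obtain j where "n = j * k" using assms(2) by (metis dvdE mult.commute)
  hence "crit_orbit k dvd theta m n"
    using crit_orbit_dvd_mult[of k j] crit_orbit_dvd_theta[OF assms(1), of m] by (auto intro: dvd_trans)
  then obtain w where "theta m n = crit_orbit k * w" by (auto elim: dvdE)
  thus ?thesis using assms(3) by (simp add: of_int_poly_hom.hom_mult)
qed

definition theta_sum :: "nat \<Rightarrow> nat \<Rightarrow> nat \<Rightarrow> complex" where
  "theta_sum m n k = root_sum (cpoly (misiurewicz_poly m n)) (\<lambda>c. poly (cpoly (theta m n)) c ^ k)"

lemma theta_sum_eq:
  assumes "m \<ge> 2" "n \<ge> 1" "k \<ge> 1"
  shows "theta_sum m n k = (\<Sum>d | d dvd n. of_int (moebius_mu (n div d)) *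
           root_sum (cpoly (misiu m d)) (\<lambda>c. poly (cpoly (theta m n)) c ^ k))"
  unfolding theta_sum_def
  by (rule root_sum_misiurewicz_poly[OF assms(1,2)]) (use theta_zero_periodic[OF assms(2)] assms(3) in auto)

lemma theta_sum_double:
  assumes m: "m \<ge> 2" and n: "n \<ge> 1" "k \<ge> 1" and N: "n * k + 1 < 2 ^ (m - 1)"
  shows "theta_sum (Suc m) n k = 2 * theta_sum m n k"
proof -
  have "theta_sum (Suc m) n k = (\<Sum>d | d dvd n. of_int (moebius_mu (n div d)) *
           (2 * root_sum (cpoly (misiu m d)) (\<lambda>c. poly (cpoly (theta m n)) c ^ k)))"
    using misiu_trace_double[OF m _ _ N] divisor_ge_1[OF n(1)] m n by (simp add: theta_sum_eq)
  also have "\<dots> = 2 * theta_sum m n k"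
    using m n by (simp add: theta_sum_eq sum_distrib_left mult_ac)
  finally show ?thesis .
qed

subsection \<open>Newton's identities\<close>

definition power_sum :: "complex multiset \<Rightarrow> nat \<Rightarrow> complex" where
  "power_sum A k = (\<Sum>x\<in>#A. x ^ k)"

definition psum_fps :: "complex multiset \<Rightarrow> complex fps" where
  "psum_fps A = Abs_fps (\<lambda>i. power_sum A (Suc i))"

text \<open>Logarithmic derivative: the factor 1 - x t contributes -x / (1 - x t), the generating
  series of the powers of x up to sign.\<close>

lemma fps_deriv_rev_prod:
  "fps_deriv (fps_of_poly (rev_prod A)) = - fps_of_poly (rev_prod A) * psum_fps A"
proof (induction A)
  case empty
  have "psum_fps {#} = 0" by (simp add: psum_fps_def power_sum_def fps_eq_iff)
  thus ?case by simp
next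
  case (add x A)
  define L where "L = Abs_fps (\<lambda>i. x ^ Suc i)"
  have L: "psum_fps (add_mset x A) = L + psum_fps A"
    by (simp add: psum_fps_def power_sum_def L_def fps_eq_iff)
  have lin: "fps_of_poly [:1, -x:] = 1 - fps_const x * fps_X"
    by (simp add: fps_of_poly_pCons)
  have geo: "(1 - fps_const x * fps_X) * L = fps_const x"
  proof (rule fps_ext)
    fix i show "fps_nth ((1 - fps_const x * fps_X) * L) i = fps_nth (fps_const x) i"
      by (cases i) (simp_all add: left_diff_distrib mult.assoc L_def)
  qed
  let ?F = "fps_of_poly (rev_prod A)"
  have eq: "fps_of_poly (rev_prod (add_mset x A)) = (1 - fps_const x * fps_X) * ?F"
    unfolding rev_prod_add fps_of_poly_mult lin ..
  have "fps_deriv ((1 - fps_const x * fps_X) * ?F)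
      = - fps_const x * ?F + (1 - fps_const x * fps_X) * fps_deriv ?F"
    by (simp add: algebra_simps)
  also have "\<dots> = - ((1 - fps_const x * fps_X) * L) * ?F + (1 - fps_const x * fps_X) * (- ?F * psum_fps A)"
    by (simp only: geo add)
  also have "\<dots> = - ((1 - fps_const x * fps_X) * ?F) * (L + psum_fps A)"
    by (simp add: algebra_simps)
  finally show ?case unfolding eq L .
qed

lemma newton_identity:
  "of_nat (Suc k) * coeff (rev_prod A) (Suc k) = - (\<Sum>i\<le>k. coeff (rev_prod A) i * power_sum A (Suc (k - i)))"
proof -
  have "fps_nth (fps_deriv (fps_of_poly (rev_prod A))) k
      = fps_nth (- fps_of_poly (rev_prod A) * psum_fps A) k"
    by (simp only: fps_deriv_rev_prod)
  thus ?thesis by (simp add: fps_mult_nth psum_fps_def sum_negf atLeast0AtMost)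
qed

lemma coeff_rev_prod_cong:
  assumes "\<And>i. 1 \<le> i \<Longrightarrow> i \<le> K \<Longrightarrow> power_sum A i = power_sum B i" "k \<le> K"
  shows "coeff (rev_prod A) k = coeff (rev_prod B) k"
  using assms(2)
proof (induction k rule: less_induct)
  case (less k)
  show ?case
  proof (cases k)
    case (Suc l)
    have "of_nat (Suc l) * coeff (rev_prod A) (Suc l) = of_nat (Suc l) * coeff (rev_prod B) (Suc l)"
      unfolding newton_identity using less Suc assms(1)
      by (intro arg_cong[where f = uminus] sum.cong refl) auto
    thus ?thesis by (simp add: Suc del: of_nat_Suc)
  qed simp
qed

lemma power_sum_cong:
  assumes "\<And>i. i \<le> K \<Longrightarrow> coeff (rev_prod A) i = coeff (rev_prod B) i" "1 \<le> k" "k \<le> K"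
  shows "power_sum A k = power_sum B k"
  using assms(2,3)
proof (induction k rule: less_induct)
  case (less k)
  then obtain l where l: "k = Suc l" by (cases k) auto
  have split: "(\<Sum>i\<le>l. coeff (rev_prod C) i * power_sum C (Suc (l - i)))
      = power_sum C k + (\<Sum>i<l. coeff (rev_prod C) (Suc i) * power_sum C (l - i))" for C
    unfolding sum.atMost_shift by (simp add: l Suc_diff_Suc)
  have "(\<Sum>i<l. coeff (rev_prod A) (Suc i) * power_sum A (l - i))
      = (\<Sum>i<l. coeff (rev_prod B) (Suc i) * power_sum B (l - i))"
    using less assms(1) l by (intro sum.cong refl) auto
  moreover have "(\<Sum>i\<le>l. coeff (rev_prod A) i * power_sum A (Suc (l - i)))
      = (\<Sum>i\<le>l. coeff (rev_prod B) i * power_sum B (Suc (l - i)))"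
    using newton_identity[of l A] newton_identity[of l B] assms(1)[of "Suc l"] less l by simp
  ultimately show ?case unfolding split by simp
qed

lemma lam_poly_square:
  assumes m: "m \<ge> 2" and n: "n \<ge> 1" and k: "n * k + 1 < 2 ^ (m - 1)"
  shows "coeff (lam_poly (Suc m) n) k = coeff (lam_poly m n ^ 2) k"
proof -
  define A where "A = (\<lambda>m. image_mset (cycle_multiplier m n) (misi_roots m n))"
  have ps: "power_sum (A m) i = (2 ^ n) ^ i * theta_sum m n i" for m i
    unfolding A_def power_sum_def theta_sum_def root_sum_def
    by (simp add: multiset.map_comp o_def cycle_multiplier_fun
        power_mult_distrib sum_mset_distrib_left)
  have cong: "power_sum (A (Suc m)) i = power_sum (A m + A m) i" if "1 \<le> i" "i \<le> k" for i
  proof -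
    have "n * i + 1 \<le> n * k + 1" using that by simp
    hence "theta_sum (Suc m) n i = 2 * theta_sum m n i"
      using k by (intro theta_sum_double[OF m n that(1)]) linarith
    thus ?thesis using ps[of "Suc m" i] ps[of m i] by (simp add: power_sum_def)
  qed
  have "complex_of_int (coeff (lam_poly (Suc m) n) k) = coeff (cpoly (lam_poly (Suc m) n)) k" by simp
  also have "\<dots> = coeff (rev_prod (A (Suc m))) k"
    using cpoly_lam_poly[of "Suc m" n] m n by (simp add: A_def)
  also have "\<dots> = coeff (rev_prod (A m + A m)) k"
    by (rule coeff_rev_prod_cong[of k]) (use cong in auto)
  also have "\<dots> = coeff (cpoly (lam_poly m n ^ 2)) k"
    using cpoly_lam_poly[OF m n]
    by (simp add: A_def rev_prod_union power2_eq_square of_int_poly_hom.hom_mult)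
  also have "\<dots> = of_int (coeff (lam_poly m n ^ 2) k)" by simp
  finally show ?thesis by (simp only: of_int_eq_iff)
qed

lemma coeff_lam_poly_1_theta:
  assumes "m \<ge> 2" "n \<ge> 1"
  shows "of_int (coeff (lam_poly m n) 1) = - (2 ^ n * theta_sum m n 1)"
  unfolding coeff_lam_poly_1[OF assms] theta_sum_def root_sum_def
  by (simp add: cycle_multiplier_fun sum_mset_distrib_left multiset.map_comp o_def)

subsection \<open>Power sums of the critical orbit\<close>

abbreviation rev_orb :: "nat \<Rightarrow> complex poly" where
  "rev_orb m \<equiv> reflect_poly (orb m)"

abbreviation psum :: "complex poly \<Rightarrow> nat \<Rightarrow> complex" where
  "psum p \<equiv> power_sum (proots p)"

lemma rev_prod_proots: "lead_coeff p = 1 \<Longrightarrow> rev_prod (proots p) = reflect_poly p"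
  using complex_poly_decompose_multiset[of p] reflect_poly_prod_linear[of "proots p"] by simp

lemma psum_0: "psum p 0 = of_nat (degree p)"
  by (simp add: power_sum_def size_proots_complex)

lemma root_sum_poly:
  assumes "degree h \<le> n"
  shows "root_sum p (poly h) = (\<Sum>u\<le>n. coeff h u * psum p u)"
proof -
  have "poly h c = (\<Sum>u\<le>n. coeff h u * c ^ u)" for c
    unfolding poly_altdef using assms by (intro sum.mono_neutral_left) (auto simp: coeff_eq_0)
  hence "root_sum p (poly h) = (\<Sum>c\<in>#proots p. \<Sum>u\<le>n. coeff h u * c ^ u)"
    by (simp add: root_sum_def)
  also have "\<dots> = (\<Sum>u\<le>n. coeff h u * psum p u)"
  proof -
    have "(\<Sum>c\<in>#A. \<Sum>u\<le>n. coeff h u * c ^ u) = (\<Sum>u\<le>n. coeff h u * power_sum A u)" for A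
      unfolding power_sum_def by (induction A) (simp_all add: sum.distrib distrib_left)
    thus ?thesis .
  qed
  finally show ?thesis .
qed

lemma reflect_poly_add:
  fixes p q :: "complex poly"
  assumes "degree q < degree p"
  shows "reflect_poly (p + q) = reflect_poly p + monom 1 (degree p - degree q) * reflect_poly q"
proof (rule poly_eqI)
  fix i
  have "degree (p + q) = degree p" using assms by (rule degree_add_eq_left)
  thus "coeff (reflect_poly (p + q)) i
      = coeff (reflect_poly p + monom 1 (degree p - degree q) * reflect_poly q) i"
    using assms by (auto simp: coeff_reflect_poly coeff_monom_mult coeff_eq_0 not_le intro!: arg_cong2[where f = "(+)"]
        arg_cong[where f = "coeff q"])
qed

text \<open>The summand c lies 2^m - 1 degrees below the leading term of a_m^2. So the reciprocal of
  a_(m+1) is a square below degree 2^m - 1, and the power sums of lower exponent double.\<close>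

lemma rev_orb_Suc:
  assumes m: "m \<ge> 1"
  shows "rev_orb (Suc m) = rev_orb m ^ 2 + monom 1 (2 ^ m - 1)"
proof -
  have m': "m - 1 + 1 = m" using m by simp
  have nz: "orb m \<noteq> 0" using crit_orbit_nonzero[OF m] by simp
  have deg: "degree (orb m ^ 2) = 2 ^ m"
    using orb_degree[OF m] nz m by (cases m) (simp_all add: degree_power_eq)
  have "(2::nat) ^ m \<ge> 2 ^ 1" using m by (intro power_increasing) auto
  hence lt: "degree [:0, 1 :: complex:] < degree (orb m ^ 2)" unfolding deg by simp
  have "reflect_poly [:0, 1 :: complex:] = 1"
    by (rule poly_eqI) (auto simp: coeff_reflect_poly coeff_pCons split: nat.splits)
  thus ?thesis unfolding orb_Suc reflect_poly_add[OF lt] deg by (simp add: reflect_poly_power)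
qed

lemma rev_prod_orb: "m \<ge> 1 \<Longrightarrow> rev_prod (proots (orb m)) = rev_orb m"
  using rev_prod_proots orb_degree by blast

lemma psum_orb_Suc:
  assumes m: "m \<ge> 1" and j: "j < 2 ^ m - 1"
  shows "psum (orb (Suc m)) j = 2 * psum (orb m) j"
proof (cases "j = 0")
  case True
  thus ?thesis using orb_degree[OF m] orb_degree[of "Suc m"] m by (cases m) (simp_all add: psum_0)
next
  case False
  have "psum (orb (Suc m)) j = power_sum (proots (orb m) + proots (orb m)) j"
  proof (rule power_sum_cong[of j])
    fix i assume "i \<le> j"
    hence "i < 2 ^ m - 1" using j by simp
    thus "coeff (rev_prod (proots (orb (Suc m)))) i = coeff (rev_prod (proots (orb m) + proots (orb m))) i"
      using rev_orb_Suc[OF m] m by (simp add: rev_prod_union rev_prod_orb power2_eq_square)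
  qed (use False in auto)
  thus ?thesis by (simp add: power_sum_def)
qed

lemma psum_orb_add:
  assumes m: "m \<ge> 1" and j: "j < 2 ^ m - 1"
  shows "psum (orb (m + i)) j = 2 ^ i * psum (orb m) j"
proof (induction i)
  case (Suc i)
  have "(2::nat) ^ m \<le> 2 ^ (m + i)" by (intro power_increasing) auto
  hence "j < 2 ^ (m + i) - 1" using j by linarith
  thus ?case using psum_orb_Suc[of "m + i" j] m Suc by simp
qed simp

section \<open>Traces over a_(m+d) + a_m compared with traces over a_(m+d) - a_m\<close>

text \<open>The difference of the degrees of \<open>a_(m+d)\<close> and \<open>a_m\<close>.\<close>

definition gap :: "nat \<Rightarrow> nat \<Rightarrow> nat" where
  "gap m d = 2 ^ (m - 1) * (2 ^ d - 1)"

lemma gap_eq: "m \<ge> 1 \<Longrightarrow> 2 ^ (m + d - 1) = gap m d + 2 ^ (m - 1)"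
proof -
  assume m: "m \<ge> 1"
  have "(2::nat) ^ (m + d - 1) = 2 ^ (m - 1) * (2 ^ d - 1 + 1)"
    using m by (simp flip: power_add)
  thus ?thesis unfolding gap_def by (simp only: distrib_left mult_1_right)
qed

lemma gap_pos: "d \<ge> 1 \<Longrightarrow> gap m d \<ge> 2 ^ (m - 1)"
  using one_less_power[of "2::nat" d] by (simp add: gap_def)

lemma degree_theta:
  assumes m: "m \<ge> 1"
  shows "degree (cpoly (theta m d)) = gap m d \<and> lead_coeff (cpoly (theta m d)) = 1"
proof (induction d)
  case (Suc d)
  let ?p = "cpoly (theta m d)" and ?q = "orb (m + d)"
  have th: "cpoly (theta m (Suc d)) = ?p * ?q" by (simp add: theta_def of_int_poly_hom.hom_mult)
  have q: "degree ?q = 2 ^ (m + d - 1)" "lead_coeff ?q = 1" using orb_degree[of "m + d"] m by auto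
  have "?p \<noteq> 0" "?q \<noteq> 0" using Suc q by auto
  hence "degree (?p * ?q) = gap m d + 2 ^ (m + d - 1)" using Suc q by (simp add: degree_mult_eq)
  also have "\<dots> = gap m (Suc d)" unfolding gap_eq[OF m] by (simp add: gap_def algebra_simps)
  finally have deg: "degree (?p * ?q) = gap m (Suc d)" .
  have "lead_coeff (?p * ?q) = 1"
    unfolding lead_coeff_mult using conjunct2[OF Suc] q(2) by (metis mult_1)
  with deg show ?case unfolding th by blast
qed (simp add: theta_def gap_def)

lemma rev_misiu:
  assumes m: "m \<ge> 1" and d: "d \<ge> 1"
  shows "reflect_poly (cpoly (misiu (Suc m) d)) = rev_orb (m + d) + monom 1 (gap m d) * rev_orb m"
    and "reflect_poly (cpoly (diff_orb m d)) = rev_orb (m + d) - monom 1 (gap m d) * rev_orb m"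
    and "degree (cpoly (misiu (Suc m) d)) = 2 ^ (m + d - 1)" "lead_coeff (cpoly (misiu (Suc m) d)) = 1"
    and "degree (cpoly (diff_orb m d)) = 2 ^ (m + d - 1)" "lead_coeff (cpoly (diff_orb m d)) = 1"
proof -
  have o: "degree (orb (m + d)) = 2 ^ (m + d - 1)" "lead_coeff (orb (m + d)) = 1" "degree (orb m) = 2 ^ (m - 1)"
    using orb_degree[of "m + d"] orb_degree[OF m] m by auto
  have lt: "degree (orb m) < degree (orb (m + d))" "degree (- orb m) < degree (orb (m + d))"
  proof -
    have "0 < gap m d" using gap_pos[OF d, of m] by (metis less_le_trans zero_less_numeral zero_less_power)
    thus "degree (orb m) < degree (orb (m + d))" "degree (- orb m) < degree (orb (m + d))"
      unfolding o gap_eq[OF m] degree_minus by simp_all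
  qed
  have g: "degree (orb (m + d)) - degree (orb m) = gap m d" unfolding o gap_eq[OF m] by simp
  have A: "cpoly (misiu (Suc m) d) = orb (m + d) + orb m" by (simp add: misiu_def of_int_poly_hom.hom_add)
  have B: "cpoly (diff_orb m d) = orb (m + d) + (- orb m)" by (simp add: cpoly_diff_orb)
  show "reflect_poly (cpoly (misiu (Suc m) d)) = rev_orb (m + d) + monom 1 (gap m d) * rev_orb m"
    unfolding A reflect_poly_add[OF lt(1)] g ..
  have "reflect_poly (- orb m) = - rev_orb m" by (rule poly_eqI) (simp add: coeff_reflect_poly)
  thus "reflect_poly (cpoly (diff_orb m d)) = rev_orb (m + d) - monom 1 (gap m d) * rev_orb m"
    unfolding B reflect_poly_add[OF lt(2)] degree_minus g by simp
  show "degree (cpoly (misiu (Suc m) d)) = 2 ^ (m + d - 1)" "lead_coeff (cpoly (misiu (Suc m) d)) = 1"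
    unfolding A using monic_add_lower[OF o(2) lt(1)] o(1) by auto
  show "degree (cpoly (diff_orb m d)) = 2 ^ (m + d - 1)" "lead_coeff (cpoly (diff_orb m d)) = 1"
    unfolding B using monic_add_lower[OF o(2) lt(2)] o(1) by auto
qed

text \<open>The series that remains of the quotient of the reciprocals of a_m and a_(m+d) when the
  power of X with exponent \<open>gap m d\<close> is taken out.\<close>

definition kappa :: "nat \<Rightarrow> nat \<Rightarrow> complex fps" where
  "kappa m d = fps_of_poly (rev_orb m) * inverse (fps_of_poly (rev_orb (m + d)))"

lemma rev_orb_unit:
  assumes "m \<ge> 1"
  shows "fps_nth (fps_of_poly (rev_orb m)) 0 = 1" "inverse (fps_of_poly (rev_orb m)) * fps_of_poly (rev_orb m) = 1"
    "fps_of_poly (rev_orb m) * inverse (fps_of_poly (rev_orb m)) = 1"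
proof -
  show *: "fps_nth (fps_of_poly (rev_orb m)) 0 = 1"
    unfolding fps_of_poly_nth coeff_0_reflect_poly using orb_degree[OF assms] by blast
  show "inverse (fps_of_poly (rev_orb m)) * fps_of_poly (rev_orb m) = 1"
    by (rule inverse_mult_eq_1) (use * in simp)
  show "fps_of_poly (rev_orb m) * inverse (fps_of_poly (rev_orb m)) = 1"
    by (rule inverse_mult_eq_1') (use * in simp)
qed

text \<open>The two polynomials \<open>a_(m+d) \<plusminus> a_m\<close> have reciprocals \<open>\<alpha> \<plusminus> \<gamma>\<close>, so the generating functions of their
  power sums differ by \<open>2 (\<gamma>/\<alpha>)' / (1 - (\<gamma>/\<alpha>)^2)\<close>.\<close>

lemma psum_diff:
  assumes m: "m \<ge> 1" and d: "d \<ge> 1" and i: "i \<le> 2 * gap m d"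
  shows "psum (cpoly (diff_orb m d)) i - psum (cpoly (misiu (Suc m) d)) i
       = (if i < gap m d then 0 else 2 * of_nat i * fps_nth (kappa m d) (i - gap m d))"
proof (cases "i = 0")
  case True
  thus ?thesis using gap_pos[OF d, of m] rev_misiu(3,5)[OF m d] by (simp add: psum_0)
next
  case False
  then obtain k where k: "i = Suc k" by (cases i) auto
  define A where "A = proots (cpoly (misiu (Suc m) d))"
  define B where "B = proots (cpoly (diff_orb m d))"
  define \<alpha> where "\<alpha> = fps_of_poly (rev_orb (m + d))"
  define \<gamma> where "\<gamma> = fps_X ^ gap m d * fps_of_poly (rev_orb m)"
  define \<nu> where "\<nu> = inverse \<alpha>"
  have mono: "fps_of_poly (monom 1 (gap m d) :: complex poly) = fps_X ^ gap m d" by (simp add: fps_of_poly_monom)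
  have FA: "fps_of_poly (rev_prod A) = \<alpha> + \<gamma>" and FB: "fps_of_poly (rev_prod B) = \<alpha> - \<gamma>"
    unfolding A_def B_def using rev_misiu[OF m d]
    by (simp_all add: rev_prod_proots fps_of_poly_add fps_of_poly_diff fps_of_poly_mult mono \<alpha>_def \<gamma>_def)
  have unit: "\<nu> * \<alpha> = 1" using rev_orb_unit(2)[of "m + d"] m by (simp add: \<nu>_def \<alpha>_def)
  define \<Delta> where "\<Delta> = psum_fps B - psum_fps A"
  have dA: "fps_deriv \<alpha> + fps_deriv \<gamma> = - (\<alpha> + \<gamma>) * psum_fps A"
    using fps_deriv_rev_prod[of A] by (simp add: FA)
  have dB: "fps_deriv \<alpha> - fps_deriv \<gamma> = - (\<alpha> - \<gamma>) * psum_fps B"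
    using fps_deriv_rev_prod[of B] by (simp add: FB)
  have "(\<alpha> + \<gamma>) * (\<alpha> - \<gamma>) * \<Delta> = (\<alpha> - \<gamma>) * (- (\<alpha> + \<gamma>) * psum_fps A) - (\<alpha> + \<gamma>) * (- (\<alpha> - \<gamma>) * psum_fps B)"
    by (simp add: \<Delta>_def algebra_simps)
  also have "\<dots> = 2 * (fps_deriv \<gamma> * \<alpha> - \<gamma> * fps_deriv \<alpha>)"
    unfolding dA [symmetric] dB [symmetric] by (simp add: algebra_simps)
  finally have main: "\<alpha> * \<alpha> * \<Delta> = 2 * (fps_deriv \<gamma> * \<alpha> - \<gamma> * fps_deriv \<alpha>) + \<gamma> * \<gamma> * \<Delta>"
    by (simp add: algebra_simps)
  have "\<Delta> = (\<nu> * \<alpha>) * (\<nu> * \<alpha>) * \<Delta>" by (simp add: unit)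
  also have "\<dots> = \<nu> * \<nu> * (\<alpha> * \<alpha> * \<Delta>)" by (simp add: mult_ac)
  also have "\<dots> = 2 * (fps_deriv \<gamma> * \<nu> * (\<nu> * \<alpha>) - \<gamma> * \<nu> * \<nu> * fps_deriv \<alpha>) + (\<gamma> * \<nu>) * (\<gamma> * \<nu>) * \<Delta>"
    unfolding main by (simp add: algebra_simps)
  also have "fps_deriv \<gamma> * \<nu> * (\<nu> * \<alpha>) - \<gamma> * \<nu> * \<nu> * fps_deriv \<alpha> = fps_deriv (\<gamma> * \<nu>)"
  proof -
    have "fps_deriv (\<nu> * \<alpha>) = 0" unfolding unit by simp
    hence 1: "fps_deriv \<nu> * \<alpha> = - (\<nu> * fps_deriv \<alpha>)" by (simp add: add_eq_0_iff2 add.commute)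
    have "fps_deriv \<nu> = fps_deriv \<nu> * \<alpha> * \<nu>" using unit by (simp add: mult.assoc mult.commute)
    hence 2: "fps_deriv \<nu> = - (\<nu> * fps_deriv \<alpha>) * \<nu>" unfolding 1 .
    show ?thesis unfolding unit by (simp add: 2 algebra_simps)
  qed
  also have "\<gamma> * \<nu> = fps_X ^ gap m d * kappa m d" by (simp add: \<gamma>_def \<nu>_def \<alpha>_def kappa_def mult.assoc)
  also have "(fps_X ^ gap m d * kappa m d) * (fps_X ^ gap m d * kappa m d) * \<Delta>
      = fps_X ^ (2 * gap m d) * (kappa m d * kappa m d * \<Delta>)"
    by (simp add: power_add mult_2 mult_ac)
  finally have \<Delta>: "\<Delta> = 2 * fps_deriv (fps_X ^ gap m d * kappa m d) + fps_X ^ (2 * gap m d) * (kappa m d * kappa m d * \<Delta>)" .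
  have "fps_nth \<Delta> k = 2 * of_nat (Suc k) * fps_nth (fps_X ^ gap m d * kappa m d) (Suc k)"
  proof -
    have two: "(2 :: complex fps) = fps_const 2" by (simp add: numeral_fps_const)
    \<comment> \<open>Here k = i - 1 lies below 2 \<open>gap m d\<close>, so the quadratic
      correction is not seen.\<close>
    have "fps_nth (fps_X ^ (2 * gap m d) * (kappa m d * kappa m d * \<Delta>)) k = 0"
      using i k by (simp add: fps_X_power_mult_nth)
    moreover define F where "F = fps_X ^ gap m d * kappa m d"
    ultimately have "fps_nth \<Delta> k = fps_nth (2 * fps_deriv F) k" by (subst \<Delta>) (simp add: F_def)
    thus ?thesis unfolding F_def [symmetric] by (simp add: two)
  qed
  thus ?thesis by (simp add: k fps_X_power_mult_nth \<Delta>_def psum_fps_def A_def B_def)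
qed

lemma kappa_0: "m \<ge> 1 \<Longrightarrow> fps_nth (kappa m d) 0 = 1"
  using rev_orb_unit(1)[of m] rev_orb_unit(1)[of "m + d"] by (simp add: kappa_def)

lemma root_sum_diff:
  assumes m: "m \<ge> 1" and d: "d \<ge> 1" and h: "degree h \<le> gap m d + j" and j: "j \<le> gap m d"
  shows "root_sum (cpoly (diff_orb m d)) (poly h) - root_sum (cpoly (misiu (Suc m) d)) (poly h)
       = 2 * (\<Sum>v\<le>j. coeff h (gap m d + v) * of_nat (gap m d + v) * fps_nth (kappa m d) v)"
proof -
  let ?s = "gap m d"
  have "root_sum (cpoly (diff_orb m d)) (poly h) - root_sum (cpoly (misiu (Suc m) d)) (poly h)
      = (\<Sum>u\<le>?s+j. coeff h u * (psum (cpoly (diff_orb m d)) u - psum (cpoly (misiu (Suc m) d)) u))"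
    unfolding root_sum_poly[OF h] by (simp add: right_diff_distrib sum_subtractf)
  also have "\<dots> = (\<Sum>u\<le>?s+j. coeff h u * (if u < ?s then 0 else 2 * of_nat u * fps_nth (kappa m d) (u - ?s)))"
    using j by (intro sum.cong refl arg_cong2[where f = "(*)"] psum_diff[OF m d]) auto
  also have "\<dots> = (\<Sum>u\<in>{?s..?s+j}. coeff h u * (2 * of_nat u * fps_nth (kappa m d) (u - ?s)))"
    by (intro sum.mono_neutral_cong_right) auto
  also have "\<dots> = (\<Sum>v\<le>j. coeff h (?s + v) * (2 * of_nat (?s + v) * fps_nth (kappa m d) v))"
    by (rule sum.reindex_bij_witness[of _ "\<lambda>v. ?s + v" "\<lambda>u. u - ?s"]) auto
  finally show ?thesis by (simp add: sum_distrib_left algebra_simps)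
qed

lemma root_sum_diff_low:
  assumes m: "m \<ge> 1" and d: "d \<ge> 1" and h: "degree h < gap m d"
  shows "root_sum (cpoly (diff_orb m d)) (poly h) = root_sum (cpoly (misiu (Suc m) d)) (poly h)"
  using root_sum_diff[OF m d, of h 0] h by (simp add: coeff_eq_0)

text \<open>The two windows differ only in that a_m is replaced by a_(m+d), which is - a_m at these
  roots.\<close>

lemma theta_misiu_root:
  assumes "d \<ge> 1" "poly (cpoly (misiu (Suc m) d)) c = 0"
  shows "poly (cpoly (theta m d)) c = - poly (cpoly (theta (Suc m) d)) c"
proof -
  obtain e where e: "d = Suc e" using assms(1) by (cases d) auto
  have "poly (orb (m + d)) c = - poly (orb m) c" using assms(2) by (simp add: poly_misiu add_eq_0_iff)
  moreover have "poly (cpoly (theta m d)) c = poly (orb m) c * (\<Prod>i<e. poly (orb (Suc m + i)) c)"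
    unfolding poly_theta e prod.lessThan_Suc_shift by simp
  moreover have "poly (cpoly (theta (Suc m) d)) c = (\<Prod>i<e. poly (orb (Suc m + i)) c) * poly (orb (m + d)) c"
    unfolding poly_theta e by simp
  ultimately show ?thesis by simp
qed

lemma root_sum_uminus: "root_sum p (\<lambda>c. - g c) = - root_sum p g"
proof -
  have "(\<Sum>x\<in>#A. - g x) = - (\<Sum>x\<in>#A. g x)" for A by (induction A) simp_all
  thus ?thesis by (simp add: root_sum_def)
qed

lemma misiu_cpoly_nz: "d \<ge> 1 \<Longrightarrow> cpoly (misiu (Suc m) d) \<noteq> 0"
  using misiu_nonzero[of "Suc m" d] by simp

text \<open>By the change of sign, the sum over the two factors of \<open>diff_orb (Suc m) d\<close>
  becomes the difference of the traces of \<open>theta m d\<close> over a_(m+d) - a_m and a_(m+d) +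
  a_m. This polynomial is monic of degree \<open>gap m d\<close>, the first exponent at which the
  power sums differ.\<close>

lemma trace_theta_sum:
  assumes m: "m \<ge> 1" and d: "d \<ge> 1"
  shows "root_sum (cpoly (diff_orb (Suc m) d)) (poly (cpoly (theta (Suc m) d))) = 2 * of_nat (gap m d)"
proof -
  have "root_sum (cpoly (misiu (Suc m) d)) (poly (cpoly (theta m d)))
      = root_sum (cpoly (misiu (Suc m) d)) (\<lambda>c. - poly (cpoly (theta (Suc m) d)) c)"
    by (rule root_sum_cong[OF misiu_cpoly_nz[OF d]]) (rule theta_misiu_root[OF d])
  moreover have "root_sum (cpoly (diff_orb m d)) (poly (cpoly (theta m d)))
      - root_sum (cpoly (misiu (Suc m) d)) (poly (cpoly (theta m d))) = 2 * of_nat (gap m d)"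
  proof -
    have "coeff (cpoly (theta m d)) (gap m d) = 1" using degree_theta[OF m, of d] by metis
    thus ?thesis
      using root_sum_diff[OF m d, of "cpoly (theta m d)" 0] degree_theta[OF m, of d] kappa_0[OF m] by simp
  qed
  ultimately show ?thesis
    using diff_trace_Suc[OF d dvd_refl, of m 1] by (simp add: root_sum_uminus add.commute)
qed

text \<open>The values of \<open>trace_theta_sum\<close> at consecutive levels are subtracted. Only
  degrees enter and no growth estimate, so \<open>d\<close> may be large compared with
  \<open>m\<close>, as the small cases require.\<close>

lemma trace_theta:
  assumes m: "m \<ge> 2" and d: "d \<ge> 1"
  shows "root_sum (cpoly (misiu (Suc m) d)) (poly (cpoly (theta (Suc m) d))) = 2 ^ (m - 1) * (2 ^ d - 1)"
proof -
  obtain l where l: "m = Suc (Suc l)" using m by (metis Suc_le_D numeral_2_eq_2 Suc_le_mono)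
  have g: "of_nat (gap i d) = (2 ^ (i - 1) * (2 ^ d - 1) :: complex)" for i
    by (simp add: gap_def of_nat_diff)
  have "root_sum (cpoly (diff_orb (Suc m) d)) (poly (cpoly (theta (Suc m) d)))
      = root_sum (cpoly (misiu (Suc m) d)) (poly (cpoly (theta (Suc m) d)))
        + root_sum (cpoly (diff_orb m d)) (poly (cpoly (theta m d)))"
    using diff_trace_Suc[OF d dvd_refl, of m 1] by simp
  moreover have "root_sum (cpoly (diff_orb m d)) (poly (cpoly (theta m d))) = 2 * of_nat (gap (Suc l) d)"
    using trace_theta_sum[of "Suc l" d] d by (simp add: l)
  moreover have "root_sum (cpoly (diff_orb (Suc m) d)) (poly (cpoly (theta (Suc m) d))) = 2 * of_nat (gap m d)"
    using trace_theta_sum[of m d] m d by simp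
  ultimately have "root_sum (cpoly (misiu (Suc m) d)) (poly (cpoly (theta (Suc m) d)))
      = 2 * of_nat (gap m d) - 2 * of_nat (gap (Suc l) d)"
    by (metis add_diff_cancel_right')
  thus ?thesis unfolding g by (simp add: l algebra_simps)
qed

text \<open>Below degree 2^m - 1 the recursion is pure squaring. Accordingly, the window of length
  \<open>d\<close> has the exponent 1 + 2 + ... + 2^(d-1) = 2^d - 1 in
  \<open>rev_theta_cong\<close>.\<close>

lemma rev_orb_cong: "m \<ge> 1 \<Longrightarrow>
  fps_X ^ (2 ^ m - 1) dvd fps_of_poly (rev_orb (m + i)) - fps_of_poly (rev_orb m) ^ (2 ^ i)"
proof (induction i)
  case (Suc i)
  define b where "b = fps_of_poly (rev_orb m)"
  define a where "a = fps_of_poly (rev_orb (m + i))"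
  have "fps_of_poly (rev_orb (m + Suc i)) = a ^ 2 + fps_X ^ (2 ^ (m + i) - 1)"
    using rev_orb_Suc[of "m + i"] Suc.prems by (simp add: a_def fps_of_poly_add fps_of_poly_power fps_of_poly_monom)
  hence eq: "fps_of_poly (rev_orb (m + Suc i)) - b ^ (2 ^ Suc i)
      = (a - b ^ (2 ^ i)) * (a + b ^ (2 ^ i)) + fps_X ^ (2 ^ (m + i) - 1)"
    by (simp add: power2_eq_square algebra_simps mult_2 flip: power_add)
  have "(2::nat) ^ m - 1 \<le> 2 ^ (m + i) - 1" by (intro diff_le_mono power_increasing) auto
  hence "fps_X ^ (2 ^ m - 1) dvd (a - b ^ (2 ^ i)) * (a + b ^ (2 ^ i)) + fps_X ^ (2 ^ (m + i) - 1)"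
    using Suc unfolding a_def b_def by (intro dvd_add dvd_mult2 le_imp_power_dvd) blast+
  hence "fps_X ^ (2 ^ m - 1) dvd fps_of_poly (rev_orb (m + Suc i)) - b ^ (2 ^ Suc i)" by (simp only: eq)
  thus ?case by (simp only: b_def)
qed simp

lemma rev_theta_cong: "m \<ge> 1 \<Longrightarrow>
  fps_X ^ (2 ^ m - 1) dvd fps_of_poly (reflect_poly (cpoly (theta m d))) - fps_of_poly (rev_orb m) ^ (2 ^ d - 1)"
proof (induction d)
  case (Suc d)
  define b where "b = fps_of_poly (rev_orb m)"
  define a where "a = fps_of_poly (rev_orb (m + d))"
  define r where "r = fps_of_poly (reflect_poly (cpoly (theta m d)))"
  have r: "fps_of_poly (reflect_poly (cpoly (theta m (Suc d)))) = r * a"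
    by (simp add: r_def a_def theta_def of_int_poly_hom.hom_mult reflect_poly_mult fps_of_poly_mult)
  have "(2::nat) ^ Suc d - 1 = (2 ^ d - 1) + 2 ^ d" by simp
  hence eq: "r * a - b ^ (2 ^ Suc d - 1) = (r - b ^ (2 ^ d - 1)) * a + b ^ (2 ^ d - 1) * (a - b ^ (2 ^ d))"
    by (simp only: power_add) (simp add: algebra_simps)
  have "fps_X ^ (2 ^ m - 1) dvd r - b ^ (2 ^ d - 1)" "fps_X ^ (2 ^ m - 1) dvd a - b ^ (2 ^ d)"
    using Suc rev_orb_cong[of m d] unfolding a_def b_def r_def by blast+
  hence "fps_X ^ (2 ^ m - 1) dvd r * a - b ^ (2 ^ Suc d - 1)"
    unfolding eq by (intro dvd_add dvd_mult dvd_mult2)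
  thus ?case unfolding r b_def .
qed (simp add: theta_def)

text \<open>At the roots of a_(m+d) + a_m the product changes sign between the windows at
  \<open>m\<close> and m + 1, and \<open>root_sum_balance\<close> carries the trace to a_(m+d) -
  a_m. So twice the trace is a difference as in \<open>root_sum_diff\<close>. Modulo X^(2^m - 1) the
  series in it are powers of the reciprocal b of a_m with exponents 1 - 2^d and 2^d - 1, and what
  remains is the logarithmic derivative of b.\<close>

lemma trace_pow_theta:
  assumes m: "m \<ge> 1" and d: "d \<ge> 1" and j: "2 * j + d + 1 < 2 ^ m"
  shows "root_sum (cpoly (misiu (Suc m) d)) (\<lambda>c. c ^ j * poly (cpoly (theta (Suc m) d)) c)
       = (2 ^ d - 1) * psum (orb m) j"
proof -
  define s where "s = gap m d"
  define M where "M = (2::nat) ^ d - 1"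
  define K where "K = (2::nat) ^ m - 1"
  define h where "h = monom 1 j * cpoly (theta m d)"
  let ?A = "cpoly (misiu (Suc m) d)" and ?B = "cpoly (diff_orb m d)"
  have th: "degree (cpoly (theta m d)) = s" using degree_theta[OF m] by (simp add: s_def)
  hence th': "degree (theta m d) = s" by simp
  have "2 * j < 2 ^ m" using j by simp
  hence "j < 2 ^ (m - 1)" using m by (cases m) auto
  hence js: "j \<le> s" using gap_pos[OF d, of m] by (simp add: s_def)
  have sM: "s = 2 ^ (m - 1) * M" by (simp add: s_def M_def gap_def)
  have K: "j < K" "K \<ge> 1" using j d by (auto simp: K_def)
  have h: "poly h c = c ^ j * poly (cpoly (theta m d)) c" for c by (simp add: h_def poly_monom)
  have "root_sum ?A (\<lambda>c. c ^ j * poly (cpoly (theta (Suc m) d)) c)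
      = root_sum ?A (\<lambda>c. c ^ j * (\<Prod>i\<leftarrow>[0..<d]. poly (orb (m + d + i)) c))"
  proof (rule root_sum_cong[OF misiu_cpoly_nz[OF d]])
    fix c assume root: "poly ?A c = 0"
    have "(\<Prod>i<d. poly (orb (m + d + i)) c) = (\<Prod>i<d. poly (orb (Suc m + i)) c)"
      by (rule prod_window_periodic[where d = d]) (use misiu_root_period[OF root] d in auto)
    thus "c ^ j * poly (cpoly (theta (Suc m) d)) c = c ^ j * (\<Prod>i\<leftarrow>[0..<d]. poly (orb (m + d + i)) c)"
      by (simp add: prod_list_upt poly_theta)
  qed
  also have "\<dots> = root_sum ?B (\<lambda>c. c ^ j * (\<Prod>i\<leftarrow>[0..<d]. poly (orb (m + i)) c))"
    unfolding cpoly_diff_orb by (rule root_sum_balance[OF m d]) (use j in simp)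
  also have "(\<lambda>c. c ^ j * (\<Prod>i\<leftarrow>[0..<d]. poly (orb (m + i)) c)) = poly h"
    by (rule ext) (simp add: prod_list_upt h poly_theta)
  finally have AB: "root_sum ?A (\<lambda>c. c ^ j * poly (cpoly (theta (Suc m) d)) c) = root_sum ?B (poly h)" .
  have "root_sum ?A (poly h) = root_sum ?A (\<lambda>c. - (c ^ j * poly (cpoly (theta (Suc m) d)) c))"
    by (rule root_sum_cong[OF misiu_cpoly_nz[OF d]]) (simp add: h theta_misiu_root[OF d])
  hence "2 * root_sum ?A (\<lambda>c. c ^ j * poly (cpoly (theta (Suc m) d)) c)
      = root_sum ?B (poly h) - root_sum ?A (poly h)"
    using AB by (simp add: root_sum_uminus)
  also have "\<dots> = 2 * (\<Sum>v\<le>j. coeff h (s + v) * of_nat (s + v) * fps_nth (kappa m d) v)"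
  proof -
    have "degree h \<le> s + j" unfolding h_def using degree_mult_le[of "monom 1 j" "cpoly (theta m d)"]
      degree_monom_le[of "1::complex" j] th by linarith
    thus ?thesis using root_sum_diff[OF m d, of h j] js by (simp add: s_def)
  qed
  finally have eq: "root_sum ?A (\<lambda>c. c ^ j * poly (cpoly (theta (Suc m) d)) c)
      = (\<Sum>v\<le>j. coeff h (s + v) * of_nat (s + v) * fps_nth (kappa m d) v)" by simp
  define b where "b = fps_of_poly (rev_orb m)"
  define \<rho> where "\<rho> = fps_of_poly (reflect_poly (cpoly (theta m d)))"
  define \<kappa> where "\<kappa> = kappa m d"
  define P where "P = psum_fps (proots (orb m))"
  have "(\<Sum>v\<le>j. coeff h (s + v) * of_nat (s + v) * fps_nth \<kappa> v)
      = fps_nth ((of_nat s * \<kappa> + fps_X * fps_deriv \<kappa>) * \<rho>) j"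
  proof -
    have "coeff h (s + v) = coeff (reflect_poly (cpoly (theta m d))) (j - v)" if "v \<le> j" for v
      using that js by (simp add: h_def coeff_monom_mult coeff_reflect_poly th')
    moreover have "fps_nth (of_nat s * \<kappa> + fps_X * fps_deriv \<kappa>) v = of_nat (s + v) * fps_nth \<kappa> v" for v
      by (cases v) (simp_all add: fps_mult_of_nat_nth algebra_simps)
    ultimately show ?thesis
      unfolding fps_mult_nth \<rho>_def by (intro sum.cong) (auto simp: atLeast0AtMost)
  qed
  also have "\<dots> = fps_nth (of_nat s + of_nat M * (fps_X * P)) j"
  proof -
    have c\<rho>: "fps_X ^ K dvd \<rho> - b ^ M" using rev_theta_cong[OF m, of d] by (simp add: \<rho>_def b_def K_def M_def)
    have db: "fps_deriv b = - b * P"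
      using fps_deriv_rev_prod[of "proots (orb m)"] rev_prod_orb[OF m] by (simp add: b_def P_def)
    define \<alpha> where "\<alpha> = fps_of_poly (rev_orb (m + d))"
    have M1: "2 ^ d = Suc M" by (simp add: M_def)
    have c\<alpha>: "fps_X ^ K dvd \<alpha> - b * b ^ M" using rev_orb_cong[OF m, of d] by (simp add: \<alpha>_def b_def K_def M1)
    have \<kappa>: "\<kappa> = b * inverse \<alpha>" by (simp add: \<kappa>_def kappa_def b_def \<alpha>_def)
    have \<alpha>1: "\<alpha> * inverse \<alpha> = 1" using rev_orb_unit(3)[of "m + d"] m by (simp add: \<alpha>_def)
    define \<eta> where "\<eta> = \<kappa> * b ^ M"
    have "\<eta> - 1 = - (\<alpha> - b * b ^ M) * inverse \<alpha>"
      using \<alpha>1 by (simp add: \<eta>_def \<kappa> algebra_simps)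
    hence "fps_X ^ K dvd \<eta> - 1" using c\<alpha> by (metis dvd_minus_iff dvd_mult2)
    then obtain g where g: "\<eta> = 1 + fps_X ^ K * g" by (metis dvdE add.commute diff_add_cancel)
    \<comment> \<open>The operator X d/dX preserves divisibility by X^K, whereas the plain
      derivative would lose one degree.\<close>
    have Xd: "fps_X * fps_deriv (fps_X ^ i) = (of_nat i * fps_X ^ i :: complex fps)" for i
    proof (induction i)
      case (Suc i)
      have "fps_X * fps_deriv (fps_X ^ Suc i :: complex fps) = fps_X * fps_X ^ i + fps_X * (fps_X * fps_deriv (fps_X ^ i))"
        by (simp add: algebra_simps)
      also have "\<dots> = of_nat (Suc i) * fps_X ^ Suc i"
        unfolding Suc by (simp add: distrib_right mult.left_commute [of fps_X "of_nat i"])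
      finally show ?case .
    qed simp
    have "fps_X * fps_deriv \<eta> = (fps_X * fps_deriv (fps_X ^ K)) * g + fps_X ^ K * (fps_X * fps_deriv g)"
      unfolding g by (simp add: algebra_simps)
    also have "\<dots> = fps_X ^ K * (of_nat K * g + fps_X * fps_deriv g)"
      unfolding Xd by (simp add: algebra_simps)
    finally have "fps_X * fps_deriv \<eta> = fps_X ^ K * (of_nat K * g + fps_X * fps_deriv g)" .
    hence d\<eta>: "fps_X ^ K dvd fps_X * fps_deriv \<eta>" by simp
    have d\<eta>': "fps_deriv \<eta> = fps_deriv \<kappa> * b ^ M - of_nat M * \<eta> * P"
    proof -
      have "fps_deriv (b ^ i) = - (of_nat i * (b ^ i * P))" for i
      proof (induction i)
        case (Suc i)
        have "fps_deriv (b ^ Suc i) = fps_deriv b * b ^ i + b * fps_deriv (b ^ i)"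
          by (simp add: algebra_simps)
        also have "\<dots> = - (of_nat (Suc i) * (b ^ Suc i * P))"
          unfolding Suc db by (simp add: algebra_simps)
        finally show ?case .
      qed simp
      thus ?thesis by (simp add: \<eta>_def algebra_simps)
    qed
    have "(of_nat s * \<kappa> + fps_X * fps_deriv \<kappa>) * \<rho> - (of_nat s + of_nat M * (fps_X * P))
        = (of_nat s * \<kappa> + fps_X * fps_deriv \<kappa>) * (\<rho> - b ^ M) + (of_nat s + of_nat M * (fps_X * P)) * (\<eta> - 1)
          + fps_X * fps_deriv \<eta>"
      unfolding d\<eta>' by (simp add: \<eta>_def algebra_simps)
    moreover have "fps_X ^ K dvd \<dots>"
      by (rule dvd_add[OF dvd_add[OF dvd_mult[OF c\<rho>] dvd_mult[OF \<open>fps_X ^ K dvd \<eta> - 1\<close>]] d\<eta>])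
    ultimately obtain f where "(of_nat s * \<kappa> + fps_X * fps_deriv \<kappa>) * \<rho> - (of_nat s + of_nat M * (fps_X * P)) = fps_X ^ K * f"
      by (metis dvdE)
    hence "(of_nat s * \<kappa> + fps_X * fps_deriv \<kappa>) * \<rho> = of_nat s + of_nat M * (fps_X * P) + fps_X ^ K * f"
      by (metis add.commute diff_add_cancel)
    thus ?thesis using K(1) by (simp add: fps_X_power_mult_nth)
  qed
  also have "\<dots> = of_nat M * psum (orb m) j"
  proof (cases j)
    case 0
    have "fps_nth (of_nat s :: complex fps) 0 = of_nat s" by (simp add: fps_of_nat [symmetric] del: fps_of_nat)
    thus ?thesis using orb_degree[OF m] by (simp add: 0 psum_0 sM)
  next
    case (Suc i)
    have "fps_nth (of_nat s :: complex fps) (Suc i) = 0" by (simp add: fps_of_nat [symmetric] del: fps_of_nat)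
    thus ?thesis by (simp add: Suc fps_mult_of_nat_nth P_def psum_fps_def)
  qed
  finally show ?thesis by (simp add: eq \<kappa>_def M_def of_nat_diff)
qed

subsection \<open>Vanishing traces\<close>

lemma root_sum_add: "root_sum p (\<lambda>c. f c + g c) = root_sum p f + root_sum p g"
  by (simp add: root_sum_def sum_mset.distrib)

lemma root_sum_scale: "root_sum p (\<lambda>c. a * g c) = a * root_sum p g"
  by (simp add: root_sum_def sum_mset_distrib_left multiset.map_comp o_def)

lemma root_sum_sum: "root_sum p (\<lambda>c. \<Sum>i\<in>I. f i c) = (\<Sum>i\<in>I. root_sum p (f i))"
  by (induction I rule: infinite_finite_induct) (simp_all add: root_sum_add, simp_all add: root_sum_def)

lemma root_sum_pow: "root_sum p (\<lambda>c. c ^ j) = psum p j"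
  by (simp add: root_sum_def power_sum_def)

definition orbit_trace :: "nat \<Rightarrow> nat \<Rightarrow> nat \<Rightarrow> nat set \<Rightarrow> complex" where
  "orbit_trace m d j S = root_sum (cpoly (diff_orb m d)) (\<lambda>c. c ^ j * (\<Prod>i\<in>S. poly (orb (m + i)) c))"

lemma diff_orb_cpoly_nz: "d \<ge> 1 \<Longrightarrow> cpoly (diff_orb m d) \<noteq> 0"
  using diff_orb_nonzero[of d m] by simp

lemma orbit_trace_balance:
  assumes m: "m \<ge> 1" and d: "d \<ge> 1" and S: "finite S" and N: "2 * j + card S + 1 < 2 ^ m"
  shows "root_sum (cpoly (misiu (Suc m) d)) (\<lambda>c. c ^ j * (\<Prod>i\<in>S. poly (orb (m + d + i)) c)) = orbit_trace m d j S"
proof -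
  define xs where "xs = sorted_list_of_set S"
  have xs: "set xs = S" "distinct xs" "length xs = card S" using S by (auto simp: xs_def)
  have "(\<Prod>i\<leftarrow>xs. f i) = (\<Prod>i\<in>S. f i)" for f :: "nat \<Rightarrow> complex"
    using prod.distinct_set_conv_list[OF xs(2), of f] xs(1) by simp
  thus ?thesis
    using root_sum_balance[OF m d, of j xs] N xs(3) by (simp add: orbit_trace_def cpoly_diff_orb)
qed

text \<open>Of the two factors of \<open>diff_orb (Suc m) d\<close>, one gives the trace at level
  \<open>m\<close> directly, the other by \<open>orbit_trace_balance\<close>.\<close>

lemma orbit_trace_Suc:
  assumes m: "m \<ge> 1" and d: "d \<ge> 1" and S: "finite S" and N: "2 * j + card S + 1 < 2 ^ m"
  shows "orbit_trace (Suc m) d j S = 2 * orbit_trace m d j (Suc ` S)"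
proof -
  have im: "(\<Prod>i\<in>Suc ` S. f i) = (\<Prod>i\<in>S. f (Suc i))" for f :: "nat \<Rightarrow> complex"
    by (subst prod.reindex) auto
  have "root_sum (cpoly (misiu (Suc m) d)) (\<lambda>c. c ^ j * (\<Prod>i\<in>S. poly (orb (Suc m + i)) c))
      = root_sum (cpoly (misiu (Suc m) d)) (\<lambda>c. c ^ j * (\<Prod>i\<in>Suc ` S. poly (orb (m + d + i)) c))"
  proof (rule root_sum_cong[OF misiu_cpoly_nz[OF d]])
    fix c assume root: "poly (cpoly (misiu (Suc m) d)) c = 0"
    have "poly (orb (m + d + Suc i)) c = poly (orb (Suc m + i)) c" for i
      using misiu_root_period[OF root, of "Suc m + i"] by (simp add: algebra_simps)
    thus "c ^ j * (\<Prod>i\<in>S. poly (orb (Suc m + i)) c) = c ^ j * (\<Prod>i\<in>Suc ` S. poly (orb (m + d + i)) c)"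
      unfolding im by simp
  qed
  also have "\<dots> = orbit_trace m d j (Suc ` S)"
    by (rule orbit_trace_balance[OF m d]) (use S N in \<open>simp_all add: card_image\<close>)
  finally show ?thesis
    unfolding orbit_trace_def root_sum_diff_orb_Suc[OF d] im by simp
qed

text \<open>Replacing \<open>a_m\<close> by \<open>- a_m\<close> exchanges \<open>a_(m+d) - a_m\<close> and \<open>a_(m+d) + a_m\<close> and changes the sign of the
  product, while a product of low degree has the same trace for both polynomials.\<close>

lemma orbit_trace_zero_base:
  assumes m: "m \<ge> 1" and d: "d \<ge> 1" and S: "S \<subseteq> {..<d - 1}" "0 \<in> S" and N: "2 * j + card S + 1 < 2 ^ m"
  shows "orbit_trace m d j S = 0"
proof -
  let ?A = "cpoly (misiu (Suc m) d)" and ?B = "cpoly (diff_orb m d)"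
  have fin: "finite S" using S(1) finite_subset by blast
  define h where "h = monom 1 j * (\<Prod>i\<in>S. orb (m + i))"
  have h: "poly h c = c ^ j * (\<Prod>i\<in>S. poly (orb (m + i)) c)" for c
    by (simp add: h_def poly_monom poly_prod)
  have "degree (\<Prod>i\<in>S. orb (m + i)) \<le> (\<Sum>i\<in>S. degree (orb (m + i)))"
    using degree_prod_sum_le[OF fin, of "\<lambda>i. orb (m + i)"] by (simp add: o_def)
  also have "\<dots> = (\<Sum>i\<in>S. 2 ^ (m - 1) * 2 ^ i)"
    using orb_degree[of "m + _"] m by (intro sum.cong) (auto simp flip: power_add)
  \<comment> \<open>Omitting the index d - 1 removes the factor of largest degree, which keeps
    \<open>h\<close> below \<open>gap m d\<close>, where both polynomials have the same power
    sums.\<close>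
  also have "\<dots> \<le> (\<Sum>i<d - 1. 2 ^ (m - 1) * 2 ^ i)" using S by (intro sum_mono2) auto
  also have "\<dots> = 2 ^ (m - 1) * (2 ^ (d - 1) - 1)"
    by (simp add: sum_distrib_left [symmetric] mask_eq_sum_exp_nat [symmetric] lessThan_def)
  finally have "degree (\<Prod>i\<in>S. orb (m + i)) \<le> 2 ^ (m - 1) * (2 ^ (d - 1) - 1)" .
  moreover have "degree h \<le> j + degree (\<Prod>i\<in>S. orb (m + i))"
    unfolding h_def using degree_mult_le[of "monom 1 j" "\<Prod>i\<in>S. orb (m + i)"] degree_monom_le[of "1::complex" j] by linarith
  moreover have "j + 2 ^ (m - 1) * (2 ^ (d - 1) - 1) < gap m d"
  proof -
    have "2 * j < 2 ^ m" using N by simp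
    hence j: "j < 2 ^ (m - 1)" using m by (cases m) auto
    have "2 ^ (m - 1) + 2 ^ (m - 1) * (2 ^ (d - 1) - 1) = 2 ^ (m - 1) * (2 :: nat) ^ (d - 1)"
      by (simp add: diff_mult_distrib2)
    also have "\<dots> \<le> gap m d"
    proof -
      have "(2::nat) ^ (d - 1) \<le> 2 ^ d - 1" using d by (cases d) (auto simp: Suc_leI)
      thus ?thesis unfolding gap_def by (rule mult_left_mono) simp
    qed
    finally show ?thesis using j by linarith
  qed
  ultimately have low: "degree h < gap m d" by linarith
  have "orbit_trace m d j S = root_sum ?A (\<lambda>c. c ^ j * (\<Prod>i\<in>S. poly (orb (m + d + i)) c))"
    by (rule orbit_trace_balance[OF m d fin N, symmetric])
  also have "\<dots> = root_sum ?A (\<lambda>c. - poly h c)"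
  proof (rule root_sum_cong[OF misiu_cpoly_nz[OF d]])
    fix c assume root: "poly ?A c = 0"
    have "poly (orb (m + d)) c = - poly (orb m) c" using root by (simp add: poly_misiu add_eq_0_iff)
    moreover have "(\<Prod>i\<in>S - {0}. poly (orb (m + d + i)) c) = (\<Prod>i\<in>S - {0}. poly (orb (m + i)) c)"
    proof (rule prod.cong[OF refl])
      fix i assume "i \<in> S - {0}"
      thus "poly (orb (m + d + i)) c = poly (orb (m + i)) c"
        using misiu_root_period[OF root, of "m + i"] by (simp add: algebra_simps)
    qed
    ultimately show "c ^ j * (\<Prod>i\<in>S. poly (orb (m + d + i)) c) = - poly h c"
      unfolding h by (simp add: prod.remove[OF fin S(2)])
  qed
  also have "\<dots> = - root_sum ?B (poly h)"
    unfolding root_sum_uminus root_sum_diff_low[OF m d low] ..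
  also have "root_sum ?B (poly h) = orbit_trace m d j S"
  proof -
    have "poly h = (\<lambda>c. c ^ j * (\<Prod>i\<in>S. poly (orb (m + i)) c))" by (rule ext) (rule h)
    thus ?thesis by (simp add: orbit_trace_def)
  qed
  finally show ?thesis by simp
qed

text \<open>Up to the factor 2^k, the set shifted by \<open>k\<close> at level \<open>m\<close> has
  the trace of the unshifted set at level m + k, where the preceding lemma applies.\<close>

lemma orbit_trace_zero_shift:
  assumes m: "m \<ge> 1" and d: "d \<ge> 1" and S: "S \<subseteq> {..<d - 1}" "0 \<in> S" and N: "2 * j + card S + 1 < 2 ^ m"
  shows "orbit_trace m d j ((+) k ` S) = 0"
proof -
  have fin: "finite S" using S(1) finite_subset by blast
  have "orbit_trace (m + l) d j ((+) k ` S) = 2 ^ l * orbit_trace m d j ((+) (k + l) ` S)" for k l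
  proof (induction l arbitrary: k)
    case (Suc l)
    have "(2::nat) ^ m \<le> 2 ^ (m + l)" by (intro power_increasing) auto
    moreover have "card ((+) k ` S) = card S" by (simp add: card_image)
    ultimately have N': "2 * j + card ((+) k ` S) + 1 < 2 ^ (m + l)" using N by linarith
    have "orbit_trace (m + Suc l) d j ((+) k ` S) = 2 * orbit_trace (m + l) d j (Suc ` (+) k ` S)"
      using orbit_trace_Suc[of "m + l" d "(+) k ` S" j] N' m d fin by simp
    also have "Suc ` (+) k ` S = (+) (Suc k) ` S" by (auto simp: image_image)
    finally show ?case unfolding Suc by simp
  qed (simp add: add.commute)
  from this[of k 0] this[of 0 k] have "2 ^ k * orbit_trace m d j ((+) k ` S) = orbit_trace (m + k) d j S" by simp
  also have "\<dots> = 0"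
  proof (rule orbit_trace_zero_base)
    have "(2::nat) ^ m \<le> 2 ^ (m + k)" by (intro power_increasing) auto
    thus "2 * j + card S + 1 < 2 ^ (m + k)" using N by linarith
  qed (use m d S in auto)
  finally show ?thesis by simp
qed

text \<open>A proper nonempty part of a cycle contains a point whose predecessor it misses. Counted
  from that point, the set contains 0 and omits d - 1, as \<open>orbit_trace_zero_shift\<close>
  wants.\<close>

lemma orbit_trace_zero:
  assumes m: "m \<ge> 1" and S: "S \<subseteq> {..<d}" "S \<noteq> {}" "S \<noteq> {..<d}" and N: "2 * j + card S + 1 < 2 ^ m"
  shows "orbit_trace m d j S = 0"
proof -
  obtain b where b: "b < d" "b \<notin> S" using S by blast
  obtain a where a: "a \<in> S" "a < d" using S by blast
  have d: "d \<ge> 1" using a by simp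
  \<comment> \<open>Steps of d - 1 walk backwards modulo \<open>d\<close>. \<open>K\<close> is the
    first step that leaves \<open>S\<close>, and the point before it is the new origin
    \<open>i0\<close>.\<close>
  define K where "K = (LEAST k. (a + (d - 1) * k) mod d \<notin> S)"
  have "(a + (d - 1) * (a + (d - b))) mod d = b"
  proof -
    have "a + (d - 1) * (a + (d - b)) + (d - b) = d * (a + (d - b))"
      using d by (cases d) auto
    hence "a + (d - 1) * (a + (d - b)) + d = d * (a + (d - b)) + b" using b by linarith
    hence "(a + (d - 1) * (a + (d - b)) + d) mod d = (d * (a + (d - b)) + b) mod d" by (rule arg_cong)
    thus ?thesis using b by simp
  qed
  hence "(a + (d - 1) * (a + (d - b))) mod d \<notin> S" using b by simp
  hence K: "(a + (d - 1) * K) mod d \<notin> S" unfolding K_def by (rule LeastI)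
  have "K \<noteq> 0" using K a by (metis add.right_neutral mod_less mult_0_right)
  then obtain k where k: "K = Suc k" by (cases K) auto
  define i0 where "i0 = (a + (d - 1) * k) mod d"
  have i0S: "i0 \<in> S" using not_less_Least[of k "\<lambda>k. (a + (d - 1) * k) mod d \<notin> S"] k by (auto simp: i0_def K_def)
  have i0d: "i0 < d" using d by (simp add: i0_def)
  have pred: "(i0 + (d - 1)) mod d \<notin> S"
  proof -
    have "a + (d - 1) * k + (d - 1) = a + (d - 1) * Suc k" by (simp only: mult_Suc_right add.assoc add.commute add.left_commute)
    thus ?thesis using K by (simp only: k i0_def mod_add_left_eq not_False_eq_True)
  qed
  define T where "T = {t. t < d \<and> (i0 + t) mod d \<in> S}"
  have T: "T \<subseteq> {..<d - 1}" "0 \<in> T"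
  proof -
    have "d - 1 \<notin> T" using pred by (simp add: T_def)
    thus "T \<subseteq> {..<d - 1}" 
    proof (intro subsetI)
      fix t assume "t \<in> T"
      moreover from this \<open>d - 1 \<notin> T\<close> have "t \<noteq> d - 1" by auto
      ultimately have "t < d" "t \<noteq> d - 1" by (auto simp: T_def)
      hence "t < d - 1" by linarith
      thus "t \<in> {..<d - 1}" by simp
    qed
    show "0 \<in> T" using i0S i0d d by (simp add: T_def)
  qed
  have bij: "bij_betw (\<lambda>t. (i0 + t) mod d) T S"
  proof (rule bij_betwI[where g = "\<lambda>i. (i + (d - i0)) mod d"])
    show "(\<lambda>t. (i0 + t) mod d) \<in> T \<rightarrow> S" by (auto simp: T_def)
    have inv: "(i0 + (i + (d - i0)) mod d) mod d = i" if "i < d" for i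
    proof -
      have "(i0 + (i + (d - i0)) mod d) mod d = (i0 + (i + (d - i0))) mod d" by (simp add: mod_simps)
      also have "i0 + (i + (d - i0)) = i + d" using i0d by simp
      finally show ?thesis using that by simp
    qed
    show "(\<lambda>i. (i + (d - i0)) mod d) \<in> S \<rightarrow> T" using inv S(1) d by (auto simp: T_def)
    show "((i0 + t) mod d + (d - i0)) mod d = t" if "t \<in> T" for t
    proof -
      have "((i0 + t) mod d + (d - i0)) mod d = ((i0 + t) + (d - i0)) mod d" by (simp only: mod_simps)
      also have "(i0 + t) + (d - i0) = t + d" using i0d by simp
      finally show ?thesis using that by (simp add: T_def)
    qed
    show "(i0 + (i + (d - i0)) mod d) mod d = i" if "i \<in> S" for i using inv[of i] that S(1) by auto
  qed
  have "orbit_trace m d j S = orbit_trace m d j ((+) i0 ` T)"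
    unfolding orbit_trace_def
  proof (rule root_sum_cong[OF diff_orb_cpoly_nz[OF d]])
    fix c assume root: "poly (cpoly (diff_orb m d)) c = 0"
    have per: "poly (orb (m + u)) c = poly (orb (m + u mod d)) c" for u
    proof -
      have "poly (orb (m + r + q * d)) c = poly (orb (m + r)) c" for q r
      proof (induction q)
        case (Suc q)
        thus ?case using diff_orb_root_period[OF root, of "m + r + q * d"] by (simp add: algebra_simps)
      qed simp
      from this[of "u mod d" "u div d"] show ?thesis by (simp add: add.assoc)
    qed
    have "(\<Prod>i\<in>(+) i0 ` T. poly (orb (m + i)) c) = (\<Prod>t\<in>T. poly (orb (m + (i0 + t))) c)"
      by (subst prod.reindex) auto
    also have "\<dots> = (\<Prod>t\<in>T. poly (orb (m + (i0 + t) mod d)) c)" by (subst per) simp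
    also have "\<dots> = (\<Prod>i\<in>S. poly (orb (m + i)) c)"
      by (rule prod.reindex_bij_betw[OF bij, of "\<lambda>i. poly (orb (m + i)) c"])
    finally show "c ^ j * (\<Prod>i\<in>S. poly (orb (m + i)) c) = c ^ j * (\<Prod>i\<in>(+) i0 ` T. poly (orb (m + i)) c)" by simp
  qed
  also have "\<dots> = 0"
    by (rule orbit_trace_zero_shift[OF m d T]) (use N bij_betw_same_card[OF bij] in simp)
  finally show ?thesis .
qed

lemma psum_add_low:
  fixes p q :: "complex poly"
  assumes p: "lead_coeff p = 1" and q: "degree q < degree p" and i: "i < degree p - degree q"
  shows "psum (p + q) i = psum p i"
proof (cases "i = 0")
  case True
  thus ?thesis using degree_add_eq_left[OF q] by (simp add: psum_0)
next
  case False
  show ?thesis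
  proof (rule power_sum_cong[of i])
    fix l assume "l \<le> i"
    hence "coeff (monom 1 (degree p - degree q) * reflect_poly q) l = 0"
      using i by (simp add: coeff_monom_mult)
    thus "coeff (rev_prod (proots (p + q))) l = coeff (rev_prod (proots p)) l"
      using rev_prod_proots[OF conjunct2[OF monic_add_lower[OF p q]]] rev_prod_proots[OF p]
      by (simp only: reflect_poly_add[OF q] coeff_add add_0_right)
  qed (use False in auto)
qed

lemma orbit_trace_full:
  assumes m: "m \<ge> 1" and d: "d \<ge> 1" and j: "2 * j + d + 1 < 2 ^ m"
  shows "orbit_trace m d j {..<d} = (2 ^ d - 1) * psum (orb m) j"
proof -
  have "orbit_trace m d j {..<d} = root_sum (cpoly (misiu (Suc m) d)) (\<lambda>c. c ^ j * (\<Prod>i<d. poly (orb (m + d + i)) c))"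
    by (rule orbit_trace_balance[OF m d, symmetric]) (use j in auto)
  also have "\<dots> = root_sum (cpoly (misiu (Suc m) d)) (\<lambda>c. c ^ j * poly (cpoly (theta (Suc m) d)) c)"
  proof (rule root_sum_cong[OF misiu_cpoly_nz[OF d]])
    fix c assume root: "poly (cpoly (misiu (Suc m) d)) c = 0"
    have "(\<Prod>i<d. poly (orb (m + d + i)) c) = (\<Prod>i<d. poly (orb (Suc m + i)) c)"
      by (rule prod_window_periodic[where d = d]) (use misiu_root_period[OF root] d in auto)
    thus "c ^ j * (\<Prod>i<d. poly (orb (m + d + i)) c) = c ^ j * poly (cpoly (theta (Suc m) d)) c"
      by (simp add: poly_theta)
  qed
  also have "\<dots> = (2 ^ d - 1) * psum (orb m) j" by (rule trace_pow_theta[OF m d j])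
  finally show ?thesis .
qed

lemma orbit_trace_empty:
  assumes m: "m \<ge> 1" and d: "d \<ge> 1" and j: "j < 2 ^ (m - 1)"
  shows "orbit_trace m d j {} = 2 ^ d * psum (orb m) j"
proof -
  have o: "degree (orb (m + d)) = 2 ^ (m + d - 1)" "lead_coeff (orb (m + d)) = 1" "degree (- orb m) = 2 ^ (m - 1)"
    using orb_degree[of "m + d"] orb_degree[OF m] m by auto
  have g: "degree (orb (m + d)) - degree (- orb m) = gap m d" "degree (- orb m) < degree (orb (m + d))"
    using gap_pos[OF d, of m] j unfolding o gap_eq[OF m] by auto
  have "orbit_trace m d j {} = psum (orb (m + d) + (- orb m)) j"
    by (simp add: orbit_trace_def root_sum_pow cpoly_diff_orb)
  also have "\<dots> = psum (orb (m + d)) j"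
    by (rule psum_add_low[OF o(2) g(2)]) (use g(1) gap_pos[OF d, of m] j in linarith)
  also have "\<dots> = 2 ^ d * psum (orb m) j"
  proof (rule psum_orb_add[OF m])
    have "(2::nat) ^ m = 2 * 2 ^ (m - 1)" using m by (cases m) auto
    thus "j < 2 ^ m - 1" using j by linarith
  qed
  finally show ?thesis .
qed

subsection \<open>Small cases\<close>

abbreviation misiu_trace :: "nat \<Rightarrow> nat \<Rightarrow> nat \<Rightarrow> complex" where
  "misiu_trace m d n \<equiv> root_sum (cpoly (misiu m d)) (poly (cpoly (theta m n)))"

lemma misiu_trace_diff:
  assumes "m \<ge> 1" "d \<ge> 1" "d dvd n" "n + 1 < 2 ^ m"
  shows "misiu_trace (Suc m) d n = root_sum (cpoly (diff_orb m d)) (poly (cpoly (theta m n)))"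
  using misiu_trace_eq[of m d n 1] assms by simp

lemma poly_theta_mult:
  assumes "\<And>j. j \<ge> m \<Longrightarrow> poly (orb (j + d)) c = poly (orb j) c"
  shows "poly (cpoly (theta m (d * e))) c = poly (cpoly (theta m d)) c ^ e"
proof (induction e)
  case (Suc e)
  have per: "poly (orb (m + d * e + i)) c = poly (orb (m + i)) c" for i
  proof (induction e)
    case (Suc e)
    thus ?case using assms[of "m + d * e + i"] by (simp add: algebra_simps)
  qed simp
  have "{..<d * Suc e} = {..<d * e} \<union> (+) (d * e) ` {..<d}"
  proof (intro equalityI subsetI)
    fix x assume x: "x \<in> {..<d * Suc e}"
    show "x \<in> {..<d * e} \<union> (+) (d * e) ` {..<d}"
    proof (cases "x < d * e")
      case False
      have "x < d + d * e" using x by simp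
      hence "x = d * e + (x - d * e)" "x - d * e \<in> {..<d}" using False by auto
      thus ?thesis by blast
    qed auto
  qed auto
  hence "poly (cpoly (theta m (d * Suc e))) c
      = (\<Prod>i\<in>{..<d * e} \<union> (+) (d * e) ` {..<d}. poly (orb (m + i)) c)"
    unfolding poly_theta by simp
  also have "\<dots> = poly (cpoly (theta m (d * e))) c * (\<Prod>i\<in>(+) (d * e) ` {..<d}. poly (orb (m + i)) c)"
    unfolding poly_theta by (rule prod.union_disjoint) auto
  also have "(\<Prod>i\<in>(+) (d * e) ` {..<d}. poly (orb (m + i)) c) = poly (cpoly (theta m d)) c"
    unfolding poly_theta by (subst prod.reindex) (auto simp: per add.assoc [symmetric])
  finally show ?case using Suc by (simp add: mult.commute)
qed (simp add: theta_def)

lemma newton_recursion: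
  "power_sum A (Suc k) = - of_nat (Suc k) * coeff (rev_prod A) (Suc k)
     - (\<Sum>i<k. coeff (rev_prod A) (Suc i) * power_sum A (k - i))"
proof -
  have "(\<Sum>i\<le>k. coeff (rev_prod A) i * power_sum A (Suc (k - i)))
      = power_sum A (Suc k) + (\<Sum>i<k. coeff (rev_prod A) (Suc i) * power_sum A (k - i))"
    unfolding sum.atMost_shift by (simp add: Suc_diff_Suc)
  thus ?thesis using newton_identity[of k A] by (simp add: algebra_simps eq_neg_iff_add_eq_0)
qed

text \<open>The second power sum is e_1^2 - 2 e_2, and both symmetric functions are even.\<close>

lemma misiu_trace_double_mod_4:
  assumes m: "m \<ge> 1" and d: "d \<ge> 1"
  obtains i :: int where "misiu_trace (Suc m) d (d * 2) = of_int (4 * i)"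
proof -
  let ?A = "misiu (Suc m) d"
  have A: "lead_coeff ?A = 1" by (rule conjunct2[OF misiu_degree]) (use d in auto)
  obtain S where S: "cpoly S = rev_prod (image_mset (poly (cpoly (theta (Suc m) d))) (proots (cpoly ?A)))"
    using rev_norm_exists[OF A] by blast
  define B where "B = image_mset (poly (cpoly (theta (Suc m) d))) (proots (cpoly ?A))"
  have ev: "even (coeff S k)" if "k \<ge> 1" for k
    by (rule rev_prod_theta_even[OF _ d A _ S that]) auto
  have c: "coeff (rev_prod B) k = of_int (coeff S k)" for k
    using S by (metis B_def of_int_hom.coeff_map_poly_hom)
  have "misiu_trace (Suc m) d (d * 2) = power_sum B 2"
  proof -
    have "misiu_trace (Suc m) d (d * 2) = root_sum (cpoly ?A) (\<lambda>c. poly (cpoly (theta (Suc m) d)) c ^ 2)"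
      by (rule root_sum_cong[OF misiu_cpoly_nz[OF d]]) (rule poly_theta_mult, rule misiu_root_period)
    thus ?thesis by (simp add: power_sum_def B_def root_sum_def multiset.map_comp o_def)
  qed
  also have "\<dots> = of_int (coeff S 1 ^ 2 - 2 * coeff S 2)"
  proof -
    have "power_sum B (Suc 0) = - of_int (coeff S (Suc 0))"
      using newton_recursion[of B 0] by (simp add: c)
    hence "power_sum B (Suc (Suc 0)) = of_int (coeff S 1 ^ 2 - 2 * coeff S 2)"
      using newton_recursion[of B "Suc 0"] by (simp add: c numeral_2_eq_2)
    thus ?thesis by (simp add: numeral_2_eq_2)
  qed
  also obtain u v where "coeff S 1 = 2 * u" "coeff S 2 = 2 * v" using ev[of 1] ev[of 2] by (auto elim!: evenE)
  hence "coeff S 1 ^ 2 - 2 * coeff S 2 = 4 * (u ^ 2 - v)" by (simp add: power2_eq_square)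
  finally show ?thesis by (rule that)
qed

text \<open>On a cycle \<open>z_0, ..., z_(d-1)\<close> the square of the product is the product of all \<open>z_i - c\<close>; after expansion
  only the empty and the full product have a nonzero trace.\<close>

lemma misiu_trace_square:
  assumes m: "m \<ge> 1" and d: "d \<ge> 1" and N: "2 * d + 1 < 2 ^ m"
  shows "misiu_trace (Suc m) d (d * 2) = (2 ^ d - 1) * 2 ^ (m - 1) + (-2) ^ d * psum (orb m) d"
proof -
  let ?B = "cpoly (diff_orb m d)"
  have "2 * d < 2 ^ m" using N by simp
  hence d': "d < 2 ^ (m - 1)" using m by (cases m) auto
  have "misiu_trace (Suc m) d (d * 2) = root_sum ?B (poly (cpoly (theta m (d * 2))))"
    by (rule misiu_trace_diff[OF m d]) (use N in auto)
  also have "\<dots> = root_sum ?B (\<lambda>c. \<Sum>S\<in>Pow {..<d}. (-1) ^ (d - card S) * (c ^ (d - card S) * (\<Prod>i\<in>S. poly (orb (m + i)) c)))"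
  proof (rule root_sum_cong[OF diff_orb_cpoly_nz[OF d]])
    fix c assume root: "poly ?B c = 0"
    have "poly (cpoly (theta m (d * 2))) c = poly (cpoly (theta m d)) c ^ 2"
      by (rule poly_theta_mult) (rule diff_orb_root_period[OF root])
    also have "\<dots> = (\<Prod>i<d. poly (orb (Suc m + i)) c + - c)"
      unfolding poly_theta prod_power_distrib by (simp add: poly_orb_Suc)
    also have "\<dots> = (\<Prod>i<d. poly (orb (m + i)) c + - c)"
      by (rule prod_window_periodic[of m "\<lambda>j. poly (orb j) c + - c" d])
        (use diff_orb_root_period[OF root] in auto)
    also have "\<dots> = (\<Sum>S\<in>Pow {..<d}. (\<Prod>i\<in>S. poly (orb (m + i)) c) * (\<Prod>i\<in>{..<d} - S. - c))"
      by (rule prod_add) simp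
    also have "\<dots> = (\<Sum>S\<in>Pow {..<d}. (-1) ^ (d - card S) * (c ^ (d - card S) * (\<Prod>i\<in>S. poly (orb (m + i)) c)))"
    proof (rule sum.cong[OF refl])
      fix S assume "S \<in> Pow {..<d}"
      hence "card ({..<d} - S) = d - card S" by (subst card_Diff_subset) (auto intro: finite_subset)
      thus "(\<Prod>i\<in>S. poly (orb (m + i)) c) * (\<Prod>i\<in>{..<d} - S. - c)
          = (-1) ^ (d - card S) * (c ^ (d - card S) * (\<Prod>i\<in>S. poly (orb (m + i)) c))"
        by (simp add: power_minus[of c] mult_ac)
    qed
    finally show "poly (cpoly (theta m (d * 2))) c
        = (\<Sum>S\<in>Pow {..<d}. (-1) ^ (d - card S) * (c ^ (d - card S) * (\<Prod>i\<in>S. poly (orb (m + i)) c)))" .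
  qed
  also have "\<dots> = (\<Sum>S\<in>Pow {..<d}. (-1) ^ (d - card S) * orbit_trace m d (d - card S) S)"
    unfolding root_sum_sum root_sum_scale orbit_trace_def ..
  also have "\<dots> = (\<Sum>S\<in>{{}, {..<d}}. (-1) ^ (d - card S) * orbit_trace m d (d - card S) S)"
  proof (rule sum.mono_neutral_right)
    show "\<forall>S\<in>Pow {..<d} - {{}, {..<d}}. (-1) ^ (d - card S) * orbit_trace m d (d - card S) S = 0"
    proof
      fix S assume S: "S \<in> Pow {..<d} - {{}, {..<d}}"
      have "card S \<le> d" using S card_mono[of "{..<d}" S] by simp
      hence "2 * (d - card S) + card S + 1 < 2 ^ m" using N by linarith
      thus "(-1) ^ (d - card S) * orbit_trace m d (d - card S) S = 0"
        using S by (subst orbit_trace_zero[OF m]) auto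
    qed
  qed auto
  also have "\<dots> = (-1) ^ d * orbit_trace m d d {} + orbit_trace m d 0 {..<d}"
  proof -
    have "0 \<in> {..<d}" using d by simp
    hence "{..<d} \<noteq> {}" by blast
    thus ?thesis by (subst sum.insert) auto
  qed
  also have "orbit_trace m d d {} = 2 ^ d * psum (orb m) d" by (rule orbit_trace_empty[OF m d d'])
  also have "orbit_trace m d 0 {..<d} = (2 ^ d - 1) * 2 ^ (m - 1)"
    using orbit_trace_full[OF m d, of 0] N orb_degree[OF m] by (simp add: psum_0)
  also have "(-1) ^ d * (2 ^ d * psum (orb m) d) = (-2) ^ d * psum (orb m) d"
    by (simp flip: power_mult_distrib mult.assoc)
  finally show ?thesis by simp
qed

text \<open>Level 3 suffices as a table: for exponents below 2^3 - 1 = 7 the sums only double at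
  each further level.\<close>

lemma psum_orb_3:
  "psum (orb 3) 0 = 4" "psum (orb 3) 1 = -2" "psum (orb 3) 2 = 2" "psum (orb 3) 3 = -5"
  "psum (orb 3) 4 = 10" "psum (orb 3) 5 = -17"
proof -
  define p where "p = psum (orb 3)"
  have orb3: "orb 3 = [:0, 1, 1, 2, 1:]"
    by (simp add: numeral_3_eq_3 orb_Suc power2_eq_square)
  have "rev_prod (proots (orb 3)) = [:1, 2, 1, 1:]"
    using rev_prod_orb[of 3] unfolding orb3 by (simp add: reflect_poly_def)
  note newt = newton_recursion[of "proots (orb 3)", unfolded this, folded p_def]
  show "psum (orb 3) 0 = 4" unfolding psum_0 orb3 by simp
  have p1: "p (Suc 0) = -2" unfolding newt by simp
  have p2: "p (Suc (Suc 0)) = 2" unfolding newt by (simp add: p1)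
  have p3: "p (Suc (Suc (Suc 0))) = -5" unfolding newt by (simp add: p1 p2)
  have p4: "p (Suc (Suc (Suc (Suc 0)))) = 10" unfolding newt by (simp add: p1 p2 p3)
  have p5: "p (Suc (Suc (Suc (Suc (Suc 0))))) = -17" unfolding newt by (simp add: p1 p2 p3 p4)
  show "psum (orb 3) 1 = -2" "psum (orb 3) 2 = 2" "psum (orb 3) 3 = -5"
    "psum (orb 3) 4 = 10" "psum (orb 3) 5 = -17"
    using p1 p2 p3 p4 p5 by (simp_all add: p_def numeral_eq_Suc)
qed

text \<open>At a root of a_(m+1) - a_m the cycle is a fixed point z = a_m, and z^2 = z - c reduces
  z^l to u(c) z + w(c). The trace of c^j z is \<open>psum (orb m) j\<close> and that of c^j is twice
  as much, hence u + 2 w. The coefficient lists in the applications are those of the reduced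
  powers.\<close>

lemma fixed_point_trace:
  fixes u w :: "nat \<Rightarrow> complex"
  assumes m: "m \<ge> 1" and J: "2 * J < 2 ^ m" and l: "l + 1 < 2 ^ m"
    and eq: "\<And>c z. z ^ 2 = z - c \<Longrightarrow> z ^ l = (\<Sum>j<J. u j * c ^ j) * z + (\<Sum>j<J. w j * c ^ j)"
  shows "misiu_trace (Suc m) 1 l = (\<Sum>j<J. (u j + 2 * w j) * psum (orb m) j)"
proof -
  let ?B = "cpoly (diff_orb m 1)"
  have "misiu_trace (Suc m) 1 l = root_sum ?B (poly (cpoly (theta m l)))"
    by (rule misiu_trace_diff[OF m]) (use l in auto)
  also have "\<dots> = root_sum ?B (\<lambda>c. (\<Sum>j<J. u j * (c ^ j * (\<Prod>i<1. poly (orb (m + i)) c)))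
      + (\<Sum>j<J. w j * (c ^ j * (\<Prod>i\<in>{}. poly (orb (m + i)) c))))"
  proof (rule root_sum_cong[OF diff_orb_cpoly_nz])
    fix c assume root: "poly ?B c = 0"
    define z where "z = poly (orb m) c"
    have "poly (orb m) c ^ 2 + c = poly (orb m) c"
      using diff_orb_root_period[OF root, of m] by (simp add: poly_orb_Suc)
    hence "z ^ 2 = z - c" by (simp add: z_def eq_diff_eq)
    moreover have "poly (cpoly (theta m l)) c = z ^ l"
      using poly_theta_mult[of m 1 c l] diff_orb_root_period[OF root] by (simp add: poly_theta z_def)
    ultimately show "poly (cpoly (theta m l)) c = (\<Sum>j<J. u j * (c ^ j * (\<Prod>i<1. poly (orb (m + i)) c)))
      + (\<Sum>j<J. w j * (c ^ j * (\<Prod>i\<in>{}. poly (orb (m + i)) c)))"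
      using eq[of z c] by (simp add: z_def sum_distrib_right mult.assoc)
  qed simp
  also have "\<dots> = (\<Sum>j<J. u j * orbit_trace m 1 j {..<1}) + (\<Sum>j<J. w j * orbit_trace m 1 j {})"
    by (simp only: root_sum_add root_sum_sum root_sum_scale orbit_trace_def)
  also have "\<dots> = (\<Sum>j<J. u j * psum (orb m) j) + (\<Sum>j<J. w j * (2 * psum (orb m) j))"
  proof (intro arg_cong2[where f = "(+)"] sum.cong refl arg_cong2[where f = "(*)"])
    fix j assume j: "j \<in> {..<J}"
    have N: "2 * j + 1 + 1 < 2 ^ m" by (rule le_less_trans[OF _ J]) (use j in auto)
    show "orbit_trace m 1 j {..<1} = psum (orb m) j" using orbit_trace_full[OF m _ N] by simp
    have "2 * j < 2 * 2 ^ (m - 1)" using N m by (cases m) auto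
    thus "orbit_trace m 1 j {} = 2 * psum (orb m) j" using orbit_trace_empty[OF m, of 1 j] by simp
  qed
  finally show ?thesis by (simp add: sum.distrib algebra_simps)
qed

lemma psum_orb_4:
  "psum (orb 4) 0 = 8" "psum (orb 4) 1 = -4" "psum (orb 4) 2 = 4" "psum (orb 4) 3 = -10"
  "psum (orb 4) 4 = 20" "psum (orb 4) 5 = -34"
  using psum_orb_add[of 3 _ 1] psum_orb_3 by (simp_all)

lemma psum_orb_5:
  "psum (orb 5) 0 = 16" "psum (orb 5) 1 = -8" "psum (orb 5) 2 = 8" "psum (orb 5) 3 = -20"
  "psum (orb 5) 4 = 40" "psum (orb 5) 5 = -68"
  using psum_orb_add[of 3 _ 2] psum_orb_3 by (simp_all)

lemma misiu_trace_4_1_3: "misiu_trace 4 1 3 = 10"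
proof -
  have "misiu_trace (Suc 3) 1 3 = (\<Sum>j<2. ([1, -1] ! j + 2 * [0, -1] ! j) * psum (orb 3) j)"
  proof (rule fixed_point_trace)
    fix c z :: complex assume "z ^ 2 = z - c"
    hence c: "c = z - z ^ 2" by simp
    have "z ^ 3 = (1 - c) * z - c" unfolding c by (simp add: algebra_simps eval_nat_numeral)
    thus "z ^ 3 = (\<Sum>j<2. [1, -1] ! j * c ^ j) * z + (\<Sum>j<2. [0, -1] ! j * c ^ j)"
      by (simp add: numeral_eq_Suc)
  qed auto
  thus ?thesis using psum_orb_3 by (simp add: numeral_eq_Suc)
qed

lemma misiu_trace_4_1_5: "misiu_trace 4 1 5 = 24"
proof -
  have "misiu_trace (Suc 3) 1 5 = (\<Sum>j<3. ([1, -3, 1] ! j + 2 * [0, -1, 2] ! j) * psum (orb 3) j)"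
  proof (rule fixed_point_trace)
    fix c z :: complex assume "z ^ 2 = z - c"
    hence c: "c = z - z ^ 2" by simp
    have "z ^ 5 = (1 - 3 * c + c ^ 2) * z - c + 2 * c ^ 2"
      unfolding c by (simp add: algebra_simps eval_nat_numeral)
    thus "z ^ 5 = (\<Sum>j<3. [1, -3, 1] ! j * c ^ j) * z + (\<Sum>j<3. [0, -1, 2] ! j * c ^ j)"
      by (simp add: numeral_eq_Suc)
  qed auto
  thus ?thesis using psum_orb_3 by (simp add: numeral_eq_Suc)
qed

lemma misiu_trace_5_1_7: "misiu_trace 5 1 7 = 162"
proof -
  have "misiu_trace (Suc 4) 1 7 = (\<Sum>j<4. ([1, -5, 6, -1] ! j + 2 * [0, -1, 4, -3] ! j) * psum (orb 4) j)"
  proof (rule fixed_point_trace)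
    fix c z :: complex assume "z ^ 2 = z - c"
    hence c: "c = z - z ^ 2" by simp
    have "z ^ 7 = (1 - 5 * c + 6 * c ^ 2 - c ^ 3) * z - c + 4 * c ^ 2 - 3 * c ^ 3"
      unfolding c by (simp add: algebra_simps eval_nat_numeral)
    thus "z ^ 7 = (\<Sum>j<4. [1, -5, 6, -1] ! j * c ^ j) * z + (\<Sum>j<4. [0, -1, 4, -3] ! j * c ^ j)"
      by (simp add: numeral_eq_Suc)
  qed auto
  thus ?thesis using psum_orb_4 by (simp add: numeral_eq_Suc)
qed

text \<open>The condition l + 1 < 2^m of \<open>fixed_point_trace\<close> fails here, since it reads
  4 < 4. Instead the fixed point is eliminated directly: a_3 = - a_2 gives z = -(c^2 + c) at the
  roots.\<close>

lemma misiu_trace_3_1_3: "misiu_trace 3 1 3 = 2"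
proof -
  let ?A = "cpoly (misiu 3 1)"
  have A: "?A = [:0, 2, 2, 2, 1:]"
    by (simp add: misiu_def of_int_poly_hom.hom_add numeral_3_eq_3 orb_Suc power2_eq_square)
  have rev: "rev_prod (proots ?A) = [:1, 2, 2, 2:]"
    using rev_prod_proots[of ?A] unfolding A by (simp add: reflect_poly_def)
  define p where "p = psum ?A"
  note newt = newton_recursion[of "proots ?A", unfolded rev, folded p_def]
  have p1: "p (Suc 0) = -2" unfolding newt by simp
  have p2: "p (Suc (Suc 0)) = 0" unfolding newt by (simp add: p1)
  have p3: "p (Suc (Suc (Suc 0))) = -2" unfolding newt by (simp add: p1 p2)
  have "misiu_trace 3 1 3 = root_sum ?A
      (\<lambda>c. poly (cpoly (theta 3 1)) c + (- 1 * c ^ 1 + (c ^ 2 + c ^ 3)))"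
  proof (rule root_sum_cong)
    fix c assume root: "poly ?A c = 0"
    define z where "z = poly (orb 3) c"
    have per: "poly (orb (j + 1)) c = poly (orb j) c" if "j \<ge> 3" for j
      by (rule misiu_root_period[of 2 1]) (use root that in \<open>simp_all add: numeral_eq_Suc\<close>)
    have "z ^ 2 + c = z" using per[of 3] by (simp add: z_def poly_orb_Suc numeral_eq_Suc)
    hence z2: "z ^ 2 = z - c" by (simp add: eq_diff_eq)
    have "poly (orb 2) c = c ^ 2 + c" by (simp add: numeral_2_eq_2 poly_orb_Suc)
    hence z: "z = - (c ^ 2 + c)"
      using root poly_misiu[of 3 1 c] by (simp add: z_def add_eq_0_iff2 eq_neg_iff_add_eq_0)
    have cz: "c * z = - (c ^ 3 + c ^ 2)"
      unfolding z by (simp add: algebra_simps power2_eq_square power3_eq_cube)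
    have "z ^ 3 = z * z ^ 2" by (simp add: power2_eq_square power3_eq_cube)
    also have "\<dots> = z ^ 2 - c * z" by (subst z2) (simp add: algebra_simps power2_eq_square)
    finally have "z ^ 3 = z + (- c + (c ^ 2 + c ^ 3))" unfolding z2 cz by simp
    moreover have "poly (cpoly (theta 3 3)) c = z ^ 3"
      using poly_theta_mult[of 3 1 c 3] per by (simp add: poly_theta z_def)
    ultimately show "poly (cpoly (theta 3 3)) c
        = poly (cpoly (theta 3 1)) c + (- 1 * c ^ 1 + (c ^ 2 + c ^ 3))"
      by (simp add: poly_theta z_def)
  qed (use A in simp)
  also have "\<dots> = misiu_trace 3 1 1 + (- 1 * p 1 + (p 2 + p 3))"
    by (simp only: root_sum_add root_sum_scale root_sum_pow p_def)
  also have "misiu_trace 3 1 1 = 2" using trace_theta[of 2 1] by (simp add: numeral_eq_Suc)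
  also have "- 1 * p 1 + (p 2 + p 3) = 0"
    using p1 p2 p3 by (simp add: numeral_eq_Suc)
  finally show ?thesis by simp
qed

text \<open>On a 3-cycle \<open>z_0, z_1, z_2\<close> the power \<open>(z_0 z_1 z_2)^3\<close> reduces to a combination of products of
  distinct points; only the empty and the full product have a nonzero trace.\<close>

lemma three_cycle_cube:
  fixes c x y z :: "'a::comm_ring_1"
  assumes "x ^ 2 = y - c" "y ^ 2 = z - c" "z ^ 2 = x - c"
  shows "(x * y * z) ^ 3 = x * y * z - c ^ 3 * (x * y * z) - 7 * c ^ 3
    + (4 * c ^ 2 - 2 * c ^ 3) * (x + y + z) + (c ^ 2 - 2 * c - c ^ 3) * (y * z + x * z + x * y)"
proof -
  \<comment> \<open>The products t^2, t e1 and t e2 are combinations of 1, t, e1 and e2 with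
    coefficients in c, so t^3 = t t^2 is one as well.\<close>
  define t e1 e2 where "t = x * y * z" and "e1 = x + y + z" and "e2 = y * z + x * z + x * y"
  have "t ^ 2 = x ^ 2 * y ^ 2 * z ^ 2" by (simp add: t_def power_mult_distrib)
  also have "\<dots> = t - c * e2 + c ^ 2 * e1 - c ^ 3"
    unfolding assms t_def e1_def e2_def by (simp add: algebra_simps power2_eq_square power3_eq_cube)
  finally have t2: "t ^ 2 = t - c * e2 + c ^ 2 * e1 - c ^ 3" .
  have step: "u ^ 2 * (v * w) = w ^ 2 - c * w - c * (v * w)" if "u ^ 2 = v - c" "v ^ 2 = w - c" for u v w
  proof -
    have "u ^ 2 * (v * w) = v ^ 2 * w - c * (v * w)"
      unfolding that(1) by (simp add: algebra_simps power2_eq_square)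
    also have "v ^ 2 * w = w ^ 2 - c * w"
      unfolding that(2) by (simp add: algebra_simps power2_eq_square)
    finally show ?thesis .
  qed
  have step2: "u ^ 2 * v ^ 2 * w = v * u - c * v - c * (v * w) - c * u + c ^ 2 + c ^ 2 * w"
    if "u ^ 2 = v - c" "v ^ 2 = w - c" "w ^ 2 = u - c" for u v w
  proof -
    have "u ^ 2 * v ^ 2 * w = v * w ^ 2 - c * (v * w) - c * w ^ 2 + c ^ 2 * w"
      unfolding that(1,2) by (simp add: algebra_simps power2_eq_square)
    also have "v * w ^ 2 = v * u - c * v"
      unfolding that(3) by (simp add: algebra_simps)
    also have "c * w ^ 2 = c * u - c ^ 2"
      unfolding that(3) by (simp add: algebra_simps power2_eq_square)
    finally show ?thesis by simp
  qed
  have "t * e1 = x ^ 2 * (y * z) + y ^ 2 * (z * x) + z ^ 2 * (x * y)"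
    by (simp add: t_def e1_def algebra_simps power2_eq_square)
  also have "\<dots> = x ^ 2 + y ^ 2 + z ^ 2 - c * e1 - c * e2"
    unfolding step[OF assms(1,2)] step[OF assms(2,3)] step[OF assms(3,1)] e1_def e2_def
    by (simp add: algebra_simps)
  finally have te1: "t * e1 = e1 - 3 * c - c * e1 - c * e2"
    unfolding assms by (simp add: e1_def)
  have te2: "t * e2 = e2 - c * e1 - c * (e1 - 3 * c) - c * e2 + c ^ 2 * e1"
  proof -
    have "t * e2 = x ^ 2 * y ^ 2 * z + y ^ 2 * z ^ 2 * x + z ^ 2 * x ^ 2 * y"
      by (simp add: t_def e2_def algebra_simps power2_eq_square)
    also have "\<dots> = y * x + z * y + x * z - 2 * c * e1 - c * e2 + c ^ 2 * e1 + 3 * c ^ 2"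
      unfolding step2[OF assms] step2[OF assms(2,3,1)] step2[OF assms(3,1,2)] e1_def e2_def
      by (simp add: algebra_simps)
    finally show ?thesis by (simp add: e2_def algebra_simps power2_eq_square)
  qed
  have "t ^ 3 = t * t ^ 2" by (simp add: power2_eq_square power3_eq_cube)
  also have "\<dots> = t ^ 2 - c * (t * e2) + c ^ 2 * (t * e1) - c ^ 3 * t"
    by (subst t2) (simp add: algebra_simps power2_eq_square)
  also have "\<dots> = t - c ^ 3 * t - 7 * c ^ 3 + (4 * c ^ 2 - 2 * c ^ 3) * e1 + (c ^ 2 - 2 * c - c ^ 3) * e2"
    unfolding t2 te1 te2 by (simp add: algebra_simps power2_eq_square power3_eq_cube)
  finally show ?thesis by (simp add: t_def e1_def e2_def)
qed

lemma misiu_trace_5_3_9: "misiu_trace 5 3 9 = 686"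
proof -
  let ?B = "cpoly (diff_orb 4 3)"
  let ?T = "\<lambda>j S c. c ^ j * (\<Prod>i\<in>S. poly (orb (4 + i)) c)"
  have "misiu_trace (Suc 4) 3 9 = root_sum ?B (poly (cpoly (theta 4 9)))"
    by (rule misiu_trace_diff) (auto simp: dvd_def)
  also have "\<dots> = root_sum ?B (\<lambda>c. ?T 0 {..<3} c + (- 1 * ?T 3 {..<3} c + (- 7 * ?T 3 {} c
      + (\<Sum>i<3. 4 * ?T 2 {i} c + (- 2 * ?T 3 {i} c
        + (?T 2 ({..<3} - {i}) c + (- 2 * ?T 1 ({..<3} - {i}) c + - 1 * ?T 3 ({..<3} - {i}) c)))))))"
  proof (rule root_sum_cong[OF diff_orb_cpoly_nz])
    fix c assume root: "poly ?B c = 0"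
    define x y z where "x = poly (orb 4) c" and "y = poly (orb 5) c" and "z = poly (orb 6) c"
    have orb_eq: "poly (orb 5) c = poly (orb 4) c ^ 2 + c" "poly (orb 6) c = poly (orb 5) c ^ 2 + c"
      "poly (orb 7) c = poly (orb 6) c ^ 2 + c"
      using poly_orb_Suc[of 4 c] poly_orb_Suc[of 5 c] poly_orb_Suc[of 6 c] by simp_all
    have "poly (orb 7) c = poly (orb 4) c" using diff_orb_root_period[OF root, of 4] by simp
    hence cyc: "x ^ 2 = y - c" "y ^ 2 = z - c" "z ^ 2 = x - c"
      using orb_eq by (auto simp: x_def y_def z_def eq_diff_eq)
    have lt3: "{..<3} = {0, 1, 2::nat}" by auto
    have rem: "{0, Suc 0, 2} - {0} = {Suc 0, 2}" "{0, Suc 0, 2} - {Suc 0} = {0, 2}" "{0, Suc 0, 2} - {2} = {0, Suc 0}"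
      by auto
    have "poly (cpoly (theta 4 9)) c = (x * y * z) ^ 3"
      using poly_theta_mult[of 4 3 c 3] diff_orb_root_period[OF root]
      by (simp add: poly_theta lt3 x_def y_def z_def mult.assoc)
    also note three_cycle_cube[OF cyc]
    finally show "poly (cpoly (theta 4 9)) c = ?T 0 {..<3} c + (- 1 * ?T 3 {..<3} c + (- 7 * ?T 3 {} c
      + (\<Sum>i<3. 4 * ?T 2 {i} c + (- 2 * ?T 3 {i} c
        + (?T 2 ({..<3} - {i}) c + (- 2 * ?T 1 ({..<3} - {i}) c + - 1 * ?T 3 ({..<3} - {i}) c))))))"
      unfolding lt3 by (simp add: rem flip: x_def y_def z_def) (simp add: algebra_simps)
  qed simp
  also have "\<dots> = orbit_trace 4 3 0 {..<3} + (- 1 * orbit_trace 4 3 3 {..<3} + (- 7 * orbit_trace 4 3 3 {}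
      + (\<Sum>i<3. 4 * orbit_trace 4 3 2 {i} + (- 2 * orbit_trace 4 3 3 {i}
        + (orbit_trace 4 3 2 ({..<3} - {i}) + (- 2 * orbit_trace 4 3 1 ({..<3} - {i})
        + - 1 * orbit_trace 4 3 3 ({..<3} - {i})))))))"
    by (simp only: root_sum_add root_sum_sum root_sum_scale orbit_trace_def)
  also have "(\<Sum>i<3. 4 * orbit_trace 4 3 2 {i} + (- 2 * orbit_trace 4 3 3 {i}
        + (orbit_trace 4 3 2 ({..<3} - {i}) + (- 2 * orbit_trace 4 3 1 ({..<3} - {i})
        + - 1 * orbit_trace 4 3 3 ({..<3} - {i}))))) = 0"
  proof (rule sum.neutral, rule ballI)
    fix i :: nat assume i: "i \<in> {..<3}"
    have card: "card ({..<3} - {i}) = 2" using i by simp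
    hence ne: "{..<3} - {i} \<noteq> {}" "{..<3} - {i} \<noteq> {..<3}" "{i} \<noteq> {..<3}"
      using i by (metis card.empty zero_neq_numeral, blast, metis card_lessThan card_1_singleton_iff numeral_eq_one_iff One_nat_def semiring_norm(86))
    have 1: "orbit_trace 4 3 j {i} = 0" if "j \<le> 3" for j
      by (rule orbit_trace_zero) (use that i ne in auto)
    have 2: "orbit_trace 4 3 j ({..<3} - {i}) = 0" if "j \<le> 3" for j
      by (rule orbit_trace_zero) (use that i ne card in auto)
    show "4 * orbit_trace 4 3 2 {i} + (- 2 * orbit_trace 4 3 3 {i}
        + (orbit_trace 4 3 2 ({..<3} - {i}) + (- 2 * orbit_trace 4 3 1 ({..<3} - {i})
        + - 1 * orbit_trace 4 3 3 ({..<3} - {i})))) = 0"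
      using 1 2 by simp
  qed
  also have "orbit_trace 4 3 0 {..<3} = 56" using orbit_trace_full[of 4 3 0] psum_orb_4 by simp
  also have "orbit_trace 4 3 3 {..<3} = - 70" using orbit_trace_full[of 4 3 3] psum_orb_4 by simp
  also have "orbit_trace 4 3 3 {} = - 80" using orbit_trace_empty[of 4 3 3] psum_orb_4 by simp
  finally show ?thesis by simp
qed

text \<open>The polynomial for period 2 is a multiple of the one for period 1, and on the roots of the cofactor
  the product of the two points of the cycle is \<open>c + 1\<close>.\<close>

lemma misiu_trace_pair:
  assumes m: "m \<ge> 1" and j: "j < 2 ^ (m - 1)"
  shows "misiu_trace (Suc m) 2 (2 * j) - misiu_trace (Suc m) 1 (2 * j)
       = (\<Sum>i\<le>j. of_nat (j choose i) * psum (orb (Suc m)) i)"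
proof -
  \<comment> \<open>The cofactor comes from a_(m+2) + a_m = (a_(m+1) + a_m) (a_(m+1) - a_m + 1),
    which holds because a_(m+1) - a_m^2 = c.\<close>
  define q where "q = 1 - orb m"
  define Q where "Q = orb (Suc m) + q"
  have p2: "(2::nat) ^ m = 2 * 2 ^ (m - 1)" using m by (cases m) auto
  have "degree q \<le> 2 ^ (m - 1)"
    unfolding q_def using orb_degree[OF m] by (intro degree_diff_le) auto
  moreover have o: "degree (orb (Suc m)) = 2 ^ m" "lead_coeff (orb (Suc m)) = 1" using orb_degree[of "Suc m"] by auto
  moreover have "(0::nat) < 2 ^ (m - 1)" by simp
  ultimately have deg: "degree q < degree (orb (Suc m))" "j < degree (orb (Suc m)) - degree q"
    using j p2 by linarith+
  have ps: "psum Q i = psum (orb (Suc m)) i" if "i \<le> j" for i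
    unfolding Q_def by (rule psum_add_low[OF o(2) deg(1)]) (use deg(2) that in linarith)
  have "degree Q = 2 ^ m" using monic_add_lower[OF o(2) deg(1)] o(1) unfolding Q_def by metis
  hence Qnz: "Q \<noteq> 0" by auto
  have fac: "cpoly (misiu (Suc m) 2) = cpoly (misiu (Suc m) 1) * Q"
    by (simp add: misiu_def of_int_poly_hom.hom_add Q_def q_def orb_Suc power2_eq_square algebra_simps)
  have "root_sum Q (poly (cpoly (theta (Suc m) (2 * j)))) = root_sum Q (\<lambda>c. \<Sum>i\<le>j. of_nat (j choose i) * c ^ i)"
  proof (rule root_sum_cong[OF Qnz])
    fix c assume root: "poly Q c = 0"
    hence "poly (cpoly (misiu (Suc m) 2)) c = 0" by (simp add: fac)
    hence "poly (cpoly (theta (Suc m) (2 * j))) c = poly (cpoly (theta (Suc m) 2)) c ^ j"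
      by (intro poly_theta_mult misiu_root_period)
    also have "poly (cpoly (theta (Suc m) 2)) c = poly (orb (Suc m)) c * (poly (orb (Suc m)) c ^ 2 + c)"
      by (simp add: poly_theta numeral_2_eq_2 poly_orb_Suc)
    also have "\<dots> = c + 1"
    proof -
      define x where "x = poly (orb m) c"
      have y: "poly (orb (Suc m)) c = x ^ 2 + c" by (simp add: x_def poly_orb_Suc)
      have s: "x ^ 2 + c = x - 1"
        using root unfolding Q_def q_def poly_add poly_diff y by (simp flip: x_def add: algebra_simps)
      hence c: "c = x - 1 - x ^ 2" by (simp add: algebra_simps)
      show ?thesis unfolding y s unfolding c by (simp add: algebra_simps power2_eq_square)
    qed
    also have "(c + 1) ^ j = (\<Sum>i\<le>j. of_nat (j choose i) * c ^ i)" by (simp add: binomial_ring)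
    finally show "poly (cpoly (theta (Suc m) (2 * j))) c = (\<Sum>i\<le>j. of_nat (j choose i) * c ^ i)" .
  qed
  also have "\<dots> = (\<Sum>i\<le>j. of_nat (j choose i) * psum (orb (Suc m)) i)"
    unfolding root_sum_sum root_sum_scale root_sum_pow using ps by (intro sum.cong) auto
  finally show ?thesis
    unfolding fac using root_sum_mult[OF misiu_cpoly_nz[of 1 m] Qnz] by simp
qed

lemma misiu_trace_pair_4: "misiu_trace 4 2 6 - misiu_trace 4 1 6 = - 2"
  using misiu_trace_pair[of 3 3] psum_orb_4 by (simp add: numeral_eq_Suc)

lemma misiu_trace_pair_5: "misiu_trace 5 2 10 - misiu_trace 5 1 10 = - 12"
  using misiu_trace_pair[of 4 5] psum_orb_5 by (simp add: numeral_eq_Suc)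

section \<open>Assembling the traces over G for the small pairs\<close>

lemma moebius_mu_prime: "prime p \<Longrightarrow> moebius_mu p = - 1"
  using moebius_mu_prime_mult[of p 1] prime_gt_1_nat[of p] by auto

lemma moebius_mu_not_squarefree: "x ^ 2 dvd n \<Longrightarrow> x \<noteq> 1 \<Longrightarrow> moebius_mu n = 0"
  by (auto simp: moebius_mu_def squarefree_def)

lemma moebius_mu_small:
  "moebius_mu 2 = - 1" "moebius_mu 3 = - 1" "moebius_mu 4 = 0" "moebius_mu 5 = - 1" "moebius_mu 6 = 1"
  "moebius_mu 7 = - 1" "moebius_mu 8 = 0" "moebius_mu 9 = 0" "moebius_mu 10 = 1"
proof -
  have p: "prime (2::nat)" "prime (3::nat)" "prime (5::nat)" "prime (7::nat)" by simp_all
  from p show "moebius_mu 2 = - 1" "moebius_mu 3 = - 1" "moebius_mu 5 = - 1" "moebius_mu 7 = - 1"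
    by (simp_all only: moebius_mu_prime)
  show "moebius_mu 6 = 1"
    using moebius_mu_prime_mult[of 2 3] p moebius_mu_prime[of 3] by (simp add: squarefree_prime)
  show "moebius_mu 10 = 1"
    using moebius_mu_prime_mult[of 2 5] p moebius_mu_prime[of 5] by (simp add: squarefree_prime)
  show "moebius_mu 4 = 0" "moebius_mu 8 = 0" "moebius_mu 9 = 0"
    using moebius_mu_not_squarefree[of 2 4] moebius_mu_not_squarefree[of 2 8] moebius_mu_not_squarefree[of 3 9] by auto
qed

lemma divisors_numeral:
  "{d. d dvd 2} = {1, 2::nat}" "{d. d dvd 3} = {1, 3::nat}" "{d. d dvd 4} = {1, 2, 4::nat}"
  "{d. d dvd 5} = {1, 5::nat}" "{d. d dvd 6} = {1, 2, 3, 6::nat}" "{d. d dvd 7} = {1, 7::nat}"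
  "{d. d dvd 8} = {1, 2, 4, 8::nat}" "{d. d dvd 9} = {1, 3, 9::nat}" "{d. d dvd 10} = {1, 2, 5, 10::nat}"
proof -
  have *: "{d. d dvd n} = insert 1 (set (filter (\<lambda>d. d dvd n) [2..<Suc n]))" if "n \<ge> 1" for n :: nat
  proof (intro equalityI subsetI)
    fix d assume d: "d \<in> {d. d dvd n}"
    hence "1 \<le> d" "d \<le> n" using that divisor_ge_1[of n d] by (auto dest: dvd_imp_le)
    thus "d \<in> insert 1 (set (filter (\<lambda>d. d dvd n) [2..<Suc n]))" using d by auto
  qed auto
  show "{d. d dvd 2} = {1, 2::nat}" "{d. d dvd 3} = {1, 3::nat}" "{d. d dvd 4} = {1, 2, 4::nat}"
    "{d. d dvd 5} = {1, 5::nat}" "{d. d dvd 6} = {1, 2, 3, 6::nat}" "{d. d dvd 7} = {1, 7::nat}"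
    "{d. d dvd 8} = {1, 2, 4, 8::nat}" "{d. d dvd 9} = {1, 3, 9::nat}" "{d. d dvd 10} = {1, 2, 5, 10::nat}"
    by (simp_all add: *)
qed

lemma theta_sum_1:
  assumes "m \<ge> 1" "n \<ge> 1"
  shows "theta_sum (Suc m) n 1 = (\<Sum>d | d dvd n. of_int (moebius_mu (n div d)) * misiu_trace (Suc m) d n)"
  using theta_sum_eq[of "Suc m" n 1] assms by simp

lemma theta_sum_3_1: "theta_sum 3 1 1 = 2"
  using theta_sum_1[of 2 1] trace_theta[of 2 1] by simp

lemma theta_sum_4_1: "theta_sum 4 1 1 = 4"
  using theta_sum_1[of 3 1] trace_theta[of 3 1] by simp

lemma theta_sum_3_2:
  obtains i :: int where "theta_sum 3 2 1 = of_int (6 - 4 * i)"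
proof -
  obtain i where "misiu_trace 3 1 2 = of_int (4 * i)" using misiu_trace_double_mod_4[of 2 1] by auto
  hence "theta_sum 3 2 1 = of_int (6 - 4 * i)"
    using theta_sum_1[of 2 2] trace_theta[of 2 2] by (simp add: divisors_numeral moebius_mu_small)
  thus ?thesis by (rule that)
qed

lemma theta_sum_3_3: "theta_sum 3 3 1 = 12"
  using theta_sum_1[of 2 3] trace_theta[of 2 3] misiu_trace_3_1_3
  by (simp add: divisors_numeral moebius_mu_small)

lemma theta_sum_3_4:
  obtains i :: int where "theta_sum 3 4 1 = of_int (30 - 4 * i)"
proof -
  obtain i where "misiu_trace 3 2 4 = of_int (4 * i)" using misiu_trace_double_mod_4[of 2 2] by auto
  hence "theta_sum 3 4 1 = of_int (30 - 4 * i)"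
    using theta_sum_1[of 2 4] trace_theta[of 2 4] by (simp add: divisors_numeral moebius_mu_small)
  thus ?thesis by (rule that)
qed

lemma theta_sum_4_3: "theta_sum 4 3 1 = 18"
  using theta_sum_1[of 3 3] trace_theta[of 3 3] misiu_trace_4_1_3
  by (simp add: divisors_numeral moebius_mu_small)

lemma theta_sum_4_4: "theta_sum 4 4 1 = 40"
  using theta_sum_1[of 3 4] trace_theta[of 3 4] misiu_trace_square[of 3 2] psum_orb_3
  by (simp add: divisors_numeral moebius_mu_small)

lemma theta_sum_4_5: "theta_sum 4 5 1 = 100"
  using theta_sum_1[of 3 5] trace_theta[of 3 5] misiu_trace_4_1_5
  by (simp add: divisors_numeral moebius_mu_small)

text \<open>The divisors 1 and 2 enter with opposite Moebius signs, so only the difference from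
  \<open>misiu_trace_pair_4\<close> is needed. The same happens for n = 10 at level 5.\<close>

lemma theta_sum_4_6:
  obtains i :: int where "theta_sum 4 6 1 = of_int (254 - 4 * i)"
proof -
  obtain i where i: "misiu_trace 4 3 6 = of_int (4 * i)" using misiu_trace_double_mod_4[of 3 3] by auto
  have "misiu_trace 4 2 6 = misiu_trace 4 1 6 - 2" using misiu_trace_pair_4 by (simp add: algebra_simps)
  hence "theta_sum 4 6 1 = of_int (254 - 4 * i)"
    using theta_sum_1[of 3 6] trace_theta[of 3 6] i by (simp add: divisors_numeral moebius_mu_small)
  thus ?thesis by (rule that)
qed

lemma theta_sum_5_7: "theta_sum 5 7 1 = 854"
  using theta_sum_1[of 4 7] trace_theta[of 4 7] misiu_trace_5_1_7
  by (simp add: divisors_numeral moebius_mu_small)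

lemma theta_sum_5_8: "theta_sum 5 8 1 = 1600"
  using theta_sum_1[of 4 8] trace_theta[of 4 8] misiu_trace_square[of 4 4] psum_orb_4
  by (simp add: divisors_numeral moebius_mu_small)

lemma theta_sum_5_9: "theta_sum 5 9 1 = 3402"
  using theta_sum_1[of 4 9] trace_theta[of 4 9] misiu_trace_5_3_9
  by (simp add: divisors_numeral moebius_mu_small)

lemma theta_sum_5_10: "theta_sum 5 10 1 = 6860"
proof -
  have "misiu_trace 5 2 10 = misiu_trace 5 1 10 - 12" using misiu_trace_pair_5 by (simp add: algebra_simps)
  thus ?thesis
    using theta_sum_1[of 4 10] trace_theta[of 4 10] misiu_trace_square[of 4 5] psum_orb_4
    by (simp add: divisors_numeral moebius_mu_small)
qed

lemma not_dvd_trace: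
  assumes "m \<ge> 2" "n \<ge> 1" "theta_sum m n 1 = of_int w" "\<not> 2 ^ (n + 1) dvd w"
  shows "\<not> 2 ^ (2 * n + 1) dvd coeff (lam_poly m n) 1"
proof -
  have "complex_of_int (coeff (lam_poly m n) 1) = of_int (- (2 ^ n * w))"
    using coeff_lam_poly_1_theta[OF assms(1,2)] assms(3) by simp
  hence "coeff (lam_poly m n) 1 = - (2 ^ n * w)" by (simp only: of_int_eq_iff)
  moreover have "(2::int) ^ (2 * n + 1) = 2 ^ n * 2 ^ (n + 1)" by (simp flip: power_add)
  ultimately show ?thesis using assms(4) by (simp del: power_Suc)
qed

lemma not_dvd_trace_Suc:
  assumes "m \<ge> 2" "n \<ge> 1" "n + 1 < 2 ^ (m - 1)" "theta_sum m n 1 = of_int w" "\<not> 2 ^ n dvd w"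
  shows "\<not> 2 ^ (2 * n + 1) dvd coeff (lam_poly (Suc m) n) 1"
proof (rule not_dvd_trace)
  show "theta_sum (Suc m) n 1 = of_int (2 * w)"
    using theta_sum_double[of m n 1] assms by simp
qed (use assms in auto)

text \<open>The list consists of the pairs for which the bound on the valuation t allows some k at
  least 2 with n k + 1 at most t but at least 2^(m-1), except for (3,1). For each of them t turns
  out to be at most 2 n, so that no such k exists.\<close>

lemma exceptional_trace:
  assumes "(m, n) \<in> {(2,1),(2,2),(2,3),(2,4),(3,2),(3,3),(3,4),(3,5),(3,6),
      (4,4),(4,5),(4,6),(4,7),(4,8),(5,8),(5,9),(5,10)}"
  shows "\<not> 2 ^ (2 * n + 1) dvd coeff (lam_poly (Suc m) n) 1"
proof -
  obtain i1 where i1: "theta_sum 3 2 1 = of_int (6 - 4 * i1)" by (rule theta_sum_3_2)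
  obtain i2 where i2: "theta_sum 3 4 1 = of_int (30 - 4 * i2)" by (rule theta_sum_3_4)
  obtain i3 where i3: "theta_sum 4 6 1 = of_int (254 - 4 * i3)" by (rule theta_sum_4_6)
  \<comment> \<open>Three of the traces are known only modulo 4; that they are 2 modulo 4 is
    enough.\<close>
  have nd: "\<not> 2 ^ Suc (Suc j) dvd 2 + 4 * (u :: int)" for j u
  proof
    assume "2 ^ Suc (Suc j) dvd 2 + 4 * u"
    moreover have "(2::int) ^ 2 dvd 2 ^ Suc (Suc j)" by (intro le_imp_power_dvd) simp
    ultimately have "2 ^ 2 dvd 2 + 4 * u" by (rule dvd_trans[rotated])
    hence "4 dvd 2 + 4 * u" by simp
    thus False by presburger
  qed
  have nd1: "\<not> 2 ^ Suc (Suc j) dvd 6 - 4 * i1" for j using nd[of j "1 - i1"] by (simp add: algebra_simps)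
  have nd2: "\<not> 2 ^ Suc (Suc j) dvd 30 - 4 * i2" for j using nd[of j "7 - i2"] by (simp add: algebra_simps)
  have nd3: "\<not> 2 ^ Suc (Suc j) dvd 254 - 4 * i3" for j using nd[of j "63 - i3"] by (simp add: algebra_simps)
  from assms consider
      "m = 2" "n = 1" | "m = 2" "n = 2" | "m = 2" "n = 3" | "m = 2" "n = 4"
    | "m = 3" "n = 2" | "m = 3" "n = 3" | "m = 3" "n = 4" | "m = 3" "n = 5" | "m = 3" "n = 6"
    | "m = 4" "n = 4" | "m = 4" "n = 5" | "m = 4" "n = 6" | "m = 4" "n = 7" | "m = 4" "n = 8"
    | "m = 5" "n = 8" | "m = 5" "n = 9" | "m = 5" "n = 10"
    by auto
  thus ?thesis
  proof cases
    case 1 show ?thesis unfolding 1 by (rule not_dvd_trace[where w = 2]) (use theta_sum_3_1 in simp_all)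
  next
    case 2 show ?thesis unfolding 2
      by (rule not_dvd_trace[where w = "6 - 4 * i1"]) (use i1 nd1[of 1] in \<open>simp_all add: numeral_eq_Suc\<close>)
  next
    case 3 show ?thesis unfolding 3 by (rule not_dvd_trace[where w = 12]) (use theta_sum_3_3 in simp_all)
  next
    case 4 show ?thesis unfolding 4
      by (rule not_dvd_trace[where w = "30 - 4 * i2"]) (use i2 nd2[of 3] in \<open>simp_all add: numeral_eq_Suc\<close>)
  next
    case 5 show ?thesis unfolding 5
      by (rule not_dvd_trace_Suc[where w = "6 - 4 * i1"]) (use i1 nd1[of 0] in \<open>simp_all add: numeral_eq_Suc\<close>)
  next
    case 6 show ?thesis unfolding 6 by (rule not_dvd_trace[where w = 18]) (use theta_sum_4_3 in simp_all)
  next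
    case 7 show ?thesis unfolding 7 by (rule not_dvd_trace[where w = 40]) (use theta_sum_4_4 in simp_all)
  next
    case 8 show ?thesis unfolding 8 by (rule not_dvd_trace[where w = 100]) (use theta_sum_4_5 in simp_all)
  next
    case 9 show ?thesis unfolding 9
      by (rule not_dvd_trace[where w = "254 - 4 * i3"]) (use i3 nd3[of 5] in \<open>simp_all add: numeral_eq_Suc\<close>)
  next
    case 10 show ?thesis unfolding 10 by (rule not_dvd_trace_Suc[where w = 40]) (use theta_sum_4_4 in simp_all)
  next
    case 11 show ?thesis unfolding 11 by (rule not_dvd_trace_Suc[where w = 100]) (use theta_sum_4_5 in simp_all)
  next
    case 12 show ?thesis unfolding 12
      by (rule not_dvd_trace_Suc[where w = "254 - 4 * i3"]) (use i3 nd3[of 4] in \<open>simp_all add: numeral_eq_Suc\<close>)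
  next
    case 13 show ?thesis unfolding 13 by (rule not_dvd_trace[where w = 854]) (use theta_sum_5_7 in simp_all)
  next
    case 14 show ?thesis unfolding 14 by (rule not_dvd_trace[where w = 1600]) (use theta_sum_5_8 in simp_all)
  next
    case 15 show ?thesis unfolding 15 by (rule not_dvd_trace_Suc[where w = 1600]) (use theta_sum_5_8 in simp_all)
  next
    case 16 show ?thesis unfolding 16 by (rule not_dvd_trace_Suc[where w = 3402]) (use theta_sum_5_9 in simp_all)
  next
    case 17 show ?thesis unfolding 17 by (rule not_dvd_trace_Suc[where w = 6860]) (use theta_sum_5_10 in simp_all)
  qed
qed

text \<open>Here 2^(2n+1) = 8 does divide the trace, so the pair is kept apart. As 8 is the exact
  power, only k = 2 remains, and it satisfies n k + 1 = 3 < 2^(m-1) = 4.\<close>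

lemma exceptional_trace_3_1: "\<not> 2 ^ 4 dvd coeff (lam_poly (Suc 3) 1) 1"
proof -
  have "complex_of_int (coeff (lam_poly 4 1) 1) = of_int (- 8)"
    using coeff_lam_poly_1_theta[of 4 1] theta_sum_4_1 by simp
  hence "coeff (lam_poly 4 1) 1 = - 8" by (simp only: of_int_eq_iff)
  thus ?thesis by simp
qed

subsection \<open>The induction step\<close>

text \<open>The two bounds on \<open>t\<close> give n at most 2 m, hence t at most 4 m + 1, which is
  below 2^(m-1) from m = 6 on. What remains is a finite check.\<close>

lemma stable_range:
  fixes m n k t :: nat
  assumes m: "m \<ge> 2" and n: "n \<ge> 1" and k: "k \<ge> 1"
    and upper: "2 * t \<le> 2 * m + 2 + 3 * n" and lower: "2 * n + 1 \<le> t" and kt: "n * k + 1 \<le> t"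
    and exc: "(m, n) \<notin> {(2,1),(2,2),(2,3),(2,4),(3,2),(3,3),(3,4),(3,5),(3,6),
      (4,4),(4,5),(4,6),(4,7),(4,8),(5,8),(5,9),(5,10)}"
    and exc31: "(m, n) = (3, 1) \<Longrightarrow> t \<le> 3"
  shows "n * k + 1 < 2 ^ (m - 1)"
proof (cases "m \<ge> 6")
  case True
  have "4 * (i + 6) + 1 < 32 * (2::nat) ^ i" for i by (induction i) auto
  from this[of "m - 6"] True have "4 * m + 1 < 2 ^ 5 * 2 ^ (m - 6)" by simp
  also have "\<dots> = (2::nat) ^ (m - 1)" using True by (simp only: power_add [symmetric]) simp
  finally have "4 * m + 1 < 2 ^ (m - 1)" .
  thus ?thesis using upper lower kt by linarith
next
  case False
  have nm: "n \<le> 2 * m" using upper lower by linarith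
  have "m = 2 \<or> m = 3 \<or> m = 4 \<or> m = 5" using m False by linarith
  thus ?thesis
  proof (elim disjE)
    assume [simp]: "m = 2"
    have "n = 1 \<or> n = 2 \<or> n = 3 \<or> n = 4" using nm n by auto
    thus ?thesis using exc by auto
  next
    assume [simp]: "m = 3"
    have "n = 1 \<or> n = 2 \<or> n = 3 \<or> n = 4 \<or> n = 5 \<or> n = 6" using nm n by auto
    thus ?thesis using exc exc31 kt by auto
  next
    assume [simp]: "m = 4"
    have "n = 1 \<or> n = 2 \<or> n = 3 \<or> n = 4 \<or> n = 5 \<or> n = 6 \<or> n = 7 \<or> n = 8" using nm n by auto
    thus ?thesis using exc kt upper by (elim disjE) (simp_all, presburger+)
  next
    assume [simp]: "m = 5"
    have "n = 1 \<or> n = 2 \<or> n = 3 \<or> n = 4 \<or> n = 5 \<or> n = 6 \<or> n = 7 \<or> n = 8 \<or> n = 9 \<or> n = 10"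
      using nm n by simp presburger
    thus ?thesis using exc kt upper by (elim disjE) (simp_all, presburger+)
  qed
qed

lemma multiplicity_two_le_iff: "x \<noteq> 0 \<Longrightarrow> t \<le> multiplicity 2 x \<longleftrightarrow> 2 ^ t dvd (x :: int)"
  using power_dvd_iff_le_multiplicity[of x "2 :: int" t] by simp

lemma padic_val_two_less_iff:
  assumes "y \<noteq> 0"
  shows "padic_val 2 y < padic_val 2 x \<longleftrightarrow> 2 ^ (multiplicity 2 y + 1) dvd x"
proof (cases "x = 0")
  case False
  thus ?thesis using assms multiplicity_two_le_iff[of x "multiplicity 2 y + 1"]
    by (auto simp: padic_val_def)
qed (use assms in \<open>simp add: padic_val_def\<close>)

lemma padic_val_uminus: "padic_val p (- x) = padic_val p x"
  by (simp add: padic_val_def)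

theorem theorem4p1:
  fixes m n :: nat
  assumes "m \<ge> 2" and "n \<ge> 1"
    and "padic_val 2 (root_trace (multiplier_poly (m + 1) n)) \<le> ereal (real m + 1 + 3 * real n / 2)"
    and "special_poly 2 (multiplier_poly m n)"
  shows "special_poly 2 (multiplier_poly (m + 1) n)"
proof -
  note m = assms(1) and n = assms(2)
  have m': "Suc m \<ge> 2" using m by simp
  define \<epsilon> where "\<epsilon> = coeff (lam_poly (Suc m) n)"
  define \<delta> where "\<delta> = coeff (lam_poly m n)"
  define t where "t = multiplicity 2 (\<epsilon> 1)"
  have "padic_val 2 (root_trace (multiplier_poly (m + 1) n)) = padic_val 2 (\<epsilon> 1)"
    using root_trace_multiplier_poly[OF m' n] by (simp add: \<epsilon>_def padic_val_uminus)
  with assms(3) have bound: "padic_val 2 (\<epsilon> 1) \<le> ereal (real m + 1 + 3 * real n / 2)" by simp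
  \<comment> \<open>A vanishing trace has infinite valuation, which the bound excludes.\<close>
  hence \<epsilon>1: "\<epsilon> 1 \<noteq> 0" by (auto simp: padic_val_def)
  with bound have "real t \<le> real m + 1 + 3 * real n / 2" by (simp add: padic_val_def t_def)
  hence upper: "2 * t \<le> 2 * m + 2 + 3 * n" by linarith
  have t_dvd: "2 ^ i dvd \<epsilon> 1 \<longleftrightarrow> i \<le> t" for i
    using multiplicity_two_le_iff[OF \<epsilon>1, of i] by (simp add: t_def)
  have \<epsilon>_dvd: "2 ^ (n * k + 1) dvd \<epsilon> k" if "k \<ge> 1" for k
    unfolding \<epsilon>_def by (rule lam_poly_coeff_dvd[OF m' n that])
  have t2: "t \<ge> n + 1" using \<epsilon>_dvd[of 1] t_dvd[of "n + 1"] by simp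
  have main: "2 ^ (t + 1) dvd \<epsilon> k" if k: "k \<ge> 2" for k
  proof (cases "t \<le> n * k")
    case True
    hence "(2 :: int) ^ (t + 1) dvd 2 ^ (n * k + 1)" by (intro le_imp_power_dvd) simp
    also have "\<dots> dvd \<epsilon> k" using \<epsilon>_dvd[of k] k by simp
    finally show ?thesis .
  next
    case False
    hence kt: "n * k + 1 \<le> t" by simp
    have "n * 2 \<le> n * k" using k by simp
    hence lower: "2 * n + 1 \<le> t" using kt by linarith
    have "(m, n) \<notin> {(2,1),(2,2),(2,3),(2,4),(3,2),(3,3),(3,4),(3,5),(3,6),
      (4,4),(4,5),(4,6),(4,7),(4,8),(5,8),(5,9),(5,10)}"
      (is "_ \<notin> ?E")
    proof
      assume "(m, n) \<in> ?E"
      from exceptional_trace[OF this] t_dvd[of "2 * n + 1"] lower show False unfolding \<epsilon>_def by simp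
    qed
    moreover have "t \<le> 3" if "(m, n) = (3, 1)"
      using exceptional_trace_3_1 t_dvd[of 4] that unfolding \<epsilon>_def by auto
    ultimately have stable: "n * k + 1 < 2 ^ (m - 1)"
      using stable_range[OF m n _ upper lower kt] k by auto
    have sq: "\<epsilon> i = (\<Sum>j\<le>i. \<delta> j * \<delta> (i - j))" if "i \<le> k" for i
    proof -
      have "n * i \<le> n * k" using that by simp
      hence "n * i + 1 < 2 ^ (m - 1)" using stable by linarith
      from lam_poly_square[OF m n this] show ?thesis
        unfolding \<epsilon>_def \<delta>_def power2_eq_square coeff_mult .
    qed
    have \<delta>0: "\<delta> 0 = 1"
      using multiplier_poly_eq(2)[OF m n] by (simp add: \<delta>_def lam_poly_def)
    have \<epsilon>\<delta>: "\<epsilon> 1 = 2 * \<delta> 1" using sq[of 1] k by (simp add: \<delta>0)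
    hence \<delta>1: "\<delta> 1 \<noteq> 0" using \<epsilon>1 by auto
    have \<delta>_dvd1: "2 ^ i dvd \<delta> 1 \<longleftrightarrow> i + 1 \<le> t" for i
      using t_dvd[of "i + 1"] unfolding \<epsilon>\<delta> by simp
    have mult_\<delta>: "multiplicity 2 (\<delta> 1) = t - 1"
      using multiplicity_two_le_iff[OF \<delta>1] \<delta>_dvd1 t2
      by (metis Nat.add_diff_assoc2 add_diff_cancel_right' add_leD2 diff_le_mono dual_order.antisym le_add_diff_inverse2 le_refl)
    note special = assms(4)[unfolded special_poly_multiplier_iff[OF m n], folded \<delta>_def]
    \<comment> \<open>This is where the strict bound by v_2(2) enters: t at least 3 means 2 (t - 1)
      is at least t + 1, so the mixed products in the square are divisible by 2^(t+1).\<close>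
    have "1 < padic_val 2 (\<delta> 1)" using special by blast
    hence t3: "t \<ge> 3" using \<delta>1 mult_\<delta> by (simp add: padic_val_def one_ereal_def)
    have \<delta>_dvd: "2 ^ t dvd \<delta> i" if "i \<ge> 2" for i
    proof (cases "i \<le> degree (multiplier_poly m n)")
      case True
      hence "padic_val 2 (\<delta> 1) < padic_val 2 (\<delta> i)" using special that by blast
      moreover have "multiplicity 2 (\<delta> 1) + 1 = t" using mult_\<delta> t3 by simp
      ultimately show ?thesis using padic_val_two_less_iff[OF \<delta>1, of "\<delta> i"] by metis
    next
      case False
      thus ?thesis by (simp add: \<delta>_def lam_poly_def coeff_reflect_poly)
    qed
    have \<delta>_dvd': "2 ^ (t - 1) dvd \<delta> i" if "i \<ge> 1" for i
    proof (cases "i = 1")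
      case True
      thus ?thesis using \<delta>_dvd1[of "t - 1"] t3 by simp
    next
      case False
      have "(2 :: int) ^ (t - 1) dvd 2 ^ t" by (intro le_imp_power_dvd) simp
      thus ?thesis using \<delta>_dvd[of i] False that by (auto intro: dvd_trans)
    qed
    have "\<epsilon> k = (\<Sum>j\<in>insert 0 (insert k {0<..<k}). \<delta> j * \<delta> (k - j))"
      unfolding sq[OF le_refl] by (rule sum.cong) (use k in auto)
    also have "\<dots> = 2 * \<delta> k + (\<Sum>j\<in>{0<..<k}. \<delta> j * \<delta> (k - j))"
      using k by (simp add: \<delta>0)
    also have "2 ^ (t + 1) dvd \<dots>"
    proof (intro dvd_add dvd_sum)
      show "2 ^ (t + 1) dvd 2 * \<delta> k" using \<delta>_dvd[OF k] by simp
      fix j assume "j \<in> {0<..<k}"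
      hence "2 ^ (t - 1) * 2 ^ (t - 1) dvd \<delta> j * \<delta> (k - j)" by (intro mult_dvd_mono \<delta>_dvd') auto
      moreover have "(2 :: int) ^ (t + 1) dvd 2 ^ (t - 1) * 2 ^ (t - 1)"
        using t3 unfolding power_add [symmetric] by (intro le_imp_power_dvd) simp
      ultimately show "2 ^ (t + 1) dvd \<delta> j * \<delta> (k - j)" by (rule dvd_trans[rotated])
    qed
    finally show ?thesis .
  qed
  have "degree (multiplier_poly (Suc m) n) \<noteq> 0"
    using \<epsilon>1 by (auto simp: \<epsilon>_def lam_poly_def coeff_reflect_poly split: if_splits)
  moreover have "1 < padic_val 2 (\<epsilon> 1)"
    using \<epsilon>1 t2 n by (simp add: padic_val_def one_ereal_def t_def)
  moreover have "padic_val 2 (\<epsilon> 1) < padic_val 2 (\<epsilon> k)" if "k \<ge> 2" for k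
    using main[OF that] padic_val_two_less_iff[OF \<epsilon>1] by (simp add: t_def)
  ultimately show ?thesis
    using special_poly_multiplier_iff[OF m' n] by (simp add: \<epsilon>_def)
qed

end
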